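(* Let $R_d(t)\in\mathsf{SO}(3)$ be a desired attitude with $\dot R_d=R_d\,\omega_d^\times$, let $R(t)\in\mathsf{SO}(3)$ satisfy $\dot R=R\,\omega^\times$, and let $R_e=R_d^\top R$, so that $$\dot R_e=R_e\,\omega_e^\times,\qquad \omega_e=\omega-R_e^\top\omega_d. \tag{E}$$ Let $e_R=\tfrac12(R_e-R_e^\top)^\vee\in\mathbb{R}^3$. Regard the angular velocity $\omega$ as the control input of (E), and consider the nonlinear dynamic inversion control law with state $x_R\in\mathbb{R}^{n}$ $$\dot x_R=A_Rx_R+B_Re_R,\qquad \omega=R_e^\top\omega_d+C_Rx_R+D_Re_R, \tag{C}$$ where $A_R\in\mathbb{R}^{n\times n}$, $B_R\in\mathbb{R}^{n\times 3}$, $C_R\in\mathbb{R}^{3\times n}$, $D_R\in\mathbb{R}^{3\times 3}$. Suppose there exists a positive definite matrix $P\in\mathbb{R}^{n\times n}$ such that $$\mathcal{Q}=\begin{bmatrix} D_R & \left(PB_R+\tfrac12C_R^\top\right)^\top\\ PB_R+\tfrac12C_R^\top & A_R^\top P+PA_R\end{bmatrix}\prec0 .$$ Then the control law (C): 1. renders the desired attitude ($R_e=I$) the almost globally asymptotically stable equilibrium of (E); 2. gives exact local tracking performance, i.e. $\Phi(t)=\Phi_d(t)$ (in the local, small-error description of the closed loop); 3. if the feedforward term $R_e^\top\omega_d$ is ignored in the control law, induces the following local desired dynamics about the stable equilibrium: $$\Phi(s)=-\left[sI-\Gamma_\Phi(s)\right]^{-1}\Gamma_\Phi(s)\,\Phi_d(s),\qquad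 \Gamma_\Phi(s)=C_R\left[sI-A_R\right]^{-1}B_R+D_R .$$
   Context: $\mathsf{SO}(3)=\{R\in\mathbb{R}^{3\times3}: R^\top R=RR^\top=I,\ \det R=1\}$. For $x\in\mathbb{R}^3$, $x^\times$ is the skew-symmetric matrix with $x^\times y=x\times y$ for all $y\in\mathbb{R}^3$; $(\cdot)^\vee$ is the inverse map from skew-symmetric $3\times3$ matrices to $\mathbb{R}^3$. $R$ is the rotation matrix from the body frame to the inertial frame, and $\omega(t),\omega_d(t)\in\mathbb{R}^3$ are the actual and desired angular velocities. $\mathcal Q\prec0$ means that $\mathcal Q$ is negative definite, i.e. $z^\top\mathcal Qz<0$ for all $z\ne0$. Almost global asymptotic stability is meant in the usual sense: the equilibrium is asymptotically stable, and the trajectories of the closed loop of (E) and (C) converge to it from all initial conditions outside a set of measure zero. Local (small-error) description: $\Phi=[\phi,\theta,\psi]^\top$ and $\Phi_d=[\phi_d,\theta_d,\psi_d]^\top$ are the actual and desired Euler angles and $e_\Phi=\Phi-\Phi_d$. Under the small error angle assumption, $R_e\approx I+e_\Phi^\times$, $e_R\approx e_\Phi$, and, neglecting product terms, the local linearized error dynamics are $\dot e_\Phi\approx\omega_e$. Item 2 refers to these local dynamics with the control law (C) substituted. For item 3, $R_e^\top\omega_d\approx\dot\Phi_d$ is used under the small error assumption, so that the local error dynamics are $\dot e_\Phi=\omega-\dot\Phi_d$, with $\omega=C_Rx_R+D_Re_\Phi$ and $\dot x_R=A_Rx_R+B_Re_\Phi$. $\Phi(s)$ and $\Phi_d(s)$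 denote the Laplace transforms of $\Phi(t)$ and $\Phi_d(t)$. *)

theory Defs
  imports "HOL-Analysis.Analysis"
begin

definition SO3 :: "(real^3^3) set" where
  "SO3 = {R. rotation_matrix R}"

definition hat :: "real^3 \<Rightarrow> real^3^3" where
  "hat x = matrix (cross3 x)"

(* Meaningful on skew-symmetric matrices only, which form the range of the injective map hat. *)
definition vee :: "real^3^3 \<Rightarrow> real^3" where
  "vee = inv hat"

definition attitude_error :: "real^3^3 \<Rightarrow> real^3" where
  "attitude_error R = (1/2) *\<^sub>R vee (R - transpose R)"

definition attitude_kinematics :: "(real \<Rightarrow> real^3^3) \<Rightarrow> (real \<Rightarrow> real^3) \<Rightarrow> bool" where
  "attitude_kinematics R w \<longleftrightarrow>
     (\<forall>t\<ge>0. R t \<in> SO3 \<and> (R has_vector_derivative (R t ** hat (w t))) (at t within {0..}))"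

(* The angular velocity w is the input of the error system; E is the attitude error matrix
   (desired attitude transposed, times actual attitude) and x the controller state. *)
definition ndi_closed_loop ::
  "real^'n^'n \<Rightarrow> real^3^'n \<Rightarrow> real^'n^3 \<Rightarrow> real^3^3 \<Rightarrow> (real \<Rightarrow> real^3) \<Rightarrow>
   (real \<Rightarrow> real^3^3) \<Rightarrow> (real \<Rightarrow> real^'n) \<Rightarrow> (real \<Rightarrow> real^3) \<Rightarrow> bool" where
  "ndi_closed_loop A B C D wd E x w \<longleftrightarrow>
     attitude_kinematics E (\<lambda>t. w t - transpose (E t) *v wd t) \<and>
     (\<forall>t\<ge>0. (x has_vector_derivative (A *v x t + B *v attitude_error (E t))) (at t within {0..}) \<and>
            w t = transpose (E t) *v wd t + C *v x t + D *v attitude_error (E t))"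

definition closed_loop_trajectories ::
  "real^'n^'n \<Rightarrow> real^3^'n \<Rightarrow> real^'n^3 \<Rightarrow> real^3^3 \<Rightarrow> (real \<Rightarrow> real^3) \<Rightarrow>
   (real \<Rightarrow> (real^3^3) \<times> (real^'n)) set" where
  "closed_loop_trajectories A B C D wd =
     {\<lambda>t. (E t, x t) | E x. \<exists>w. ndi_closed_loop A B C D wd E x w}"

(* T is a set of trajectories on the time interval {0..}. *)
definition asymptotically_stable ::
  "(real \<Rightarrow> 's::metric_space) set \<Rightarrow> 's \<Rightarrow> bool" where
  "asymptotically_stable T q \<longleftrightarrow>
     (\<lambda>t. q) \<in> T \<and>
     (\<forall>\<epsilon>>0. \<exists>\<delta>>0. \<forall>f\<in>T. dist (f 0) q < \<delta> \<longrightarrow> (\<forall>t\<ge>0. dist (f t) q < \<epsilon>)) \<and>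
     (\<exists>\<delta>>0. \<forall>f\<in>T. dist (f 0) q < \<delta> \<longrightarrow> (f \<longlongrightarrow> q) at_top)"

(* N has k-dimensional Hausdorff measure zero (k > 0). For subsets of a k-dimensional smooth
   submanifold of Euclidean space this is the usual notion of measure zero, i.e. Lebesgue-null
   in every chart. Boundedness is needed because diameter is unspecified on unbounded sets. *)
definition hausdorff_null :: "nat \<Rightarrow> 's::metric_space set \<Rightarrow> bool" where
  "hausdorff_null k N \<longleftrightarrow>
     (\<forall>\<epsilon>>0. \<exists>U :: nat \<Rightarrow> 's set. N \<subseteq> (\<Union>i. U i) \<and> (\<forall>i. bounded (U i)) \<and>
        summable (\<lambda>i. diameter (U i) ^ k) \<and> (\<Sum>i. diameter (U i) ^ k) < \<epsilon>)"

(* X is the state space and k its dimension. The first conjunct keeps the quantification over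
   trajectories from being vacuous for some initial states. *)
definition almost_globally_asymptotically_stable ::
  "nat \<Rightarrow> 's::metric_space set \<Rightarrow> (real \<Rightarrow> 's) set \<Rightarrow> 's \<Rightarrow> bool" where
  "almost_globally_asymptotically_stable k X T q \<longleftrightarrow>
     (\<forall>p\<in>X. \<exists>f\<in>T. f 0 = p) \<and>
     asymptotically_stable T q \<and>
     (\<exists>N\<subseteq>X. hausdorff_null k N \<and> (\<forall>f\<in>T. f 0 \<in> X - N \<longrightarrow> (f \<longlongrightarrow> q) at_top))"

definition positive_definite :: "real^'n^'n \<Rightarrow> bool" where
  "positive_definite P \<longleftrightarrow> transpose P = P \<and> (\<forall>z. z \<noteq> 0 \<longrightarrow> z \<bullet> (P *v z) > 0)"

(* No symmetry is required here: the matrix Q below has the block D, which need not be symmetric. *)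
definition negative_definite :: "real^'n^'n \<Rightarrow> bool" where
  "negative_definite Q \<longleftrightarrow> (\<forall>z. z \<noteq> 0 \<longrightarrow> z \<bullet> (Q *v z) < 0)"

definition block_matrix ::
  "'a^'n^'m \<Rightarrow> 'a^'q^'m \<Rightarrow> 'a^'n^'p \<Rightarrow> 'a^'q^'p \<Rightarrow> 'a^('n + 'q)^('m + 'p)" where
  "block_matrix M11 M12 M21 M22 =
     (\<chi> i j. case i of
        Inl a \<Rightarrow> (case j of Inl b \<Rightarrow> M11 $ a $ b | Inr b \<Rightarrow> M12 $ a $ b)
      | Inr a \<Rightarrow> (case j of Inl b \<Rightarrow> M21 $ a $ b | Inr b \<Rightarrow> M22 $ a $ b))"

definition Q_matrix ::
  "real^'n^'n \<Rightarrow> real^3^'n \<Rightarrow> real^'n^3 \<Rightarrow> real^3^3 \<Rightarrow> real^'n^'n \<Rightarrow> real^(3 + 'n)^(3 + 'n)" where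
  "Q_matrix A B C D P =
     block_matrix D (transpose (P ** B + (1/2) *\<^sub>R transpose C))
                  (P ** B + (1/2) *\<^sub>R transpose C) (transpose A ** P + P ** A)"

(* Small-error closed loop in Euler angles, with error e = \<Phi> - \<Phi>d. Here r is the local value of
   (transpose E) wd, so that e' = w - r, and u is the feedforward term used in the control law:
   u = r for the full law, u = 0 when the feedforward is ignored. *)
definition local_closed_loop ::
  "real^'n^'n \<Rightarrow> real^3^'n \<Rightarrow> real^'n^3 \<Rightarrow> real^3^3 \<Rightarrow> (real \<Rightarrow> real^3) \<Rightarrow> (real \<Rightarrow> real^3) \<Rightarrow>
   (real \<Rightarrow> real^3) \<Rightarrow> (real \<Rightarrow> real^3) \<Rightarrow> (real \<Rightarrow> real^'n) \<Rightarrow> bool" where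
  "local_closed_loop A B C D r u \<Phi> \<Phi>d x \<longleftrightarrow>
     (\<exists>w. \<forall>t\<ge>0.
        ((\<lambda>t. \<Phi> t - \<Phi>d t) has_vector_derivative (w t - r t)) (at t within {0..}) \<and>
        (x has_vector_derivative (A *v x t + B *v (\<Phi> t - \<Phi>d t))) (at t within {0..}) \<and>
        w t = u t + C *v x t + D *v (\<Phi> t - \<Phi>d t))"

definition laplace_integrand :: "(real \<Rightarrow> real^'m) \<Rightarrow> complex \<Rightarrow> real \<Rightarrow> complex^'m" where
  "laplace_integrand f s t = (\<chi> i. exp (- s * of_real t) * of_real (f t $ i))"

definition laplace_exists :: "(real \<Rightarrow> real^'m) \<Rightarrow> complex \<Rightarrow> bool" where
  "laplace_exists f s \<longleftrightarrow> laplace_integrand f s absolutely_integrable_on {0..}"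

definition laplace :: "(real \<Rightarrow> real^'m) \<Rightarrow> complex \<Rightarrow> complex^'m" where
  "laplace f s = integral {0..} (laplace_integrand f s)"

definition complex_matrix :: "real^'n^'m \<Rightarrow> complex^'n^'m" where
  "complex_matrix M = (\<chi> i j. of_real (M $ i $ j))"

definition transfer_matrix ::
  "real^'n^'n \<Rightarrow> real^'p^'n \<Rightarrow> real^'n^'q \<Rightarrow> real^'p^'q \<Rightarrow> complex \<Rightarrow> complex^'p^'q" where
  "transfer_matrix A B C D s =
     complex_matrix C ** matrix_inv (mat s - complex_matrix A) ** complex_matrix B
       + complex_matrix D"

end

theory Submission
  imports Defs
begin

text \<open>
  The feedforward term cancels \<open>wd\<close>, so the closed loop is autonomous. The energy
  \<open>(3 - trace E) / 2 + x \<bullet> (P *v x)\<close> has derivative \<open>z \<bullet> (Q *v z)\<close> along solutions, where \<open>z\<close> combines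
  \<open>attitude_error E\<close> and \<open>x\<close>. Hence \<open>z\<close> tends to zero, and
  \<open>4 |attitude_error E|^2 = (3 - trace E) (1 + trace E)\<close> on rotations leaves only \<open>E \<rightarrow> mat 1\<close> or
  \<open>trace E \<rightarrow> - 1\<close>. Global solutions exist because the energy makes a bounded Lipschitz truncation of the
  vector field harmless.

  The trajectories with \<open>trace E \<rightarrow> - 1\<close> end near a two-dimensional family of half-turns. For two of them, with
  differences \<open>\<Delta>\<close> and \<open>\<delta>\<close>, the form \<open>|attitude_error \<Delta>|^2 / 2 - \<delta> \<bullet> (P *v \<delta>) - \<kappa> |\<Delta>|^2\<close> would grow
  exponentially if it were positive, so eventually it is nonpositive. This bounds one of the three attitude
  coordinates by the others and \<open>\<delta>\<close>: locally these states form a Lipschitz graph of codimension one, a null set,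
  and pulling it back along the flow costs only a Lipschitz constant.

  The same quadratic form \<open>Q\<close> gives exponential decay of the local error dynamics. With a forcing term it bounds
  the weighted integrals of the state, which makes the Laplace transforms exist, and evaluated on complex vectors
  it makes both matrices invertible.
\<close>

subsection \<open>Sets of Hausdorff measure zero\<close>

text \<open>Half-turns are not isolated equilibria: they fill a surface, so the linearization at
  each of them has a two-dimensional kernel, and an exceptional trajectory is not shown to approach
  a single half-turn. The sign reversal behind the comparison comes from the differential of
  \<open>attitude_error\<close>: turning with angular velocity \<open>v\<close> changes it at the
  rate \<open>v\<close> at \<open>mat 1\<close>, but at the rate
  \<open>- (n \<bullet> v) *\<^sub>R n\<close> at the half-turn about a unit vector
  \<open>n\<close>. A rotation near a half-turn nearly fixes the difference of the attitude errors,
  so the matrix inequality that makes the energy decrease makes the form with the sign of its state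
  part reversed increase.\<close>

lemma hausdorff_null_UN:
  assumes N: "\<And>j::nat. hausdorff_null k (N j)"
  shows "hausdorff_null k (\<Union>j. N j)"
  unfolding hausdorff_null_def
proof (intro allI impI)
  fix \<epsilon> :: real assume e: "\<epsilon> > 0"
  \<comment> \<open>The exponent \<open>j + 2\<close> makes the budgets add up to
    \<open>\<epsilon> / 2\<close>. The bound on partial sums passes to the limit only as \<le>, and
    the spare half restores the strict inequality.\<close>
  have "\<exists>U. N j \<subseteq> (\<Union>i::nat. U i) \<and> (\<forall>i. bounded (U i)) \<and>
        summable (\<lambda>i. diameter (U i) ^ k) \<and> (\<Sum>i. diameter (U i) ^ k) < \<epsilon> * (1/2)^(j+2)" for j
    using N[of j] e unfolding hausdorff_null_def by (elim allE[of _ "\<epsilon> * (1/2)^(j+2)"]) auto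
  then obtain U where U: "\<And>j. N j \<subseteq> (\<Union>i::nat. U j i)" "\<And>i j. bounded (U j i)"
    "\<And>j. summable (\<lambda>i. diameter (U j i) ^ k)" "\<And>j. (\<Sum>i. diameter (U j i) ^ k) < \<epsilon> * (1/2)^(j+2)"
    by metis
  define f where "f = (\<lambda>(j, i). diameter (U j i) ^ k)"
  define W where "W n = (case prod_decode n of (j, i) \<Rightarrow> U j i)" for n
  have f: "diameter (W n) ^ k = f (prod_decode n)" for n
    by (simp add: W_def f_def split: prod.split)
  have f0: "f p \<ge> 0" for p
    using U(2) by (auto simp: f_def split: prod.split intro!: zero_le_power diameter_ge_0)
  have sums: "(\<lambda>j. \<epsilon> * (1/2)^(j+2)) sums (\<epsilon> / 2)"
    using sums_mult[OF power_half_series, of "\<epsilon>/2"] by (simp add: field_simps)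
  \<comment> \<open>Every finite set of index pairs lies in a rectangle, over which the double sum
    can be iterated; nonnegativity makes the enlargement harmless.\<close>
  have partial: "(\<Sum>n<m. f (prod_decode n)) \<le> \<epsilon> / 2" for m
  proof -
    obtain J where J: "fst ` prod_decode ` {..<m} \<subseteq> {..<J}"
      using finite_nat_iff_bounded by (metis finite_imageI finite_lessThan)
    obtain I where I: "snd ` prod_decode ` {..<m} \<subseteq> {..<I}"
      using finite_nat_iff_bounded by (metis finite_imageI finite_lessThan)
    have "(\<Sum>n<m. f (prod_decode n)) = sum f (prod_decode ` {..<m})"
      by (simp add: sum.reindex inj_prod_decode)
    also have "\<dots> \<le> sum f ({..<J} \<times> {..<I})"
      using J I f0 by (intro sum_mono2) (auto simp: image_subset_iff mem_Times_iff)
    also have "\<dots> = (\<Sum>j<J. \<Sum>i<I. f (j, i))"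
      by (simp add: sum.cartesian_product)
    also have "\<dots> \<le> (\<Sum>j<J. \<epsilon> * (1/2)^(j+2))"
    proof (rule sum_mono)
      fix j
      have "(\<Sum>i<I. f (j, i)) \<le> (\<Sum>i. f (j, i))"
        using U(3)[of j] f0 by (intro sum_le_suminf) (auto simp: f_def)
      then show "(\<Sum>i<I. f (j, i)) \<le> \<epsilon> * (1/2)^(j+2)"
        using U(4)[of j] by (simp add: f_def)
    qed
    also have "\<dots> \<le> (\<Sum>j. \<epsilon> * (1/2)^(j+2))"
      using sums e by (intro sum_le_suminf) (auto simp: sums_iff)
    also have "\<dots> = \<epsilon> / 2" using sums by (simp add: sums_iff)
    finally show ?thesis .
  qed
  then have summ: "summable (\<lambda>n. f (prod_decode n))"
    using f0 by (intro summableI_nonneg_bounded)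
  have "(\<Sum>n. f (prod_decode n)) \<le> \<epsilon> / 2"
    using summ partial by (intro suminf_le_const)
  moreover have "(\<Union>j. N j) \<subseteq> (\<Union>n. W n)"
  proof
    fix p assume "p \<in> (\<Union>j. N j)"
    then obtain j i where "p \<in> U j i" using U(1) by blast
    then show "p \<in> (\<Union>n. W n)"
      by (auto simp: W_def intro!: exI[of _ "prod_encode (j, i)"])
  qed
  moreover have "bounded (W n)" for n
    using U(2) by (simp add: W_def split: prod.split)
  ultimately show "\<exists>W :: nat \<Rightarrow> 'a set. (\<Union>j. N j) \<subseteq> (\<Union>i. W i) \<and> (\<forall>i. bounded (W i)) \<and>
      summable (\<lambda>i. diameter (W i) ^ k) \<and> (\<Sum>i. diameter (W i) ^ k) < \<epsilon>"
    using summ e by (intro exI[of _ W]) (auto simp: f)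
qed

lemma hausdorff_null_subset: "hausdorff_null k N \<Longrightarrow> M \<subseteq> N \<Longrightarrow> hausdorff_null k M"
  unfolding hausdorff_null_def by (meson subset_trans)

lemma hausdorff_null_countable_Union:
  assumes "countable I" "\<And>i. i \<in> I \<Longrightarrow> hausdorff_null k (N i)" "k > 0"
  shows "hausdorff_null k (\<Union>i\<in>I. N i)"
proof (cases "I = {}")
  case True
  \<comment> \<open>The covering sets are empty and have diameter 0; \<open>k > 0\<close> turns
    \<open>0 ^ k\<close> into 0.\<close>
  then show ?thesis using \<open>k > 0\<close>
    by (auto simp: hausdorff_null_def power_0_left intro!: exI[of _ "\<lambda>_. {}"])
next
  case False
  then have "(\<Union>i\<in>I. N i) = (\<Union>j. N (from_nat_into I j))"
    using assms(1) by (metis image_image range_from_nat_into)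
  then show ?thesis
    using assms False by (metis (no_types, lifting) hausdorff_null_UN from_nat_into)
qed

text \<open>The image of \<open>S\<close> is covered by about \<open>m ^ DIM('b)\<close> grid cells of side \<open>1/m\<close>, whose preimages
  have diameter \<open>O(1/m)\<close>.\<close>

lemma hausdorff_null_expanding_map:
  fixes g :: "'s::metric_space \<Rightarrow> 'b::euclidean_space"
  assumes dim: "DIM('b) < k" and bdd: "bounded (g ` S)"
    and expand: "\<And>p q. p \<in> S \<Longrightarrow> q \<in> S \<Longrightarrow> dist p q \<le> K * dist (g p) (g q)"
  shows "hausdorff_null k S"
  unfolding hausdorff_null_def
proof (intro allI impI)
  fix \<epsilon> :: real assume e: "\<epsilon> > 0"
  let ?d = "DIM('b)"
  \<comment> \<open>\<open>max K 0\<close> guards against a negative \<open>K\<close>; the dimension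
    enters because the norm is bounded by the sum of the coordinates.\<close>
  define L where "L = max K 0 * ?d"
  have L0: "L \<ge> 0" by (simp add: L_def)
  obtain r where r: "\<And>p. p \<in> S \<Longrightarrow> norm (g p) \<le> r"
    using bdd by (auto simp: bounded_iff)
  obtain R :: nat where R: "R > 0" "\<And>p. p \<in> S \<Longrightarrow> norm (g p) \<le> R"
  proof
    show "Suc (nat \<lceil>r\<rceil>) > 0" by simp
    show "norm (g p) \<le> real (Suc (nat \<lceil>r\<rceil>))" if "p \<in> S" for p
      using r[OF that] by linarith
  qed
  \<comment> \<open>\<open>c / m\<close> is the bound aimed at: at most
    \<open>(3 * R * m) ^ DIM('b)\<close> cells contribute \<open>(L / m) ^ k\<close> each, and
    \<open>k\<close> exceeds the dimension by at least one.\<close>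
  define c where "c = (3 * real R) ^ ?d * L ^ k"
  obtain m :: nat where m: "m > 0" "c / m < \<epsilon>"
  proof -
    obtain m :: nat where "c / \<epsilon> < m" using reals_Archimedean2 by blast
    then have "c / Suc m < \<epsilon>"
      using e by (simp add: divide_less_eq field_simps)
    then show ?thesis using that by blast
  qed
  define F where "F = PiE (Basis :: 'b set) (\<lambda>_. {- int (R * m) .. int (R * m)})"
  define U where "U f = {p \<in> S. \<forall>b\<in>Basis. \<lfloor>real m * (g p \<bullet> b)\<rfloor> = f b}" for f :: "'b \<Rightarrow> int"
  have finF: "finite F" by (simp add: F_def finite_PiE)
  have "card F = (2 * (R * m) + 1) ^ ?d"
    by (simp add: F_def card_PiE nat_add_distrib nat_mult_distrib)
  then have cardF: "real (card F) \<le> (3 * real R * real m) ^ ?d"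
  proof -
    have "2 * (R * m) + 1 \<le> 3 * (R * m)" using R(1) m(1) by simp
    then have "(2 * (R * m) + 1) ^ ?d \<le> (3 * (R * m)) ^ ?d" by (rule power_mono) simp
    then have "real ((2 * (R * m) + 1) ^ ?d) \<le> real ((3 * (R * m)) ^ ?d)" using of_nat_mono by blast
    then show ?thesis using \<open>card F = _\<close> by (simp add: mult.assoc)
  qed
  have cover: "\<exists>f\<in>F. p \<in> U f" if p: "p \<in> S" for p
  proof
    let ?f = "restrict (\<lambda>b. \<lfloor>real m * (g p \<bullet> b)\<rfloor>) Basis"
    show "p \<in> U ?f" using p by (simp add: U_def)
    show "?f \<in> F" unfolding F_def
    proof (rule restrict_PiE_iff[THEN iffD2], intro ballI)
      fix b :: 'b assume b: "b \<in> Basis"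
      have "\<bar>g p \<bullet> b\<bar> \<le> real R"
        using R(2)[OF p] Basis_le_norm[OF b, of "g p"] by simp
      then have "real m * (g p \<bullet> b) \<le> real m * real R" "real m * (- real R) \<le> real m * (g p \<bullet> b)"
        by (intro mult_left_mono; simp)+
      then show "\<lfloor>real m * (g p \<bullet> b)\<rfloor> \<in> {- int (R * m)..int (R * m)}"
        by (simp add: le_floor_iff floor_le_iff algebra_simps)
    qed
  qed
  have dist_U: "dist p q \<le> L / m" if p: "p \<in> U f" and q: "q \<in> U f" for p q f
  proof -
    have "\<bar>(g p - g q) \<bullet> b\<bar> \<le> 1 / m" if b: "b \<in> Basis" for b
    proof -
      have "\<lfloor>real m * (g p \<bullet> b)\<rfloor> = \<lfloor>real m * (g q \<bullet> b)\<rfloor>"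
        using p q b by (simp add: U_def)
      then have "\<bar>real m * (g p \<bullet> b) - real m * (g q \<bullet> b)\<bar> \<le> 1" by linarith
      then have "\<bar>real m\<bar> * \<bar>(g p - g q) \<bullet> b\<bar> \<le> 1"
        by (simp only: abs_mult[symmetric] inner_diff_left right_diff_distrib)
      then show ?thesis using m(1) by (simp add: field_simps)
    qed
    then have "norm (g p - g q) \<le> ?d * (1 / m)"
      using norm_le_l1[of "g p - g q"] sum_bounded_above[of Basis "\<lambda>b. \<bar>(g p - g q) \<bullet> b\<bar>" "1/m"]
      by fastforce
    moreover have "dist p q \<le> max K 0 * dist (g p) (g q)"
      using p q by (intro order_trans[OF expand mult_right_mono]) (auto simp: U_def)
    ultimately have "dist p q \<le> max K 0 * (?d * (1 / m))"
      unfolding dist_norm[of "g p"] by (meson mult_left_mono max.cobounded2 order_trans)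
    then show ?thesis by (simp add: L_def)
  qed
  have bdU: "bounded (U f)" for f
    using dist_U unfolding bounded_def by blast
  have diamU: "diameter (U f) \<le> L / m" for f
  proof (cases "U f = {}")
    case False
    then show ?thesis unfolding diameter_def using dist_U by (auto intro!: cSUP_least)
  qed (use L0 in auto)
  obtain h where h: "bij_betw h {0..<card F} F"
    using ex_bij_betw_nat_finite[OF finF] by blast
  define W where "W i = (if i < card F then U (h i) else {})" for i
  have fin: "diameter (W i) ^ k = 0" if "i \<notin> {0..<card F}" for i
    using that dim by (simp add: W_def)
  have S: "(\<Sum>i. diameter (W i) ^ k) = (\<Sum>i\<in>{0..<card F}. diameter (W i) ^ k)"
    by (rule suminf_finite) (use fin in auto)
  also have "\<dots> \<le> (\<Sum>i\<in>{0..<card F}. (L / m) ^ k)"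
    using diamU bdU by (intro sum_mono power_mono) (auto simp: W_def diameter_ge_0)
  also have "\<dots> = card F * (L / m) ^ k" by simp
  also have "\<dots> \<le> (3 * real R * real m) ^ ?d * (L / m) ^ k"
    using cardF L0 by (intro mult_right_mono) auto
  also have "\<dots> = c * (real m ^ ?d / real m ^ k)"
    by (simp add: c_def power_mult_distrib power_divide)
  also have "\<dots> \<le> c * (1 / m)"
  proof (rule mult_left_mono)
    have "real m ^ (Suc ?d) \<le> real m ^ k"
      using dim m(1) by (intro power_increasing) auto
    then show "real m ^ ?d / real m ^ k \<le> 1 / real m"
      using m(1) by (simp add: field_simps)
    show "0 \<le> c" using L0 by (simp add: c_def)
  qed
  finally have "(\<Sum>i. diameter (W i) ^ k) < \<epsilon>" using m(2) by simp
  moreover have "summable (\<lambda>i. diameter (W i) ^ k)"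
    by (rule summable_finite[of "{0..<card F}"]) (use fin in auto)
  moreover have "bounded (W i)" for i using bdU by (simp add: W_def)
  moreover have "S \<subseteq> (\<Union>i. W i)"
  proof
    fix p assume "p \<in> S"
    then obtain f where f: "f \<in> F" "p \<in> U f" using cover by blast
    then obtain i where "i < card F" "h i = f"
      using h unfolding bij_betw_def by (metis atLeastLessThan_iff imageE)
    then show "p \<in> (\<Union>i. W i)" using f by (auto simp: W_def)
  qed
  ultimately show "\<exists>U :: nat \<Rightarrow> 's set. S \<subseteq> (\<Union>i. U i) \<and> (\<forall>i. bounded (U i)) \<and>
        summable (\<lambda>i. diameter (U i) ^ k) \<and> (\<Sum>i. diameter (U i) ^ k) < \<epsilon>"
    by blast
qed

subsection \<open>Global solutions of Lipschitz differential equations\<close>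

text \<open>The weight \<open>exp (- 2 * L * t)\<close> makes the Picard operator a contraction on \<open>{0..}\<close>, so that no
  continuation argument is needed.\<close>

lemma bounded_lipschitz_global_solution:
  fixes G :: "'a::euclidean_space \<Rightarrow> 'a"
  assumes L: "L > 0" and lip: "\<And>x y. norm (G x - G y) \<le> L * norm (x - y)"
    and bdd: "\<And>x. norm (G x) \<le> M"
  obtains y where "y 0 = y0" "\<And>t. t \<ge> 0 \<Longrightarrow> (y has_vector_derivative G (y t)) (at t within {0..})"
proof -
  \<comment> \<open>The contraction factor comes out as \<open>L / k\<close>, hence 1/2.\<close>
  define k where "k = 2 * L"
  have k: "k > 0" using L by (simp add: k_def)
  have contG: "continuous_on S G" for S
    by (rule lipschitz_on_continuous_on[OF lipschitz_onI[of _ _ L]])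
      (use L lip in \<open>auto simp: dist_norm\<close>)
  have M0: "M \<ge> 0" using bdd[of 0] norm_ge_zero order_trans by blast
  \<comment> \<open>Here \<open>b\<close> stands for the weighted solution
    \<open>exp (- k * t) *\<^sub>R y t\<close>, and \<open>\<Psi> b\<close> is the Picard integral
    of the unweighted one. Bounded continuous functions live on the whole line, so \<open>T\<close>
    uses \<open>max 0 t\<close> to extend by the value at 0.\<close>
  define \<Psi> where "\<Psi> b t = y0 + integral {0..t} (\<lambda>s. G (exp (k * s) *\<^sub>R apply_bcontfun b s))" for b t
  define T where "T b t = exp (- k * max 0 t) *\<^sub>R \<Psi> b (max 0 t)" for b t
  have contI: "continuous_on S (\<lambda>s. G (exp (k * s) *\<^sub>R apply_bcontfun b s))" for b S
    by (rule continuous_on_compose2[OF contG[of UNIV]]) (auto intro!: continuous_intros)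
  have intI: "(\<lambda>s. G (exp (k * s) *\<^sub>R apply_bcontfun b s)) integrable_on {u..v}" for b u v
    by (rule integrable_continuous_real[OF contI])
  have \<Psi>_deriv: "(\<Psi> b has_vector_derivative G (exp (k * t) *\<^sub>R apply_bcontfun b t)) (at t within {0..})"
    if t: "t \<ge> 0" for b t
  proof -
    have "((\<lambda>u. integral {0..u} (\<lambda>s. G (exp (k * s) *\<^sub>R apply_bcontfun b s))) has_vector_derivative
        G (exp (k * t) *\<^sub>R apply_bcontfun b t)) (at t within {0..t+1})"
      by (rule integral_has_vector_derivative[OF contI]) (use t in auto)
    then have "(\<Psi> b has_vector_derivative G (exp (k * t) *\<^sub>R apply_bcontfun b t)) (at t within {0..t+1})"
      unfolding \<Psi>_def by (auto intro!: derivative_eq_intros)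
    moreover have "at t within {0..t+1} = at t within {0..}"
      by (rule at_within_nhd[of _ "{t-1<..<t+1}"]) auto
    ultimately show ?thesis by simp
  qed
  have \<Psi>_cont: "continuous_on {0..} (\<Psi> b)" for b
    unfolding continuous_on_eq_continuous_within
    using \<Psi>_deriv has_vector_derivative_continuous by fastforce
  have T_cont: "continuous_on UNIV (T b)" for b
    unfolding T_def
    by (intro continuous_intros continuous_on_compose2[OF \<Psi>_cont]) auto
  have T_bdd: "norm (T b t) \<le> norm y0 + M / k" for b t
  proof -
    define s where "s = max 0 t"
    have "norm (integral {0..s} (\<lambda>s. G (exp (k * s) *\<^sub>R apply_bcontfun b s))) \<le> M * (s - 0)"
      by (rule integral_bound[OF _ contI]) (use bdd in \<open>auto simp: s_def\<close>)
    then have "norm (T b t) \<le> exp (- k * s) * (norm y0 + M * s)"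
      unfolding T_def \<Psi>_def s_def[symmetric] by (auto intro!: mult_left_mono norm_triangle_le)
    also have "\<dots> = exp (- k * s) * norm y0 + M / k * (k * s * exp (- (k * s)))"
      using k by (simp add: field_simps)
    also have "\<dots> \<le> 1 * norm y0 + M / k * 1"
    proof (intro add_mono mult_mono)
      show "exp (- k * s) \<le> 1" using k by (simp add: s_def)
      have "k * s \<le> exp (k * s)" using exp_ge_add_one_self[of "k * s"] by linarith
      then show "k * s * exp (- (k * s)) \<le> 1" by (simp add: exp_minus field_simps)
    qed (use M0 k in \<open>auto simp: s_def le_max_iff_disj\<close>)
    finally show ?thesis by simp
  qed
  have T_bcontfun: "T b \<in> bcontfun" for b
    unfolding bcontfun_def bounded_iff using T_cont T_bdd by auto
  define \<T> where "\<T> b = Bcontfun (T b)" for b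
  have apply_T: "apply_bcontfun (\<T> b) = T b" for b
    unfolding \<T>_def using T_bcontfun by (simp add: Bcontfun_inverse)
  have exp_int: "((\<lambda>s. exp (k * s)) has_integral (exp (k * s') / k - 1 / k)) {0..s'}" if "s' \<ge> 0" for s'
  proof -
    have "((\<lambda>s. exp (k * s)) has_integral (exp (k * s') / k - exp (k * 0) / k)) {0..s'}"
      using k that by (intro fundamental_theorem_of_calculus)
        (auto intro!: derivative_eq_intros simp: has_real_derivative_iff_has_vector_derivative[symmetric])
    then show ?thesis by simp
  qed
  have contraction: "dist (\<T> b) (\<T> c) \<le> (1/2) * dist b c" for b c
  proof (rule dist_bound)
    fix t :: real
    define s where "s = max 0 t"
    have s: "s \<ge> 0" by (simp add: s_def le_max_iff_disj)
    let ?f = "\<lambda>b s. G (exp (k * s) *\<^sub>R apply_bcontfun b s)"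
    have "T b t - T c t = exp (- k * s) *\<^sub>R (integral {0..s} (?f b) - integral {0..s} (?f c))"
      by (simp add: T_def \<Psi>_def s_def scaleR_diff_right scaleR_add_right)
    also have "integral {0..s} (?f b) - integral {0..s} (?f c) = integral {0..s} (\<lambda>u. ?f b u - ?f c u)"
      by (rule Henstock_Kurzweil_Integration.integral_diff[symmetric]) (rule intI)+
    finally have eq: "norm (T b t - T c t) = exp (- k * s) * norm (integral {0..s} (\<lambda>u. ?f b u - ?f c u))"
      by simp
    have "norm (integral {0..s} (\<lambda>u. ?f b u - ?f c u)) \<le> integral {0..s} (\<lambda>u. L * dist b c * exp (k * u))"
    proof (rule integral_norm_bound_integral)
      show "(\<lambda>u. L * dist b c * exp (k * u)) integrable_on {0..s}"
        by (intro integrable_continuous_real continuous_intros)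
      fix u
      have "norm (?f b u - ?f c u) \<le> L * norm (exp (k * u) *\<^sub>R (apply_bcontfun b u - apply_bcontfun c u))"
        using lip by (metis scaleR_diff_right)
      also have "\<dots> \<le> L * (exp (k * u) * dist b c)"
        using L dist_bounded[of b u c] by (auto simp: dist_norm intro!: mult_left_mono)
      finally show "norm (?f b u - ?f c u) \<le> L * dist b c * exp (k * u)" by (simp add: mult_ac)
    qed (intro integrable_diff intI)
    also have "\<dots> = L * dist b c * (exp (k * s) / k - 1 / k)"
      using integral_unique[OF exp_int[OF s]] by simp
    also have "\<dots> \<le> L * dist b c * (exp (k * s) / k)"
      using L k by (intro mult_left_mono) auto
    finally have "norm (T b t - T c t) \<le> exp (- k * s) * (L * dist b c * (exp (k * s) / k))"
      unfolding eq by (intro mult_left_mono) auto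
    also have "\<dots> = (1/2) * dist b c"
      using L by (simp add: k_def exp_minus field_simps)
    finally show "dist (apply_bcontfun (\<T> b) t) (apply_bcontfun (\<T> c) t) \<le> 1 / 2 * dist b c"
      by (simp add: apply_T dist_norm)
  qed
  have "\<exists>!b. \<T> b = b"
    by (rule banach_fix_type[of "1/2"]) (use contraction in auto)
  then obtain b where b: "\<T> b = b" by blast
  show thesis
  proof (rule that[of "\<Psi> b"])
    show "\<Psi> b 0 = y0" by (simp add: \<Psi>_def)
    fix t :: real assume t: "t \<ge> 0"
    have "apply_bcontfun b t = exp (- k * t) *\<^sub>R \<Psi> b t"
      using apply_T[of b] t unfolding b by (simp add: T_def)
    then have "exp (k * t) *\<^sub>R apply_bcontfun b t = \<Psi> b t"
      by (simp add: mult_exp_exp)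
    then show "(\<Psi> b has_vector_derivative G (\<Psi> b t)) (at t within {0..})"
      using \<Psi>_deriv[OF t, of b] by simp
  qed
qed

subsection \<open>The hat map and rotations\<close>

unbundle cross3_syntax

lemma hat_mult_vec: "hat x *v y = x \<times> y"
proof -
  have "linear (cross3 x)"
    by (intro linearI) (simp_all add: cross_add_right cross_mult_right)
  then show ?thesis
    by (simp add: hat_def matrix_works)
qed

lemma hat_eq:
  "hat x = vector [vector [0, - x$3, x$2], vector [x$3, 0, - x$1], vector [- x$2, x$1, 0]]"
  by (simp add: hat_def matrix_def vec_eq_iff forall_3 cross3_def axis_def)

lemma hat_nth [simp]:
  "hat x $ 1 $ 1 = 0" "hat x $ 1 $ 2 = - x$3" "hat x $ 1 $ 3 = x$2"
  "hat x $ 2 $ 1 = x$3" "hat x $ 2 $ 2 = 0" "hat x $ 2 $ 3 = - x$1"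
  "hat x $ 3 $ 1 = - x$2" "hat x $ 3 $ 2 = x$1" "hat x $ 3 $ 3 = 0"
  by (simp_all add: hat_eq)

lemma inj_hat: "inj hat"
  by (auto simp: inj_def vec_eq_iff forall_3)

lemma linear_hat: "linear hat"
  by (intro linearI) (simp_all add: vec_eq_iff forall_3 algebra_simps)

lemma attitude_error_eq:
  "attitude_error R = (1/2) *\<^sub>R vector [R$3$2 - R$2$3, R$1$3 - R$3$1, R$2$1 - R$1$2]"
proof -
  have "R - transpose R = hat (vector [R$3$2 - R$2$3, R$1$3 - R$3$1, R$2$1 - R$1$2])"
    by (simp add: vec_eq_iff forall_3 transpose_def)
  then show ?thesis
    by (simp add: attitude_error_def vee_def inj_hat)
qed

lemma attitude_error_nth [simp]:
  "attitude_error R $ 1 = (R$3$2 - R$2$3) / 2"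
  "attitude_error R $ 2 = (R$1$3 - R$3$1) / 2"
  "attitude_error R $ 3 = (R$2$1 - R$1$2) / 2"
  by (simp_all add: attitude_error_eq)

lemma linear_attitude_error: "linear attitude_error"
  by (intro linearI) (simp_all add: vec_eq_iff forall_3 field_simps)

text \<open>The differential of the attitude error along the kinematics. Its dependence on
  \<open>F\<close> decides between stability and instability: it is the identity at
  \<open>mat 1\<close> and minus the projection onto the axis at a half-turn.\<close>

lemma attitude_error_mult_hat:
  "attitude_error (F ** hat v) = (1/2) *\<^sub>R (trace F *\<^sub>R v - transpose F *v v)"
  by (simp add: vec_eq_iff forall_3 trace_def sum_3 matrix_matrix_mult_def
      matrix_vector_mult_def transpose_def field_simps)

lemma trace_mult_hat: "trace (F ** hat v) = - 2 * (attitude_error F \<bullet> v)"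
  by (simp add: trace_def sum_3 matrix_matrix_mult_def inner_vec_def field_simps)

text \<open>The trace of a symmetric matrix times a skew-symmetric one vanishes. As \<open>F\<close>
  is arbitrary, this also applies to differences of rotations, where it removes the term containing
  the possibly large control.\<close>

lemma inner_mult_hat_self: "F \<bullet> (F ** hat v) = 0" for F :: "real^3^3"
  by (simp add: sum_3 matrix_matrix_mult_def inner_vec_def field_simps)

lemma transpose_hat: "transpose (hat v) = - hat v"
  by (simp add: vec_eq_iff forall_3 transpose_def)

lemma hat_attitude_error: "hat (attitude_error R) = (1/2) *\<^sub>R (R - transpose R)"
  by (simp add: vec_eq_iff forall_3 transpose_def field_simps)

lemma attitude_error_mat [simp]: "attitude_error (mat 1) = 0"
  by (simp add: vec_eq_iff forall_3 mat_def)

lemma linear_trace: "linear (trace :: real^3^3 \<Rightarrow> real)"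
  by (intro linearI) (simp_all add: trace_def sum_3 algebra_simps)

lemma bounded_bilinear_matrix_mult:
  "bounded_bilinear ((**) :: real^'b^'a \<Rightarrow> real^'c^'b \<Rightarrow> real^'c^'a)"
  unfolding bilinear_conv_bounded_bilinear[symmetric] bilinear_def
  by (auto intro!: linearI simp: matrix_matrix_mult_def vec_eq_iff sum.distrib algebra_simps
      sum_distrib_left)

lemma linear_transpose: "linear (transpose :: real^'a^'b \<Rightarrow> real^'b^'a)"
  by (intro linearI) (simp_all add: vec_eq_iff transpose_def)

lemma norm_transpose: "norm (transpose F) = norm F" for F :: "real^3^3"
  by (simp add: norm_eq_sqrt_inner inner_vec_def sum_3 transpose_def algebra_simps)

section \<open>Algebra of rotation matrices\<close>

lemma SO3_iff: "R \<in> SO3 \<longleftrightarrow> transpose R ** R = mat 1 \<and> R ** transpose R = mat 1 \<and> det R = 1"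
  by (auto simp: SO3_def rotation_matrix_def orthogonal_matrix_def)

lemma SO3_mat: "mat 1 \<in> SO3"
  by (simp add: SO3_iff)

lemma SO3_mult: "R \<in> SO3 \<Longrightarrow> S \<in> SO3 \<Longrightarrow> R ** S \<in> SO3"
  by (simp add: SO3_def rotation_matrix_def orthogonal_matrix_mul det_mul)

lemma SO3_transpose: "R \<in> SO3 \<Longrightarrow> transpose R \<in> SO3"
  by (auto simp: SO3_iff)

lemma norm_mult_vec_SO3: "R \<in> SO3 \<Longrightarrow> norm (R *v x) = norm x"
proof -
  assume "R \<in> SO3"
  then have "(R *v x) \<bullet> (R *v x) = x \<bullet> x"
    by (metis SO3_iff dot_lmul_matrix matrix_vector_mul_assoc matrix_vector_mul_lid transpose_matrix_vector
        transpose_transpose)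
  then show ?thesis
    by (simp add: norm_eq_sqrt_inner)
qed

lemma inner_matrix_eq_trace: "(F::real^3^3) \<bullet> G = trace (transpose F ** G)"
  by (simp add: inner_vec_def trace_def sum_3 matrix_matrix_mult_def transpose_def)

lemma norm_mult_SO3:
  fixes F :: "real^3^3"
  assumes "R \<in> SO3" shows "norm (R ** F) = norm F"
proof -
  have "(R ** F) \<bullet> (R ** F) = F \<bullet> F"
    using assms by (simp add: inner_matrix_eq_trace matrix_transpose_mul SO3_iff matrix_mul_assoc)
      (metis matrix_mul_assoc matrix_mul_rid)
  then show ?thesis
    by (simp add: norm_eq_sqrt_inner)
qed

lemma inner_self_SO3: "R \<in> SO3 \<Longrightarrow> R \<bullet> R = 3"
  by (simp add: inner_matrix_eq_trace SO3_iff trace_def sum_3 mat_def)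

lemma norm_SO3: "R \<in> SO3 \<Longrightarrow> norm R = sqrt 3"
  by (simp add: norm_eq_sqrt_inner inner_self_SO3)

lemma norm_minus_mat_SO3: "R \<in> SO3 \<Longrightarrow> (norm (R - mat 1))\<^sup>2 = 2 * (3 - trace R)"
  using inner_self_SO3[of R] 
  by (simp add: power2_norm_eq_inner inner_vec_def sum_3 mat_def trace_def algebra_simps)

text \<open>Rotations preserve cross products, so each column is the cross product of the other two;
  a rotation is its own cofactor matrix. Only the diagonal entries are recorded, since the trace
  identity uses no others.\<close>

lemma SO3_columns_cross: assumes "R \<in> SO3"
  shows "R$2$2 * R$3$3 - R$3$2 * R$2$3 = R$1$1"
    "R$3$3 * R$1$1 - R$1$3 * R$3$1 = R$2$2"
    "R$1$1 * R$2$2 - R$2$1 * R$1$2 = R$3$3"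
proof -
  have c: "(R *v x) \<times> (R *v y) = R *v (x \<times> y)" for x y
    using assms by (simp add: SO3_def cross_rotation_matrix)
  show "R$2$2 * R$3$3 - R$3$2 * R$2$3 = R$1$1"
    using c[of "axis 2 1" "axis 3 1", THEN arg_cong, of "\<lambda>v. v $ 1"]
    by (simp add: cross_basis matrix_vector_mul_component cross3_def axis_def inner_vec_def sum_3)
  show "R$3$3 * R$1$1 - R$1$3 * R$3$1 = R$2$2"
    using c[of "axis 3 1" "axis 1 1", THEN arg_cong, of "\<lambda>v. v $ 2"]
    by (simp add: cross_basis matrix_vector_mul_component cross3_def axis_def inner_vec_def sum_3)
  show "R$1$1 * R$2$2 - R$2$1 * R$1$2 = R$3$3"
    using c[of "axis 1 1" "axis 2 1", THEN arg_cong, of "\<lambda>v. v $ 3"]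
    by (simp add: cross_basis matrix_vector_mul_component cross3_def axis_def inner_vec_def sum_3)
qed

text \<open>For a rotation by the angle \<theta>, the attitude error has norm |sin \<theta>| and the
  trace is 1 + 2 cos \<theta>. The factorization shows where the error can vanish.\<close>

lemma attitude_error_norm_SO3: assumes "R \<in> SO3"
  shows "4 * (attitude_error R \<bullet> attitude_error R) = (3 - trace R) * (1 + trace R)"
proof -
  have "R \<bullet> R = 3" using assms by (rule inner_self_SO3)
  with SO3_columns_cross[OF assms]
  have "(R$3$2 - R$2$3)\<^sup>2 + (R$1$3 - R$3$1)\<^sup>2 + (R$2$1 - R$1$2)\<^sup>2 = (3 - trace R) * (1 + trace R)"
    unfolding inner_vec_def trace_def sum_3 inner_real_def
    by (simp add: algebra_simps power2_eq_square)
  then show ?thesis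
    by (simp add: inner_vec_def sum_3 power2_eq_square)
qed

text \<open>The attitude error lies on the rotation axis. In the proof, conjugating
  \<open>hat v\<close> by \<open>R\<close> yields \<open>hat (R *v v)\<close>, while
  \<open>R - transpose R\<close> commutes with \<open>R\<close>.\<close>

lemma SO3_attitude_error_fixed: assumes "R \<in> SO3"
  shows "R *v attitude_error R = attitude_error R"
proof -
  have "hat (R *v attitude_error R) *v y = hat (attitude_error R) *v y" for y
  proof -
    have RRt: "R *v (transpose R *v y) = y" for y
      using assms by (metis matrix_vector_mul_assoc matrix_vector_mul_lid SO3_iff)
    have "(R *v attitude_error R) \<times> y = (R *v attitude_error R) \<times> (R *v (transpose R *v y))"
      by (simp only: RRt)
    also have "\<dots> = R *v (hat (attitude_error R) *v (transpose R *v y))"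
      using assms by (simp add: SO3_def cross_rotation_matrix hat_mult_vec)
    also have "\<dots> = hat (attitude_error R) *v y"
      by (simp add: hat_attitude_error matrix_vector_mult_diff_rdistrib RRt scaleR_matrix_vector_assoc[symmetric]
          matrix_vector_mult_diff_distrib matrix_vector_mult_scaleR del: transpose_matrix_vector)
    finally show ?thesis by (simp add: hat_mult_vec)
  qed
  then show ?thesis
    using inj_hat by (auto simp: matrix_eq inj_def)
qed

text \<open>Euler's rotation theorem, from \<open>det (R - I) = det R * det (I - transpose R) = - det (R - I)\<close>.\<close>

lemma SO3_axis: assumes "R \<in> SO3"
  obtains n where "n \<noteq> 0" "R *v n = n" "transpose R *v n = n"
proof -
  have R: "transpose R ** R = mat 1" "R ** transpose R = mat 1" "det R = 1"
    using assms by (auto simp: SO3_iff)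
  have "R ** (mat 1 - transpose R) = R - mat 1"
    by (simp add: R bounded_bilinear.diff_right[OF bounded_bilinear_matrix_mult])
  then have "det (R - mat 1) = det (mat 1 - transpose R)"
    using R by (metis det_mul mult_1)
  also have "\<dots> = det (transpose (mat 1 - transpose R))" by simp
  also have "transpose (mat 1 - transpose R) = - (R - mat 1)"
    by (simp add: vec_eq_iff transpose_def mat_def)
  also have "det \<dots> = - det (R - mat 1)"
    by (simp add: det_3 algebra_simps)
  finally have "\<not> invertible (R - mat 1)" by (simp add: invertible_det_nz)
  then obtain n where n: "n \<noteq> 0" "(R - mat 1) *v n = 0"
    by (metis invertible_left_inverse matrix_left_invertible_ker)
  then have "R *v n = n" by (simp add: matrix_vector_mult_diff_rdistrib)
  moreover from this have "transpose R *v n = n"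
    using R(1) by (metis matrix_vector_mul_assoc matrix_vector_mul_lid)
  ultimately show ?thesis using n that by blast
qed

unbundle no cross3_syntax

subsection \<open>Monotonicity and dissipation on the half-line\<close>

lemma nondecreasing_on_atLeast:
  fixes f :: "real \<Rightarrow> real"
  assumes "\<And>t. t \<ge> a \<Longrightarrow> (f has_real_derivative f' t) (at t within {a..})"
    and "\<And>t. t \<ge> a \<Longrightarrow> f' t \<ge> 0" and "a \<le> s" "s \<le> t"
  shows "f s \<le> f t"
proof (rule DERIV_nonneg_imp_increasing_open[OF \<open>s \<le> t\<close>])
  show "continuous_on {s..t} f"
    by (rule continuous_on_subset[of "{a..}"])
      (use assms in \<open>auto simp: continuous_on_eq_continuous_within intro!: DERIV_continuous\<close>)
  fix u assume u: "s < u" "u < t"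
  then have "at u within {a..} = at u"
    using assms(3) by (intro at_within_interior) auto
  then show "\<exists>y. (f has_real_derivative y) (at u) \<and> 0 \<le> y"
    using assms(1,2)[of u] assms(3) u by auto
qed

lemma nonincreasing_on_atLeast:
  fixes f :: "real \<Rightarrow> real"
  assumes "\<And>t. t \<ge> a \<Longrightarrow> (f has_real_derivative f' t) (at t within {a..})"
    and "\<And>t. t \<ge> a \<Longrightarrow> f' t \<le> 0" and "a \<le> s" "s \<le> t"
  shows "f t \<le> f s"
  using nondecreasing_on_atLeast[of a "\<lambda>t. - f t" "\<lambda>t. - f' t" s t] assms
  by (auto intro: DERIV_minus)

lemma decseq_real_convergent:
  fixes V :: "real \<Rightarrow> real"
  assumes mono: "\<And>s t. 0 \<le> s \<Longrightarrow> s \<le> t \<Longrightarrow> V t \<le> V s" and lb: "\<And>t. 0 \<le> t \<Longrightarrow> b \<le> V t"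
  obtains l where "(V \<longlongrightarrow> l) at_top" "\<And>t. 0 \<le> t \<Longrightarrow> l \<le> V t"
proof
  have bdd: "bdd_below (V ` {0..})" using lb by (auto simp: bdd_below_def)
  then show le: "Inf (V ` {0..}) \<le> V t" if "0 \<le> t" for t
    using that by (auto intro: cInf_lower)
  show "(V \<longlongrightarrow> Inf (V ` {0..})) at_top"
  proof (rule order_tendstoI)
    fix y assume "y < Inf (V ` {0..})"
    then show "\<forall>\<^sub>F t in at_top. y < V t"
      by (intro eventually_mono[OF eventually_ge_at_top[of 0]] less_le_trans[OF _ le])
  next
    fix y assume "Inf (V ` {0..}) < y"
    then obtain s where "0 \<le> s" "V s < y"
      using cInf_lessD[of "V ` {0..}" y] by auto
    then show "\<forall>\<^sub>F t in at_top. V t < y"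
      using mono by (metis (mono_tags, lifting) eventually_at_top_linorder le_less_trans)
  qed
qed

text \<open>Whenever \<open>g t \<ge> \<epsilon>\<close>, the Lipschitz bound keeps \<open>g\<close>
  above \<open>\<epsilon> / 2\<close> for a duration that does not depend on \<open>t\<close>, so
  \<open>V\<close> then drops by a fixed amount. Once \<open>V\<close> is closer to its limit than
  that amount, this is impossible.\<close>

lemma dissipation_tendsto_zero:
  fixes V g :: "real \<Rightarrow> real"
  assumes deriv: "\<And>t. t \<ge> 0 \<Longrightarrow> (V has_real_derivative V' t) (at t within {0..})"
    and diss: "\<And>t. t \<ge> 0 \<Longrightarrow> V' t \<le> - c * (g t)\<^sup>2" and c: "c > 0"
    and V0: "\<And>t. t \<ge> 0 \<Longrightarrow> V t \<ge> 0" and g0: "\<And>t. t \<ge> 0 \<Longrightarrow> g t \<ge> 0"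
    and lip: "\<And>s t. s \<ge> 0 \<Longrightarrow> s \<le> t \<Longrightarrow> \<bar>g t - g s\<bar> \<le> L * (t - s)"
  shows "(g \<longlongrightarrow> 0) at_top"
proof (rule tendstoI)
  fix \<epsilon> :: real assume e: "\<epsilon> > 0"
  have V'0: "V' t \<le> 0" if "t \<ge> 0" for t
    using diss[OF that] mult_nonneg_nonneg[of c "(g t)\<^sup>2"] c zero_le_power2[of "g t"] by linarith
  obtain l where l: "(V \<longlongrightarrow> l) at_top" "\<And>t. 0 \<le> t \<Longrightarrow> l \<le> V t"
    by (rule decseq_real_convergent[of V 0])
      (use nonincreasing_on_atLeast[of 0 V V'] deriv V'0 V0 in auto)
  \<comment> \<open>Within time \<open>\<tau>\<close> the function \<open>g\<close> changes by at
    most \<open>\<epsilon> / 2\<close>; the added 1 covers \<open>L = 0\<close>.\<close>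
  define \<tau> where "\<tau> = \<epsilon> / (2 * (\<bar>L\<bar> + 1))"
  have \<tau>: "\<tau> > 0" "L * \<tau> \<le> \<epsilon> / 2"
  proof -
    show "\<tau> > 0" using e by (simp add: \<tau>_def)
    have "L * \<tau> \<le> (\<bar>L\<bar> + 1) * \<tau>" using \<open>\<tau> > 0\<close> by (intro mult_right_mono) auto
    also have "\<dots> = \<epsilon> / 2" by (simp add: \<tau>_def field_simps)
    finally show "L * \<tau> \<le> \<epsilon> / 2" .
  qed
  define d where "d = c * (\<epsilon>/2)\<^sup>2"
  have d: "d > 0" using c e by (simp add: d_def)
  have "\<forall>\<^sub>F t in at_top. V t < l + d * \<tau>"
    using l(1) d \<tau> by (intro order_tendstoD(2)[of V l]) auto
  then show "\<forall>\<^sub>F t in at_top. dist (g t) 0 < \<epsilon>"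
    using eventually_ge_at_top[of 0]
  proof eventually_elim
    case (elim t)
    show ?case
    proof (rule ccontr)
      assume "\<not> dist (g t) 0 < \<epsilon>"
      then have gt: "g t \<ge> \<epsilon>" using g0[OF elim(2)] by (simp add: dist_norm)
      define W where "W s = V (min s (t + \<tau>)) + d * min s (t + \<tau>)" for s
      have "V (t + \<tau>) + d * (t + \<tau>) \<le> V t + d * t"
      proof (rule DERIV_nonpos_imp_decreasing_open[of t "t + \<tau>" "\<lambda>s. V s + d * s"])
        show "t \<le> t + \<tau>" using \<tau> by simp
        have "continuous_on {t..t + \<tau>} V"
          by (rule continuous_on_subset[of "{0..}"])
            (use deriv elim in \<open>auto simp: continuous_on_eq_continuous_within intro!: DERIV_continuous\<close>)
        then show "continuous_on {t..t + \<tau>} (\<lambda>s. V s + d * s)" by (intro continuous_intros)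
        fix s assume s: "t < s" "s < t + \<tau>"
        then have "at s within {0..} = at s"
          using elim by (intro at_within_interior) auto
        then have D: "(V has_real_derivative V' s) (at s)"
          using deriv[of s] elim s by auto
        have "\<bar>g s - g t\<bar> \<le> L * (s - t)"
          using lip[of t s] elim s by simp
        also have "\<dots> \<le> \<bar>L\<bar> * \<tau>"
          using s by (intro mult_mono) auto
        finally have "\<bar>g s - g t\<bar> \<le> \<bar>L\<bar> * \<tau>" .
        moreover have "\<bar>L\<bar> * \<tau> \<le> \<epsilon> / 2"
          using \<tau> e by (simp add: \<tau>_def field_simps)
        ultimately have "g s \<ge> \<epsilon> / 2" using gt by linarith
        then have "(g s)\<^sup>2 \<ge> (\<epsilon>/2)\<^sup>2" using e by (intro power_mono) auto
        then have "d \<le> c * (g s)\<^sup>2" using c by (simp add: d_def)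
        then have "V' s \<le> - d" using diss[of s] elim s by simp
        then show "\<exists>y. ((\<lambda>s. V s + d * s) has_real_derivative y) (at s) \<and> y \<le> 0"
          by (intro exI[of _ "V' s + d"]) (auto intro!: derivative_eq_intros D)
      qed
      moreover have "l \<le> V (t + \<tau>)" using l(2)[of "t + \<tau>"] elim \<tau> by simp
      ultimately show False using elim by (simp add: algebra_simps)
    qed
  qed
qed

lemma has_vector_derivative_lipschitz_atLeast:
  fixes f :: "real \<Rightarrow> 'a::real_normed_vector"
  assumes "\<And>t. t \<ge> 0 \<Longrightarrow> (f has_vector_derivative f' t) (at t within {0..})"
    and "\<And>t. t \<ge> 0 \<Longrightarrow> norm (f' t) \<le> L" and "0 \<le> s" "s \<le> t"
  shows "norm (f t - f s) \<le> L * (t - s)"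
proof -
  have "norm (f t - f s) \<le> L * norm (t - s)"
  proof (rule differentiable_bound[where S = "{0..}" and f' = "\<lambda>t h. h *\<^sub>R f' t"])
    fix t :: real assume t: "t \<in> {0..}"
    then show "(f has_derivative (\<lambda>h. h *\<^sub>R f' t)) (at t within {0..})"
      using assms(1) by (simp add: has_vector_derivative_def)
    show "onorm (\<lambda>h. h *\<^sub>R f' t) \<le> L"
      using assms(2)[of t] t by (intro onorm_le) (simp add: mult.commute[of L] mult_left_mono)
  qed (use assms in auto)
  then show ?thesis using assms by simp
qed

text \<open>The minimum over the unit sphere is attained, hence positive, and homogeneity carries it
  to all vectors.\<close>

lemma quadratic_lower_bound:
  fixes f :: "'a::euclidean_space \<Rightarrow> real"
  assumes "continuous_on UNIV f" "\<And>c x. f (c *\<^sub>R x) = c\<^sup>2 * f x" "\<And>x. x \<noteq> 0 \<Longrightarrow> f x > 0"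
  obtains c where "c > 0" "\<And>x. c * (norm x)\<^sup>2 \<le> f x"
proof -
  have "sphere (0::'a) 1 \<noteq> {}" by auto
  moreover have "continuous_on (sphere 0 1) f" using assms(1) continuous_on_subset by blast
  ultimately obtain z where z: "z \<in> sphere 0 1" "\<And>y. y \<in> sphere 0 1 \<Longrightarrow> f z \<le> f y"
    using continuous_attains_inf[of "sphere 0 1" f] by auto
  show ?thesis
  proof (rule that[of "f z"])
    show "f z > 0" using z(1) by (intro assms(3)) auto
    fix x :: 'a
    show "f z * (norm x)\<^sup>2 \<le> f x"
    proof (cases "x = 0")
      case True
      then show ?thesis using assms(2)[of 0 0] by simp
    next
      case False
      have "f z \<le> f (x /\<^sub>R norm x)" using False by (intro z(2)) auto
      also have "\<dots> = f x / (norm x)\<^sup>2" by (simp add: assms(2) power_inverse divide_inverse mult.commute)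
      finally show ?thesis using False by (simp add: pos_le_divide_eq)
    qed
  qed
qed

subsection \<open>The matrix inequality\<close>

lemma sum_UNIV_Plus:
  fixes f :: "'a::finite + 'b::finite \<Rightarrow> 'c::comm_monoid_add"
  shows "(\<Sum>i\<in>UNIV. f i) = (\<Sum>a\<in>UNIV. f (Inl a)) + (\<Sum>b\<in>UNIV. f (Inr b))"
  by (simp add: UNIV_Plus_UNIV[symmetric] sum.Plus del: UNIV_Plus_UNIV)

definition join :: "'a^'n \<Rightarrow> 'a^'m \<Rightarrow> 'a^('n + 'm)" where
  "join e x = (\<chi> i. case i of Inl a \<Rightarrow> e $ a | Inr b \<Rightarrow> x $ b)"

lemma block_matrix_mult_join:
  "block_matrix M11 M12 M21 M22 *v join e x = join (M11 *v e + M12 *v x) (M21 *v e + M22 *v x)"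
  by (auto simp: vec_eq_iff join_def block_matrix_def matrix_vector_mult_def sum_UNIV_Plus split: sum.split)

lemma inner_join: "join e x \<bullet> join f y = e \<bullet> f + x \<bullet> y"
  by (simp add: inner_vec_def sum_UNIV_Plus join_def)

lemma join_eq_0: "join e x = 0 \<longleftrightarrow> e = 0 \<and> x = (0 :: real^'n)"
  by (metis inner_join inner_eq_zero_iff inner_ge_zero add_nonneg_eq_0_iff)

lemma inner_transpose_mult:
  fixes M :: "real^'n^'m"
  shows "x \<bullet> (transpose M *v y) = (M *v x) \<bullet> y"
  by (metis dot_lmul_matrix inner_commute transpose_matrix_vector)

locale ndi_lmi =
  fixes A :: "real^'n^'n" and B :: "real^3^'n" and C :: "real^'n^3" and D :: "real^3^3"
    and P :: "real^'n^'n"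
  assumes P: "positive_definite P" and Q: "negative_definite (Q_matrix A B C D P)"
begin

text \<open>The rate of change of the storage function: of \<open>energy\<close> along closed-loop
  trajectories, and of \<open>local_energy\<close> in the linear loop.\<close>

definition supply_rate :: "real^3 \<Rightarrow> real^'n \<Rightarrow> real" where
  "supply_rate e x = e \<bullet> (C *v x + D *v e) + 2 * (x \<bullet> (P *v (A *v x + B *v e)))"

lemma P_symmetric: "x \<bullet> (P *v y) = (P *v x) \<bullet> y"
  using P inner_transpose_mult[of x P y] by (simp add: positive_definite_def)

text \<open>Each of the two off-diagonal blocks contributes
  \<open>x \<bullet> (P *v (B *v e))\<close> and half of \<open>e \<bullet> (C *v x)\<close>. The
  remaining factor 2 comes from the symmetry of \<open>P\<close>.\<close>

lemma supply_rate_eq_Q: "join e x \<bullet> (Q_matrix A B C D P *v join e x) = supply_rate e x"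
proof -
  have "x \<bullet> (transpose A *v (P *v x)) = x \<bullet> (P *v (A *v x))"
    by (metis inner_transpose_mult P_symmetric inner_commute)
  then show ?thesis
    unfolding Q_matrix_def block_matrix_mult_join inner_join supply_rate_def
    by (simp add: inner_transpose_mult matrix_vector_mult_add_rdistrib matrix_vector_mul_assoc[symmetric]
        matrix_vector_right_distrib inner_add_right inner_add_left scaleR_matrix_vector_assoc[symmetric]
        inner_commute del: transpose_matrix_vector)
qed

lemma supply_rate_bound:
  obtains c where "c > 0" "\<And>e x. supply_rate e x \<le> - c * ((norm e)\<^sup>2 + (norm x)\<^sup>2)"
proof -
  let ?f = "\<lambda>p. - supply_rate (fst p) (snd p)"
  have "\<exists>c>0. \<forall>p. c * (norm p)\<^sup>2 \<le> ?f p"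
  proof (rule quadratic_lower_bound[of ?f])
    show "continuous_on UNIV ?f" unfolding supply_rate_def
      by (intro continuous_intros linear_continuous_on_compose[OF _ matrix_vector_mul_linear])
    show "?f (c *\<^sub>R p) = c\<^sup>2 * ?f p" for c p
      by (simp add: supply_rate_def matrix_vector_mult_scaleR matrix_vector_right_distrib inner_add_right
          power2_eq_square algebra_simps)
    show "?f p > 0" if "p \<noteq> 0" for p
    proof -
      have "join (fst p) (snd p) \<noteq> 0" using that by (cases p) (simp add: join_eq_0 zero_prod_def)
      then have "supply_rate (fst p) (snd p) < 0"
        using Q unfolding supply_rate_eq_Q[symmetric] negative_definite_def by blast
      then show ?thesis by simp
    qed
  qed blast
  then obtain c where c: "c > 0" "\<And>p. c * (norm p)\<^sup>2 \<le> ?f p" by blast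
  show ?thesis
  proof (rule that[OF c(1)])
    show "supply_rate e x \<le> - c * ((norm e)\<^sup>2 + (norm x)\<^sup>2)" for e x
      using c(2)[of "(e, x)"] by (simp add: norm_Pair)
  qed
qed

lemma P_bound:
  obtains p where "p > 0" "\<And>x. p * (norm x)\<^sup>2 \<le> x \<bullet> (P *v x)"
proof (rule quadratic_lower_bound[of "\<lambda>x. x \<bullet> (P *v x)"])
  show "continuous_on UNIV (\<lambda>x. x \<bullet> (P *v x))"
    by (intro continuous_intros linear_continuous_on_compose[OF _ matrix_vector_mul_linear])
  show "(c *\<^sub>R x) \<bullet> (P *v (c *\<^sub>R x)) = c\<^sup>2 * (x \<bullet> (P *v x))" for c x
    by (simp add: matrix_vector_mult_scaleR power2_eq_square)
  show "x \<bullet> (P *v x) > 0" if "x \<noteq> 0" for x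
    using P that by (simp add: positive_definite_def)
qed (rule that)

lemma P_nonneg: "x \<bullet> (P *v x) \<ge> 0"
  using P by (cases "x = 0") (auto simp: positive_definite_def intro: less_imp_le)

lemma P_form_deriv:
  assumes "(x has_vector_derivative w) (at t within S)"
  shows "((\<lambda>t. x t \<bullet> (P *v x t)) has_real_derivative 2 * (x t \<bullet> (P *v w))) (at t within S)"
proof -
  have "((\<lambda>t. P *v x t) has_vector_derivative P *v w) (at t within S)"
    by (rule bounded_linear.has_vector_derivative[OF matrix_vector_mul_bounded_linear assms])
  from bounded_bilinear.has_vector_derivative[OF bounded_bilinear_inner assms this]
  have "((\<lambda>t. x t \<bullet> (P *v x t)) has_vector_derivative x t \<bullet> (P *v w) + w \<bullet> (P *v x t)) (at t within S)" .
  moreover have "w \<bullet> (P *v x t) = x t \<bullet> (P *v w)"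
    by (metis P_symmetric inner_commute)
  ultimately show ?thesis
    by (simp add: has_real_derivative_iff_has_vector_derivative)
qed

end

subsection \<open>Existence of closed-loop trajectories\<close>

text \<open>Boundedness is carried along because products of Lipschitz functions are Lipschitz only
  when the factors are bounded, and the vector field of the loop contains products.\<close>

definition bounded_lipschitz :: "('a::real_normed_vector \<Rightarrow> 'b::real_normed_vector) \<Rightarrow> bool" where
  "bounded_lipschitz f \<longleftrightarrow> (\<exists>L M. \<forall>x y. norm (f x - f y) \<le> L * norm (x - y) \<and> norm (f x) \<le> M)"

lemma bounded_lipschitzI:
  "(\<And>x y. norm (f x - f y) \<le> L * norm (x - y)) \<Longrightarrow> (\<And>x. norm (f x) \<le> M) \<Longrightarrow> bounded_lipschitz f"
  unfolding bounded_lipschitz_def by blast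

lemma bounded_lipschitz_bilinear:
  assumes "bounded_bilinear h" "bounded_lipschitz f" "bounded_lipschitz g"
  shows "bounded_lipschitz (\<lambda>x. h (f x) (g x))"
proof -
  interpret bounded_bilinear h by fact
  obtain K where K: "K > 0" "\<And>a b. norm (h a b) \<le> norm a * norm b * K"
    using pos_bounded by blast
  obtain L M where f: "\<And>x y. norm (f x - f y) \<le> L * norm (x - y)" "\<And>x. norm (f x) \<le> M"
    using assms(2) unfolding bounded_lipschitz_def by blast
  obtain L' M' where g: "\<And>x y. norm (g x - g y) \<le> L' * norm (x - y)" "\<And>x. norm (g x) \<le> M'"
    using assms(3) unfolding bounded_lipschitz_def by blast
  have M0: "M \<ge> 0" "M' \<ge> 0"
    using f(2)[of 0] g(2)[of 0] norm_ge_zero order_trans by blast+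
  show ?thesis
  proof (rule bounded_lipschitzI)
    fix x y
    have "h (f x) (g x) - h (f y) (g y) = h (f x - f y) (g x) + h (f y) (g x - g y)"
      by (simp add: diff_left diff_right)
    also have "norm \<dots> \<le> norm (f x - f y) * norm (g x) * K + norm (f y) * norm (g x - g y) * K"
      by (intro norm_triangle_le add_mono K)
    also have "\<dots> \<le> (L * norm (x - y)) * M' * K + M * (L' * norm (x - y)) * K"
      using f g K(1) M0 order_trans[OF norm_ge_zero f(1)[of x y]]
      by (intro add_mono mult_right_mono mult_mono) auto
    also have "\<dots> = (L * M' * K + M * L' * K) * norm (x - y)" by (simp add: algebra_simps)
    finally show "norm (h (f x) (g x) - h (f y) (g y)) \<le> (L * M' * K + M * L' * K) * norm (x - y)" .
  next
    fix x
    have "norm (h (f x) (g x)) \<le> norm (f x) * norm (g x) * K" by (rule K)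
    also have "\<dots> \<le> M * M' * K" using f g K(1) M0 by (intro mult_right_mono mult_mono) auto
    finally show "norm (h (f x) (g x)) \<le> M * M' * K" .
  qed
qed

lemma bounded_lipschitz_linear:
  assumes "bounded_linear h" "bounded_lipschitz f"
  shows "bounded_lipschitz (\<lambda>x. h (f x))"
proof -
  interpret bounded_linear h by fact
  obtain K where K: "K > 0" "\<And>a. norm (h a) \<le> norm a * K"
    using pos_bounded by blast
  obtain L M where f: "\<And>x y. norm (f x - f y) \<le> L * norm (x - y)" "\<And>x. norm (f x) \<le> M"
    using assms(2) unfolding bounded_lipschitz_def by blast
  show ?thesis
  proof (rule bounded_lipschitzI)
    fix x y
    have "norm (h (f x) - h (f y)) \<le> norm (f x - f y) * K" using K(2)[of "f x - f y"] by (simp add: diff)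
    also have "\<dots> \<le> (L * norm (x - y)) * K" using f K by (intro mult_right_mono) auto
    finally show "norm (h (f x) - h (f y)) \<le> (L * K) * norm (x - y)" by (simp add: mult_ac)
    have "norm (h (f x)) \<le> norm (f x) * K" by (rule K)
    also have "\<dots> \<le> M * K" using f K by (intro mult_right_mono) auto
    finally show "norm (h (f x)) \<le> M * K" .
  qed
qed

lemma bounded_lipschitz_add:
  assumes "bounded_lipschitz f" "bounded_lipschitz g"
  shows "bounded_lipschitz (\<lambda>x. f x + g x)"
proof -
  obtain L M where f: "\<And>x y. norm (f x - f y) \<le> L * norm (x - y)" "\<And>x. norm (f x) \<le> M"
    using assms(1) unfolding bounded_lipschitz_def by blast
  obtain L' M' where g: "\<And>x y. norm (g x - g y) \<le> L' * norm (x - y)" "\<And>x. norm (g x) \<le> M'"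
    using assms(2) unfolding bounded_lipschitz_def by blast
  show ?thesis
  proof (rule bounded_lipschitzI)
    fix x y
    have "norm ((f x + g x) - (f y + g y)) \<le> norm (f x - f y) + norm (g x - g y)"
      by (metis add_diff_add norm_triangle_ineq)
    also have "\<dots> \<le> (L + L') * norm (x - y)"
      using f(1)[of x y] g(1)[of x y] by (simp add: algebra_simps)
    finally show "norm ((f x + g x) - (f y + g y)) \<le> (L + L') * norm (x - y)" .
    show "norm (f x + g x) \<le> M + M'"
      using f(2)[of x] g(2)[of x] by (intro norm_triangle_le) linarith
  qed
qed

lemma bounded_lipschitz_Pair:
  assumes "bounded_lipschitz f" "bounded_lipschitz g"
  shows "bounded_lipschitz (\<lambda>x. (f x, g x))"
proof -
  have "bounded_lipschitz (\<lambda>x. (f x, 0) + (0, g x))"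
    by (intro bounded_lipschitz_add bounded_lipschitz_linear[OF _ assms(1)] bounded_lipschitz_linear[OF _ assms(2)]
        bounded_linear_Pair bounded_linear_ident bounded_linear_zero)
  then show ?thesis by simp
qed

lemma bounded_lipschitz_compose:
  assumes "bounded_lipschitz f" "\<And>x y. norm (g x - g y) \<le> norm (x - y)"
  shows "bounded_lipschitz (\<lambda>x. f (g x))"
proof -
  obtain L M where f: "\<And>x y. norm (f x - f y) \<le> L * norm (x - y)" "\<And>x. norm (f x) \<le> M"
    using assms(1) unfolding bounded_lipschitz_def by blast
  show ?thesis
  proof (rule bounded_lipschitzI)
    fix x y
    have "norm (f (g x) - f (g y)) \<le> max L 0 * norm (g x - g y)"
      by (rule order_trans[OF f(1)]) (simp add: mult_right_mono)
    also have "\<dots> \<le> max L 0 * norm (x - y)"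
      using assms(2) by (intro mult_left_mono) auto
    finally show "norm (f (g x) - f (g y)) \<le> max L 0 * norm (x - y)" .
  qed (rule f(2))
qed

text \<open>The scalar factor of the radial projection onto the ball of radius \<open>r\<close>. It
  is kept separate from the vector so that one factor can be applied to several vectors at
  once.\<close>

definition shrink :: "real \<Rightarrow> 'a::real_normed_vector \<Rightarrow> real" where
  "shrink r x = r / max r (norm x)"

lemma shrink_eq_1: "r > 0 \<Longrightarrow> norm x \<le> r \<Longrightarrow> shrink r x = 1"
  by (simp add: shrink_def max_absorb1)

lemma shrink_nonneg: "r > 0 \<Longrightarrow> shrink r x \<ge> 0"
  by (simp add: shrink_def less_max_iff_disj)

text \<open>The map \<open>max r (norm x)\<close> is 1-Lipschitz. The weight
  \<open>max r (norm y)\<close> dominates both \<open>r\<close> and \<open>norm y\<close>, so a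
  single estimate serves the factor alone and its product with the vector.\<close>

lemma shrink_diff:
  assumes "r > 0"
  shows "\<bar>shrink r x - shrink r y\<bar> * max r (norm y) \<le> norm (x - y)"
proof -
  define a where "a = max r (norm x)"
  define b where "b = max r (norm y)"
  have ab: "a \<ge> r" "b \<ge> r" "a > 0" "b > 0" using assms by (auto simp: a_def b_def)
  have "(shrink r x - shrink r y) * b = (r / a) * (b - a)"
    using ab by (simp add: shrink_def a_def[symmetric] b_def[symmetric] field_simps)
  then have "\<bar>shrink r x - shrink r y\<bar> * b = (r / a) * \<bar>b - a\<bar>"
    using ab assms by (metis abs_mult abs_of_nonneg divide_nonneg_pos less_imp_le)
  also have "\<dots> \<le> 1 * \<bar>b - a\<bar>"
    using ab assms by (intro mult_right_mono) auto
  also have "\<bar>b - a\<bar> \<le> \<bar>norm y - norm x\<bar>" by (auto simp: a_def b_def)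
  also have "\<dots> \<le> norm (x - y)" by (metis norm_minus_commute norm_triangle_ineq3)
  finally show ?thesis by (simp add: b_def)
qed

lemma bounded_lipschitz_shrink:
  assumes "r > 0" shows "bounded_lipschitz (shrink r)"
proof (rule bounded_lipschitzI)
  fix x y :: 'a
  have "\<bar>shrink r x - shrink r y\<bar> * r \<le> \<bar>shrink r x - shrink r y\<bar> * max r (norm y)"
    by (intro mult_left_mono) auto
  then have "\<bar>shrink r x - shrink r y\<bar> * r \<le> norm (x - y)"
    using shrink_diff[OF assms, of x y] by linarith
  then show "norm (shrink r x - shrink r y) \<le> (1 / r) * norm (x - y)"
    using assms by (simp add: field_simps)
  show "norm (shrink r x) \<le> 1"
    using assms by (auto simp: shrink_def divide_le_eq max_def)
qed

lemma bounded_lipschitz_shrink_scaleR: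
  assumes "r > 0" shows "bounded_lipschitz (\<lambda>x. shrink r x *\<^sub>R x)"
proof (rule bounded_lipschitzI)
  fix x y :: 'a
  have 1: "\<bar>shrink r x\<bar> \<le> 1" using assms by (auto simp: shrink_def divide_le_eq max_def)
  have "shrink r x *\<^sub>R x - shrink r y *\<^sub>R y = shrink r x *\<^sub>R (x - y) + (shrink r x - shrink r y) *\<^sub>R y"
    by (simp add: algebra_simps)
  also have "norm \<dots> \<le> \<bar>shrink r x\<bar> * norm (x - y) + \<bar>shrink r x - shrink r y\<bar> * norm y"
    by (metis norm_scaleR norm_triangle_ineq)
  also have "\<dots> \<le> 1 * norm (x - y) + \<bar>shrink r x - shrink r y\<bar> * max r (norm y)"
    using 1 by (intro add_mono mult_right_mono mult_left_mono) auto
  also have "\<dots> \<le> 2 * norm (x - y)" using shrink_diff[OF assms, of x y] by simp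
  finally show "norm (shrink r x *\<^sub>R x - shrink r y *\<^sub>R y) \<le> 2 * norm (x - y)" .
  have "norm x \<le> max r (norm x)" "max r (norm x) > 0" using assms by auto
  then show "norm (shrink r x *\<^sub>R x) \<le> r"
    using assms by (simp add: shrink_def divide_le_eq field_simps)
qed

text \<open>Since \<open>hat v\<close> is skew-symmetric, \<open>E ** transpose E\<close> is
  constant. The determinant is then continuous with values 1 and -1 and cannot leave its initial
  value. With \<open>v\<close> arbitrary, the truncated vector field is covered too.\<close>

lemma rotation_kinematics_invariant:
  assumes deriv: "\<And>t. t \<ge> 0 \<Longrightarrow> (E has_vector_derivative E t ** hat (v t)) (at t within {0..})"
    and E0: "E 0 \<in> SO3" and t: "t \<ge> 0"
  shows "E t \<in> SO3"
proof -
  have "((\<lambda>t. E t ** transpose (E t)) has_vector_derivative 0) (at t within {0..})" if "t \<ge> 0" for t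
  proof -
    have T: "((\<lambda>t. transpose (E t)) has_vector_derivative transpose (E t ** hat (v t))) (at t within {0..})"
      by (rule bounded_linear.has_vector_derivative[OF linear_conv_bounded_linear[THEN iffD1, OF linear_transpose] deriv[OF that]])
    have "E t ** transpose (E t ** hat (v t)) + E t ** hat (v t) ** transpose (E t) = 0"
      by (simp add: matrix_transpose_mul transpose_hat matrix_mul_assoc
          bounded_bilinear.minus_left[OF bounded_bilinear_matrix_mult]
          bounded_bilinear.minus_right[OF bounded_bilinear_matrix_mult])
    then show ?thesis
      using bounded_bilinear.has_vector_derivative[OF bounded_bilinear_matrix_mult deriv[OF that] T] by simp
  qed
  then have "E t ** transpose (E t) = E 0 ** transpose (E 0)" if "t \<ge> 0" for t
    using has_vector_derivative_lipschitz_atLeast[of "\<lambda>t. E t ** transpose (E t)" "\<lambda>_. 0" 0 0 t] that by simp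
  then have EE: "E t ** transpose (E t) = mat 1" if "t \<ge> 0" for t
    using E0 that by (metis SO3_iff)
  then have det1: "det (E t) * det (E t) = 1" if "t \<ge> 0" for t
    using that by (metis det_I det_mul det_transpose)
  have "continuous_on {0..} E"
    unfolding continuous_on_eq_continuous_within
    using deriv has_vector_derivative_continuous by fastforce
  then have cont: "continuous_on {0..t} (\<lambda>t. det (E t))"
    unfolding det_3 by (intro continuous_intros) (auto intro: continuous_on_subset)
  have "det (E t) = 1"
  proof (rule ccontr)
    assume "det (E t) \<noteq> 1"
    then have "det (E t) = -1" using det1[OF t] by (simp add: square_eq_1_iff)
    then obtain s where "0 \<le> s" "det (E s) = 0"
      using IVT2'[of "\<lambda>t. det (E t)" t 0 0] cont t E0 by (auto simp: SO3_iff)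
    then show False using det1[of s] by simp
  qed
  then show ?thesis
    using EE[OF t] by (simp add: SO3_iff matrix_left_right_inverse)
qed

lemma trace_SO3_bounds: assumes "R \<in> SO3" shows "trace R \<le> 3" "- 1 \<le> trace R"
proof -
  have "0 \<le> 2 * (3 - trace R)"
    using norm_minus_mat_SO3[OF assms] by (metis zero_le_power2)
  then show "trace R \<le> 3" by simp
  moreover have "(3 - trace R) * (1 + trace R) \<ge> 0"
    using attitude_error_norm_SO3[OF assms] inner_ge_zero[of "attitude_error R"] by linarith
  ultimately show "- 1 \<le> trace R" by (auto simp: zero_le_mult_iff)
qed

section \<open>The autonomous closed loop and its energy\<close>

context ndi_lmi
begin

definition ctrl :: "real^3 \<Rightarrow> real^'n \<Rightarrow> real^3" where
  "ctrl e x = C *v x + D *v e"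

definition loop_solution :: "(real \<Rightarrow> real^3^3) \<Rightarrow> (real \<Rightarrow> real^'n) \<Rightarrow> bool" where
  "loop_solution E x \<longleftrightarrow> (\<forall>t\<ge>0. E t \<in> SO3 \<and>
     (E has_vector_derivative E t ** hat (ctrl (attitude_error (E t)) (x t))) (at t within {0..}) \<and>
     (x has_vector_derivative A *v x t + B *v attitude_error (E t)) (at t within {0..}))"

lemma closed_loop_trajectories_eq:
  "closed_loop_trajectories A B C D wd = {\<lambda>t. (E t, x t) | E x. loop_solution E x}"
proof -
  have "(\<exists>w. ndi_closed_loop A B C D wd E x w) \<longleftrightarrow> loop_solution E x" for E x
  proof
    assume "\<exists>w. ndi_closed_loop A B C D wd E x w"
    then obtain w where "ndi_closed_loop A B C D wd E x w" ..
    then show "loop_solution E x"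
      by (auto simp: ndi_closed_loop_def attitude_kinematics_def loop_solution_def ctrl_def add.assoc)
  next
    assume "loop_solution E x"
    then show "\<exists>w. ndi_closed_loop A B C D wd E x w"
      by (intro exI[of _ "\<lambda>t. transpose (E t) *v wd t + C *v x t + D *v attitude_error (E t)"])
        (auto simp: ndi_closed_loop_def attitude_kinematics_def loop_solution_def ctrl_def add.assoc)
  qed
  then show ?thesis by (simp add: closed_loop_trajectories_def)
qed

text \<open>With rotation angle \<theta> the first summand is 1 - cos \<theta>: 0 at
  \<open>mat 1\<close>, and 2, its maximum, at the half-turns.\<close>

definition energy :: "real^3^3 \<Rightarrow> real^'n \<Rightarrow> real" where
  "energy R x = (3 - trace R) / 2 + x \<bullet> (P *v x)"

lemma energy_deriv:
  assumes "(E has_vector_derivative E t ** hat v) (at t within S)"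
    and "(x has_vector_derivative w) (at t within S)"
  shows "((\<lambda>t. energy (E t) (x t)) has_real_derivative
     attitude_error (E t) \<bullet> v + 2 * (x t \<bullet> (P *v w))) (at t within S)"
proof -
  have "((\<lambda>t. trace (E t)) has_real_derivative - 2 * (attitude_error (E t) \<bullet> v)) (at t within S)"
    using bounded_linear.has_vector_derivative[OF linear_conv_bounded_linear[THEN iffD1, OF linear_trace] assms(1)]
    by (simp add: has_real_derivative_iff_has_vector_derivative trace_mult_hat)
  with P_form_deriv[OF assms(2)] show ?thesis
    unfolding energy_def by (auto intro!: derivative_eq_intros)
qed

lemma energy_ge: "R \<in> SO3 \<Longrightarrow> x \<bullet> (P *v x) \<le> energy R x" "R \<in> SO3 \<Longrightarrow> 0 \<le> energy R x"
  using trace_SO3_bounds[of R] P_nonneg[of x] by (auto simp: energy_def)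

lemma supply_rate_nonpos: "supply_rate e x \<le> 0"
  by (rule supply_rate_bound)
    (smt (verit, best) mult_minus_left mult_nonneg_nonneg zero_le_power2 add_nonneg_nonneg)

lemma supply_rate_eq: "supply_rate e x = e \<bullet> ctrl e x + 2 * (x \<bullet> (P *v (A *v x + B *v e)))"
  by (simp add: supply_rate_def ctrl_def)

text \<open>The truncation multiplies the attitude error and the state by the same factor
  \<open>s x\<close>. By linearity of the controller, both the angular velocity and the state
  derivative are scaled by it, so the energy of the truncated loop changes at the rate
  \<open>s x\<close> times the supply rate and still cannot increase. The energy then confines the
  state to the region where the factor is 1.\<close>

lemma loop_solution_exists:
  assumes E0: "E0 \<in> SO3"
  obtains E x where "loop_solution E x" "E 0 = E0" "x 0 = x0"
proof -
  obtain p where p: "p > 0" "\<And>x. p * (norm x)\<^sup>2 \<le> x \<bullet> (P *v x)"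
    using P_bound by blast
  \<comment> \<open>The square root bounds \<open>norm (x t)\<close> as long as the energy stays
    below its initial value; adding 1 keeps the radius positive.\<close>
  define r where "r = sqrt (energy E0 x0 / p) + 1"
  have r: "r > 0" using p(1) energy_ge(2)[OF E0, of x0] by (simp add: r_def add_nonneg_pos)
  \<comment> \<open>Rotations have norm \<open>sqrt 3\<close>, so the radius 2 leaves them
    unchanged.\<close>
  define \<pi> where "\<pi> R = shrink 2 R *\<^sub>R R" for R :: "real^3^3"
  define s where "s x = shrink r x" for x :: "real^'n"
  define G where "G = (\<lambda>(R, x).
     (\<pi> R ** hat (ctrl (s x *\<^sub>R attitude_error (\<pi> R)) (s x *\<^sub>R x)),
      A *v (s x *\<^sub>R x) + B *v (s x *\<^sub>R attitude_error (\<pi> R))))"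
  have fst1: "norm (fst p - fst q) \<le> norm (p - q)" for p q :: "(real^3^3) \<times> (real^'n)"
    by (metis fst_diff norm_fst_le prod.collapse)
  have snd1: "norm (snd p - snd q) \<le> norm (p - q)" for p q :: "(real^3^3) \<times> (real^'n)"
    by (metis snd_diff norm_snd_le prod.collapse)
  have bl_hat: "bounded_linear hat" and bl_e: "bounded_linear attitude_error"
    using linear_hat linear_attitude_error by (simp_all add: linear_linear)
  have "bounded_lipschitz (\<lambda>R. \<pi> R)" unfolding \<pi>_def
    by (rule bounded_lipschitz_shrink_scaleR) simp
  then have \<pi>: "bounded_lipschitz (\<lambda>p :: (real^3^3) \<times> (real^'n). \<pi> (fst p))"
    by (rule bounded_lipschitz_compose) (rule fst1)
  have s: "bounded_lipschitz (\<lambda>p :: (real^3^3) \<times> (real^'n). s (snd p))"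
    unfolding s_def by (rule bounded_lipschitz_compose[OF bounded_lipschitz_shrink[OF r] snd1])
  have sx: "bounded_lipschitz (\<lambda>p :: (real^3^3) \<times> (real^'n). s (snd p) *\<^sub>R snd p)"
    unfolding s_def by (rule bounded_lipschitz_compose[OF bounded_lipschitz_shrink_scaleR[OF r] snd1])
  have se: "bounded_lipschitz (\<lambda>p. s (snd p) *\<^sub>R attitude_error (\<pi> (fst p)))"
    by (intro bounded_lipschitz_bilinear[OF bounded_bilinear_scaleR s] bounded_lipschitz_linear[OF bl_e] \<pi>)
  have "bounded_lipschitz G"
    unfolding G_def case_prod_beta ctrl_def
    by (intro bounded_lipschitz_Pair bounded_lipschitz_add
        bounded_lipschitz_bilinear[OF bounded_bilinear_matrix_mult] \<pi> bounded_lipschitz_linear[OF bl_hat]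
        bounded_lipschitz_linear[OF matrix_vector_mul_bounded_linear] se sx)
  then obtain L M where LM: "\<And>p q. norm (G p - G q) \<le> L * norm (p - q)" "\<And>p. norm (G p) \<le> M"
    unfolding bounded_lipschitz_def by blast
  have L1: "norm (G p - G q) \<le> (\<bar>L\<bar> + 1) * norm (p - q)" for p q
    by (rule order_trans[OF LM(1)]) (intro mult_right_mono; simp)
  obtain y where y: "y 0 = (E0, x0)"
      "\<And>t. t \<ge> 0 \<Longrightarrow> (y has_vector_derivative G (y t)) (at t within {0..})"
    by (rule bounded_lipschitz_global_solution[OF _ L1 LM(2), of "(E0, x0)"]) auto
  define E where "E t = fst (y t)" for t
  define x where "x t = snd (y t)" for t
  have E': "(E has_vector_derivative fst (G (y t))) (at t within {0..})" if "t \<ge> 0" for t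
    unfolding E_def by (rule bounded_linear.has_vector_derivative[OF bounded_linear_fst y(2)[OF that]])
  have x': "(x has_vector_derivative snd (G (y t))) (at t within {0..})" if "t \<ge> 0" for t
    unfolding x_def by (rule bounded_linear.has_vector_derivative[OF bounded_linear_snd y(2)[OF that]])
  \<comment> \<open>Moving the factor of \<open>\<pi>\<close> inside \<open>hat\<close> gives the
    truncated field the form of rotation kinematics, so \<open>E\<close> stays in \<open>SO3\<close>
    before the truncation is known to be inactive.\<close>
  have "fst (G (y t)) = E t ** hat (shrink 2 (E t) *\<^sub>R
      ctrl (s (x t) *\<^sub>R attitude_error (\<pi> (E t))) (s (x t) *\<^sub>R x t))" for t
    by (simp add: G_def case_prod_beta E_def x_def \<pi>_def linear_cmul[OF linear_hat]
        bounded_bilinear.scaleR_left[OF bounded_bilinear_matrix_mult]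
        bounded_bilinear.scaleR_right[OF bounded_bilinear_matrix_mult])
  then have SO3: "E t \<in> SO3" if "t \<ge> 0" for t
    using E' E0 y(1) that by (intro rotation_kinematics_invariant[of E _ t]) (auto simp: E_def)
  have \<pi>E: "\<pi> (E t) = E t" if "t \<ge> 0" for t
  proof -
    have "norm (E t) \<le> 2" using norm_SO3[OF SO3[OF that]] by (simp add: real_le_lsqrt)
    then show ?thesis by (simp add: \<pi>_def shrink_eq_1)
  qed
  have G1: "fst (G (y t)) = E t ** hat (s (x t) *\<^sub>R ctrl (attitude_error (E t)) (x t))"
    and G2: "snd (G (y t)) = s (x t) *\<^sub>R (A *v x t + B *v attitude_error (E t))" if "t \<ge> 0" for t
    using \<pi>E[OF that] by (simp_all add: G_def case_prod_beta E_def x_def ctrl_def matrix_vector_mult_scaleR scaleR_add_right)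
  have "((\<lambda>t. energy (E t) (x t)) has_real_derivative
     s (x t) * supply_rate (attitude_error (E t)) (x t)) (at t within {0..})" if "t \<ge> 0" for t
    using energy_deriv[OF E'[OF that, unfolded G1[OF that]] x'[OF that, unfolded G2[OF that]]]
    by (rule DERIV_cong) (simp add: supply_rate_eq algebra_simps matrix_vector_mult_scaleR)
  then have energy: "energy (E t) (x t) \<le> energy E0 x0" if "t \<ge> 0" for t
    using nonincreasing_on_atLeast[of 0 "\<lambda>t. energy (E t) (x t)" _ 0 t] that y(1) shrink_nonneg[OF r] supply_rate_nonpos
    by (fastforce simp: s_def E_def x_def intro!: mult_nonneg_nonpos)
  have "norm (x t) \<le> r" if "t \<ge> 0" for t
  proof -
    have "p * (norm (x t))\<^sup>2 \<le> energy E0 x0"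
      using p(2)[of "x t"] energy_ge(1)[OF SO3[OF that], of "x t"] energy[OF that] by linarith
    then have "(norm (x t))\<^sup>2 \<le> energy E0 x0 / p" using p(1) by (simp add: field_simps)
    then have "norm (x t) \<le> sqrt (energy E0 x0 / p)" by (rule real_le_rsqrt)
    then show ?thesis by (simp add: r_def)
  qed
  then have "s (x t) = 1" if "t \<ge> 0" for t
    using that r by (simp add: s_def shrink_eq_1)
  then have "loop_solution E x"
    using SO3 E' x' G1 G2 by (auto simp: loop_solution_def)
  then show thesis using y(1) that by (auto simp: E_def x_def)
qed

end

subsection \<open>Asymptotic stability\<close>

lemma norm_attitude_error_SO3: assumes "R \<in> SO3" shows "norm (attitude_error R) \<le> 1"
proof -
  have "(3 - trace R) * (1 + trace R) = 4 - (trace R - 1)\<^sup>2"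
    by (simp add: power2_eq_square algebra_simps)
  then have "attitude_error R \<bullet> attitude_error R \<le> 1"
    using attitude_error_norm_SO3[OF assms] zero_le_power2[of "trace R - 1"] by linarith
  then show ?thesis by (simp add: norm_eq_sqrt_inner)
qed

lemma attitude_error_mult_hat_bound:
  assumes "R \<in> SO3" shows "norm (attitude_error (R ** hat v)) \<le> 2 * norm v"
proof -
  have "norm (trace R *\<^sub>R v - transpose R *v v) \<le> \<bar>trace R\<bar> * norm v + norm v"
    by (rule order_trans[OF norm_triangle_ineq4])
      (use norm_mult_vec_SO3[OF SO3_transpose[OF assms]] in \<open>simp del: transpose_matrix_vector\<close>)
  also have "\<dots> \<le> 3 * norm v + norm v"
    using trace_SO3_bounds[OF assms] by (intro add_mono mult_right_mono) auto
  finally show ?thesis by (simp add: attitude_error_mult_hat)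
qed

lemma tendsto_mat_1_if_trace:
  fixes E :: "real \<Rightarrow> real^3^3"
  assumes "\<And>t. t \<ge> 0 \<Longrightarrow> E t \<in> SO3" "((\<lambda>t. trace (E t)) \<longlongrightarrow> 3) at_top"
  shows "(E \<longlongrightarrow> mat 1) at_top"
proof -
  have "((\<lambda>t. sqrt (2 * (3 - trace (E t)))) \<longlongrightarrow> sqrt (2 * (3 - 3))) at_top"
    by (intro tendsto_intros assms)
  moreover have "\<forall>\<^sub>F t in at_top. sqrt (2 * (3 - trace (E t))) = norm (E t - mat 1)"
    using eventually_ge_at_top[of 0]
    by eventually_elim
      (simp only: norm_minus_mat_SO3[OF assms(1), symmetric] real_sqrt_abs abs_norm_cancel)
  ultimately have "((\<lambda>t. norm (E t - mat 1)) \<longlongrightarrow> 0) at_top"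
    using Lim_transform_eventually by fastforce
  then show ?thesis using LIM_zero_iff tendsto_norm_zero_iff by blast
qed

section \<open>Convergence of closed-loop trajectories\<close>

context ndi_lmi
begin

lemma linear_bounds:
  obtains K where "K > 0" "\<And>e x. norm (ctrl e x) \<le> K * norm (e, x)"
    "\<And>e x. norm (A *v x + B *v e) \<le> K * norm (e, x)" "\<And>x. x \<bullet> (P *v x) \<le> K * (norm x)\<^sup>2"
proof -
  have "bounded_linear (\<lambda>p. ctrl (fst p) (snd p))" unfolding ctrl_def
    by (intro bounded_linear_add bounded_linear_compose[OF matrix_vector_mul_bounded_linear]
        bounded_linear_fst bounded_linear_snd)
  then obtain K1 where K1: "K1 > 0" "\<And>p. norm (ctrl (fst p) (snd p)) \<le> norm p * K1"
    using bounded_linear.pos_bounded by blast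
  have "bounded_linear (\<lambda>p. A *v snd p + B *v fst p)"
    by (intro bounded_linear_add bounded_linear_compose[OF matrix_vector_mul_bounded_linear]
        bounded_linear_fst bounded_linear_snd)
  then obtain K2 where K2: "K2 > 0" "\<And>p. norm (A *v snd p + B *v fst p) \<le> norm p * K2"
    using bounded_linear.pos_bounded by blast
  obtain K3 where K3: "K3 > 0" "\<And>x. norm (P *v x) \<le> norm x * K3"
    using bounded_linear.pos_bounded[OF matrix_vector_mul_bounded_linear[of P]] by blast
  define K where "K = K1 + K2 + K3"
  have K: "K1 \<le> K" "K2 \<le> K" "K3 \<le> K" "K > 0" using K1 K2 K3 by (auto simp: K_def)
  show ?thesis
  proof (rule that[OF K(4)])
    fix e x
    have "norm (ctrl e x) \<le> norm (e, x) * K1" using K1(2)[of "(e, x)"] by simp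
    also have "\<dots> \<le> norm (e, x) * K" using K by (intro mult_left_mono) auto
    finally show "norm (ctrl e x) \<le> K * norm (e, x)" by (simp add: mult.commute)
    have "norm (A *v x + B *v e) \<le> norm (e, x) * K2" using K2(2)[of "(e, x)"] by simp
    also have "\<dots> \<le> norm (e, x) * K" using K by (intro mult_left_mono) auto
    finally show "norm (A *v x + B *v e) \<le> K * norm (e, x)" by (simp add: mult.commute)
    have "x \<bullet> (P *v x) \<le> norm x * norm (P *v x)" by (rule norm_cauchy_schwarz)
    also have "\<dots> \<le> norm x * (norm x * K3)" using K3 by (intro mult_left_mono) auto
    also have "\<dots> \<le> norm x * (norm x * K)" using K by (intro mult_left_mono) auto
    finally show "x \<bullet> (P *v x) \<le> K * (norm x)\<^sup>2" by (simp add: power2_eq_square mult_ac)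
  qed
qed

lemma loop_solutionD:
  assumes "loop_solution E x" "t \<ge> 0"
  shows "E t \<in> SO3"
    and "(E has_vector_derivative E t ** hat (ctrl (attitude_error (E t)) (x t))) (at t within {0..})"
    and "(x has_vector_derivative A *v x t + B *v attitude_error (E t)) (at t within {0..})"
  using assms by (auto simp: loop_solution_def)

lemma loop_energy_deriv:
  assumes "loop_solution E x" "t \<ge> 0"
  shows "((\<lambda>t. energy (E t) (x t)) has_real_derivative supply_rate (attitude_error (E t)) (x t))
    (at t within {0..})"
  using energy_deriv[OF loop_solutionD(2,3)[OF assms]] by (simp add: supply_rate_eq)

lemma loop_energy_decreasing:
  assumes "loop_solution E x" "0 \<le> s" "s \<le> t"
  shows "energy (E t) (x t) \<le> energy (E s) (x s)"
  by (rule nonincreasing_on_atLeast[of 0 "\<lambda>t. energy (E t) (x t)"])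
    (use loop_energy_deriv[OF assms(1)] supply_rate_nonpos assms in auto)

lemma loop_state_bounded:
  assumes "loop_solution E x"
  obtains X where "\<And>t. t \<ge> 0 \<Longrightarrow> norm (x t) \<le> X"
proof -
  obtain p where p: "p > 0" "\<And>x. p * (norm x)\<^sup>2 \<le> x \<bullet> (P *v x)"
    using P_bound by blast
  show ?thesis
  proof (rule that)
    fix t :: real assume t: "t \<ge> 0"
    have "p * (norm (x t))\<^sup>2 \<le> energy (E 0) (x 0)"
      using p(2)[of "x t"] energy_ge(1)[OF loop_solutionD(1)[OF assms t], of "x t"]
        loop_energy_decreasing[OF assms order_refl t] by linarith
    then have "(norm (x t))\<^sup>2 \<le> energy (E 0) (x 0) / p" using p(1) by (simp add: field_simps)
    then show "norm (x t) \<le> sqrt (energy (E 0) (x 0) / p)" by (rule real_le_rsqrt)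
  qed
qed

lemma loop_error_tendsto:
  assumes sol: "loop_solution E x"
  shows "((\<lambda>t. (attitude_error (E t), x t)) \<longlongrightarrow> 0) at_top"
proof -
  obtain c where c: "c > 0" "\<And>e x. supply_rate e x \<le> - c * ((norm e)\<^sup>2 + (norm x)\<^sup>2)"
    using supply_rate_bound by blast
  obtain K where K: "K > 0" "\<And>e x. norm (ctrl e x) \<le> K * norm (e, x)"
    "\<And>e x. norm (A *v x + B *v e) \<le> K * norm (e, x)" 
    by (rule linear_bounds) (rule that)
  obtain X where X: "\<And>t. t \<ge> 0 \<Longrightarrow> norm (x t) \<le> X"
    using loop_state_bounded[OF sol] by blast
  define g where "g t = (attitude_error (E t), x t)" for t
  \<comment> \<open>Twice \<open>K * (1 + X)\<close> for the attitude error and once for the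
    state.\<close>
  define L where "L = 3 * (K * (1 + X))"
  have g': "(g has_vector_derivative (attitude_error (E t ** hat (ctrl (attitude_error (E t)) (x t))),
      A *v x t + B *v attitude_error (E t))) (at t within {0..})" if "t \<ge> 0" for t
    unfolding g_def
    by (intro has_vector_derivative_Pair loop_solutionD[OF sol that]
        bounded_linear.has_vector_derivative[OF linear_conv_bounded_linear[THEN iffD1, OF linear_attitude_error]])
  have g_bound: "norm (g t) \<le> 1 + X" if "t \<ge> 0" for t
    using norm_attitude_error_SO3[OF loop_solutionD(1)[OF sol that]] X[OF that]
    unfolding g_def by (intro order_trans[OF norm_Pair_le]) simp
  have L: "norm (attitude_error (E t ** hat (ctrl (attitude_error (E t)) (x t))),
      A *v x t + B *v attitude_error (E t)) \<le> L" if "t \<ge> 0" for t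
  proof -
    have Kg: "K * norm (attitude_error (E t), x t) \<le> K * (1 + X)"
      using g_bound[OF that] K(1) by (simp add: g_def)
    have "norm (attitude_error (E t ** hat (ctrl (attitude_error (E t)) (x t)))) \<le> 2 * (K * (1 + X))"
      by (rule order_trans[OF attitude_error_mult_hat_bound[OF loop_solutionD(1)[OF sol that]]])
        (use order_trans[OF K(2) Kg] in simp)
    moreover have "norm (A *v x t + B *v attitude_error (E t)) \<le> K * (1 + X)"
      using order_trans[OF K(3) Kg] .
    ultimately show ?thesis
      unfolding L_def by (intro order_trans[OF norm_Pair_le]) simp
  qed
  have "((\<lambda>t. norm (g t)) \<longlongrightarrow> 0) at_top"
  proof (rule dissipation_tendsto_zero[where V = "\<lambda>t. energy (E t) (x t)"])
    show "supply_rate (attitude_error (E t)) (x t) \<le> - c * (norm (g t))\<^sup>2" if "t \<ge> 0" for t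
      using c(2) by (simp add: g_def norm_Pair)
    show "\<bar>norm (g t) - norm (g s)\<bar> \<le> L * (t - s)" if "s \<ge> 0" "s \<le> t" for s t
      by (rule order_trans[OF norm_triangle_ineq3]) 
        (rule has_vector_derivative_lipschitz_atLeast[OF g' L that])
  qed (use c loop_energy_deriv[OF sol] energy_ge loop_solutionD(1)[OF sol] in auto)
  then show ?thesis unfolding g_def by (rule tendsto_norm_zero_cancel)
qed

lemma loop_energy_state_tendsto:
  assumes "loop_solution E x"
  shows "((\<lambda>t. x t \<bullet> (P *v x t)) \<longlongrightarrow> 0) at_top"
proof -
  have "(x \<longlongrightarrow> 0) at_top"
    using tendsto_snd[OF loop_error_tendsto[OF assms]] by simp
  moreover from this have "((\<lambda>t. P *v x t) \<longlongrightarrow> P *v 0) at_top"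
    by (rule bounded_linear.tendsto[OF matrix_vector_mul_bounded_linear])
  ultimately show ?thesis using tendsto_inner by fastforce
qed

text \<open>The energy converges and its state part vanishes, so the trace itself has a limit. The
  vanishing attitude error makes this limit a root of \<open>(3 - l) * (1 + l)\<close>.\<close>

lemma loop_trace_tendsto:
  assumes sol: "loop_solution E x"
  shows "((\<lambda>t. trace (E t)) \<longlongrightarrow> 3) at_top \<or> ((\<lambda>t. trace (E t)) \<longlongrightarrow> - 1) at_top"
proof -
  obtain l where l: "((\<lambda>t. energy (E t) (x t)) \<longlongrightarrow> l) at_top"
    by (rule decseq_real_convergent[of "\<lambda>t. energy (E t) (x t)" 0])
      (use loop_energy_decreasing[OF sol] energy_ge loop_solutionD(1)[OF sol] in auto)
  have "((\<lambda>t. 3 - 2 * (energy (E t) (x t) - x t \<bullet> (P *v x t))) \<longlongrightarrow> 3 - 2 * (l - 0)) at_top"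
    by (intro tendsto_intros l loop_energy_state_tendsto[OF sol])
  then have tr: "((\<lambda>t. trace (E t)) \<longlongrightarrow> 3 - 2 * l) at_top"
    by (simp add: energy_def diff_divide_distrib)
  then have "((\<lambda>t. (3 - trace (E t)) * (1 + trace (E t))) \<longlongrightarrow> (3 - (3 - 2 * l)) * (1 + (3 - 2 * l))) at_top"
    by (intro tendsto_intros)
  moreover have "((\<lambda>t. (3 - trace (E t)) * (1 + trace (E t))) \<longlongrightarrow> 0) at_top"
  proof -
    have e: "((\<lambda>t. attitude_error (E t)) \<longlongrightarrow> 0) at_top"
      using tendsto_fst[OF loop_error_tendsto[OF sol]] by simp
    have "((\<lambda>t. 4 * (attitude_error (E t) \<bullet> attitude_error (E t))) \<longlongrightarrow> 4 * (0 \<bullet> (0::real^3))) at_top"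
      by (intro tendsto_intros e)
    moreover have "\<forall>\<^sub>F t in at_top. 4 * (attitude_error (E t) \<bullet> attitude_error (E t)) =
        (3 - trace (E t)) * (1 + trace (E t))"
      using eventually_ge_at_top[of 0]
      by eventually_elim (rule attitude_error_norm_SO3[OF loop_solutionD(1)[OF sol]])
    ultimately show ?thesis by (simp add: tendsto_cong)
  qed
  ultimately have "(3 - (3 - 2 * l)) * (1 + (3 - 2 * l)) = 0"
    by (intro tendsto_unique) auto
  then have "3 - 2 * l = 3 \<or> 3 - 2 * l = - 1" by auto
  with tr show ?thesis by auto
qed

lemma loop_tendsto:
  assumes sol: "loop_solution E x" and tr: "((\<lambda>t. trace (E t)) \<longlongrightarrow> 3) at_top"
  shows "((\<lambda>t. (E t, x t)) \<longlongrightarrow> (mat 1, 0)) at_top"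
  using tendsto_mat_1_if_trace[OF loop_solutionD(1)[OF sol] tr]
    tendsto_snd[OF loop_error_tendsto[OF sol]] by (auto intro: tendsto_Pair)

text \<open>On rotations the attitude part of the energy is exactly a quarter of the squared
  distance to \<open>mat 1\<close>, which makes the energy comparable to the squared distance on the
  whole state space.\<close>

lemma energy_bounds:
  obtains m M where "m > 0" "M > 0"
    "\<And>R x. R \<in> SO3 \<Longrightarrow> m * (dist (R, x) (mat 1, 0))\<^sup>2 \<le> energy R x"
    "\<And>R x. R \<in> SO3 \<Longrightarrow> energy R x \<le> M * (dist (R, x) (mat 1, 0))\<^sup>2"
proof -
  obtain p where p: "p > 0" "\<And>x. p * (norm x)\<^sup>2 \<le> x \<bullet> (P *v x)"
    using P_bound by blast
  obtain K where K: "K > 0" "\<And>x. x \<bullet> (P *v x) \<le> K * (norm x)\<^sup>2"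
    by (rule linear_bounds) (rule that)
  have d: "(dist (R, x) (mat 1, 0))\<^sup>2 = (norm (R - mat 1))\<^sup>2 + (norm x)\<^sup>2" for R :: "real^3^3" and x :: "real^'n"
    by (simp add: dist_norm norm_Pair)
  have en: "energy R x = 1/4 * (norm (R - mat 1))\<^sup>2 + x \<bullet> (P *v x)" if "R \<in> SO3" for R x
    using norm_minus_mat_SO3[OF that] by (simp add: energy_def)
  show ?thesis
  proof (rule that[of "min (1/4) p" "max (1/4) K"])
    fix R :: "real^3^3" and x :: "real^'n" assume R: "R \<in> SO3"
    show "min (1/4) p * (dist (R, x) (mat 1, 0))\<^sup>2 \<le> energy R x"
      unfolding d en[OF R] distrib_left
      by (intro add_mono order_trans[OF mult_right_mono p(2)] mult_right_mono) auto
    show "energy R x \<le> max (1/4) K * (dist (R, x) (mat 1, 0))\<^sup>2"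
      unfolding d en[OF R] distrib_left
      by (intro add_mono order_trans[OF K(2) mult_right_mono] mult_right_mono) auto
  qed (use p K in auto)
qed

lemma loop_asymptotically_stable:
  "asymptotically_stable {\<lambda>t. (E t, x t) | E x. loop_solution E x} (mat 1, 0)"
proof -
  obtain m M where mM: "m > 0" "M > 0"
    "\<And>R x. R \<in> SO3 \<Longrightarrow> m * (dist (R, x) (mat 1, 0))\<^sup>2 \<le> energy R x"
    "\<And>R x. R \<in> SO3 \<Longrightarrow> energy R x \<le> M * (dist (R, x) (mat 1, 0))\<^sup>2"
    using energy_bounds by blast
  have "loop_solution (\<lambda>t. mat 1) (\<lambda>t. 0)"
    by (simp add: loop_solution_def SO3_mat ctrl_def linear_0[OF linear_hat])
  then have "(\<lambda>t. (mat 1, 0)) \<in> {\<lambda>t. (E t, x t) | E x. loop_solution E x}"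
    by (intro CollectI exI[of _ "\<lambda>t. mat 1"] exI[of _ "\<lambda>t. 0"]) simp
  moreover have "\<exists>\<delta>>0. \<forall>E x. loop_solution E x \<and> dist (E 0, x 0) (mat 1, 0) < \<delta> \<longrightarrow>
      (\<forall>t\<ge>0. dist (E t, x t) (mat 1, 0) < \<epsilon>)" if e: "\<epsilon> > 0" for \<epsilon>
  \<comment> \<open>The ratio \<open>m / M\<close> of the two comparison constants is lost when
    passing from distance to energy and back.\<close>
  proof (intro exI[of _ "\<epsilon> * sqrt (m / M)"] conjI allI impI)
    show "\<epsilon> * sqrt (m / M) > 0" using e mM by simp
    fix E x t assume *: "loop_solution E x \<and> dist (E 0, x 0) (mat 1, 0) < \<epsilon> * sqrt (m / M)"
      and t: "(0::real) \<le> t"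
    then have sol: "loop_solution E x" by simp
    have "m * (dist (E t, x t) (mat 1, 0))\<^sup>2 \<le> M * (dist (E 0, x 0) (mat 1, 0))\<^sup>2"
      using mM(3)[OF loop_solutionD(1)[OF sol t], of "x t"] mM(4)[OF loop_solutionD(1)[OF sol order_refl], of "x 0"]
        loop_energy_decreasing[OF sol order_refl t] by linarith
    also have "\<dots> < M * (\<epsilon> * sqrt (m / M))\<^sup>2"
      using * mM by (intro mult_strict_left_mono power_strict_mono) auto
    also have "\<dots> = m * \<epsilon>\<^sup>2" using mM by (simp add: power_mult_distrib field_simps)
    finally have "(dist (E t, x t) (mat 1, 0))\<^sup>2 < \<epsilon>\<^sup>2" using mM by simp
    then show "dist (E t, x t) (mat 1, 0) < \<epsilon>" using e by (simp add: power_less_imp_less_base)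
  qed
  moreover have "\<exists>\<delta>>0. \<forall>E x. loop_solution E x \<and> dist (E 0, x 0) (mat 1, 0) < \<delta> \<longrightarrow>
      ((\<lambda>t. (E t, x t)) \<longlongrightarrow> (mat 1, 0)) at_top"
  \<comment> \<open>This radius keeps the initial energy at most 1, whereas a trajectory with trace
    tending to -1 has limiting energy 2.\<close>
  proof (intro exI[of _ "sqrt (1 / M)"] conjI allI impI)
    show "sqrt (1 / M) > 0" using mM by simp
    fix E x assume *: "loop_solution E x \<and> dist (E 0, x 0) (mat 1, 0) < sqrt (1 / M)"
    then have sol: "loop_solution E x" by simp
    have "energy (E 0) (x 0) \<le> M * (dist (E 0, x 0) (mat 1, 0))\<^sup>2"
      by (rule mM(4)[OF loop_solutionD(1)[OF sol order_refl]])
    also have "\<dots> \<le> M * (sqrt (1 / M))\<^sup>2"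
      using * mM by (intro mult_left_mono power_mono) auto
    also have "\<dots> = 1" using mM by simp
    finally have e0: "energy (E 0) (x 0) \<le> 1" .
    have "\<not> ((\<lambda>t. trace (E t)) \<longlongrightarrow> - 1) at_top"
    proof
      assume "((\<lambda>t. trace (E t)) \<longlongrightarrow> - 1) at_top"
      then have "((\<lambda>t. energy (E t) (x t)) \<longlongrightarrow> (3 - (-1)) / 2 + 0) at_top"
        unfolding energy_def by (intro tendsto_intros loop_energy_state_tendsto[OF sol]) auto
      moreover have "\<forall>\<^sub>F t in at_top. energy (E t) (x t) \<le> 1"
        using eventually_ge_at_top[of 0]
        by eventually_elim (use loop_energy_decreasing[OF sol order_refl] e0 order_trans in blast)
      ultimately have "(3 - (-1)) / 2 + 0 \<le> (1::real)"
        by (intro tendsto_upperbound[where F = at_top]) auto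
      then show False by simp
    qed
    then show "((\<lambda>t. (E t, x t)) \<longlongrightarrow> (mat 1, 0)) at_top"
      using loop_tendsto[OF sol] loop_trace_tendsto[OF sol] by blast
  qed
  moreover have ball: "(\<forall>f\<in>{\<lambda>t. (E t, x t) | E x. loop_solution E x}. Q f) \<longleftrightarrow>
      (\<forall>E x. loop_solution E x \<longrightarrow> Q (\<lambda>t. (E t, x t)))" for Q
    by blast
  ultimately show ?thesis
    unfolding asymptotically_stable_def ball by (intro conjI) (assumption | simp add: imp_conjL)+
qed

end

subsection \<open>Differences of rotations\<close>

lemma norm_hat_le: "norm (hat v) \<le> 2 * norm v"
proof (rule power2_le_imp_le)
  have "hat v \<bullet> hat v = 2 * (v \<bullet> v)"
    by (simp add: inner_vec_def sum_3)
  then show "(norm (hat v))\<^sup>2 \<le> (2 * norm v)\<^sup>2"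
    by (simp add: power2_norm_eq_inner power_mult_distrib)
qed simp

lemma norm_attitude_error_le: "norm (attitude_error M) \<le> norm M"
proof (rule power2_le_imp_le)
  have sq: "((a - b) / 2)\<^sup>2 \<le> a\<^sup>2 + b\<^sup>2" for a b :: real
  proof -
    have "a\<^sup>2 + b\<^sup>2 - ((a - b) / 2)\<^sup>2 = ((a + b)\<^sup>2 + 2 * a\<^sup>2 + 2 * b\<^sup>2) / 4"
      by (simp add: power2_eq_square field_simps)
    also have "\<dots> \<ge> 0" by simp
    finally show ?thesis by simp
  qed
  have "(attitude_error M \<bullet> attitude_error M) = ((M$3$2 - M$2$3) / 2)\<^sup>2 + ((M$1$3 - M$3$1) / 2)\<^sup>2
      + ((M$2$1 - M$1$2) / 2)\<^sup>2"
    by (simp add: inner_vec_def sum_3 power2_eq_square)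
  also have "\<dots> \<le> ((M$3$2)\<^sup>2 + (M$2$3)\<^sup>2) + ((M$1$3)\<^sup>2 + (M$3$1)\<^sup>2) + ((M$2$1)\<^sup>2 + (M$1$2)\<^sup>2)"
    by (intro add_mono sq)
  also have "\<dots> \<le> \<dots> + ((M$1$1)\<^sup>2 + (M$2$2)\<^sup>2 + (M$3$3)\<^sup>2)" by simp
  also have "\<dots> = M \<bullet> M" by (simp add: inner_vec_def sum_3 power2_eq_square)
  finally show "(norm (attitude_error M))\<^sup>2 \<le> (norm M)\<^sup>2"
    by (simp add: power2_norm_eq_inner)
qed simp

lemma norm_matrix_vector_mult_le:
  fixes M :: "real^'n^'m"
  shows "norm (M *v v) \<le> norm M * norm v"
proof (rule power2_le_imp_le)
  have "(M *v v) \<bullet> (M *v v) = (\<Sum>i\<in>UNIV. (M $ i \<bullet> v)\<^sup>2)"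
    by (simp add: inner_vec_def[of "M *v v"] matrix_vector_mul_component power2_eq_square)
  also have "\<dots> \<le> (\<Sum>i\<in>UNIV. (M $ i \<bullet> M $ i) * (v \<bullet> v))"
    by (intro sum_mono Cauchy_Schwarz_ineq)
  also have "\<dots> = (M \<bullet> M) * (v \<bullet> v)"
    by (simp add: inner_vec_def[of M] sum_distrib_right)
  finally show "(norm (M *v v))\<^sup>2 \<le> (norm M * norm v)\<^sup>2"
    by (simp add: power2_norm_eq_inner power_mult_distrib)
qed simp

lemma attitude_error_diff: "attitude_error (R - S) = attitude_error R - attitude_error S"
  by (rule linear_diff[OF linear_attitude_error])

text \<open>Rotations fix their attitude error, so \<open>(I - S) *v attitude_error (R - S)\<close> equals
  \<open>(R - S) *v attitude_error R\<close>, which is small as soon as \<open>attitude_error R\<close> is.\<close>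

lemma attitude_error_diff_inner:
  assumes "R \<in> SO3" "S \<in> SO3"
  shows "attitude_error (R - S) \<bullet> attitude_error (S ** hat v) =
    - (attitude_error (R - S) \<bullet> v) + (1 + trace S) / 2 * (attitude_error (R - S) \<bullet> v)
    + ((R - S) *v attitude_error R) \<bullet> v / 2"
proof -
  let ?\<eta> = "attitude_error (R - S)"
  have S\<eta>: "S *v ?\<eta> = ?\<eta> - (R - S) *v attitude_error R"
    by (simp add: attitude_error_diff matrix_vector_mult_diff_distrib matrix_vector_mult_diff_rdistrib
        SO3_attitude_error_fixed assms)
  have "?\<eta> \<bullet> attitude_error (S ** hat v) = (trace S * (?\<eta> \<bullet> v) - (S *v ?\<eta>) \<bullet> v) / 2"
    by (simp add: attitude_error_mult_hat inner_diff_right inner_transpose_mult del: transpose_matrix_vector)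
  then show ?thesis
    unfolding S\<eta> by (simp add: inner_diff_left field_simps)
qed

text \<open>With \<open>Y = transpose R0 ** R\<close> and \<open>Z = transpose R0 ** S\<close>, orthogonality makes the symmetric part
  of \<open>Y - Z\<close> quadratic in \<open>Y - I\<close>, \<open>Z - I\<close>, so \<open>R - S\<close> is controlled by the axial vector of \<open>Y - Z\<close>.\<close>

lemma SO3_diff_bound:
  obtains \<rho> where "\<rho> > 0"
    "\<And>R0 R S. R0 \<in> SO3 \<Longrightarrow> R \<in> SO3 \<Longrightarrow> S \<in> SO3 \<Longrightarrow> \<bar>1 + trace R0\<bar> \<le> \<rho> \<Longrightarrow> norm (R - R0) \<le> \<rho> \<Longrightarrow>
      norm (S - R0) \<le> \<rho> \<Longrightarrow>
      norm (R - S) \<le> 4 * norm (attitude_error (R - S)) +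
        2 * norm (attitude_error (transpose R0 ** (R - S)) - transpose R0 *v attitude_error (transpose R0 ** (R - S)))"
proof -
  obtain K where K: "K > 0" "\<And>(M::real^3^3) (N::real^3^3). norm (M ** N) \<le> norm M * norm N * K"
    using bounded_bilinear.pos_bounded[OF bounded_bilinear_matrix_mult] by blast
  \<comment> \<open>Chosen so that the terms proportional to \<open>norm \<Delta>\<close> add up to
    half of \<open>norm \<Delta>\<close> and can be absorbed on the left.\<close>
  define \<rho> where "\<rho> = 1 / (2 * (3 * K + 1))"
  have \<rho>0: "\<rho> > 0" using K(1) by (simp add: \<rho>_def)
  have \<rho>K: "(3 * K + 1) * \<rho> = 1 / 2" using K(1) by (simp add: \<rho>_def field_simps)
  show ?thesis
  proof (rule that[OF \<rho>0])
    fix R0 R S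
    assume R0: "R0 \<in> SO3" and R: "R \<in> SO3" and S: "S \<in> SO3" and tr: "\<bar>1 + trace R0\<bar> \<le> \<rho>"
      and RR0: "norm (R - R0) \<le> \<rho>" and SR0: "norm (S - R0) \<le> \<rho>"
    define Y where "Y = transpose R0 ** R"
    define Z where "Z = transpose R0 ** S"
    define \<Delta> where "\<Delta> = R - S"
    define \<Theta> where "\<Theta> = transpose R0 ** \<Delta>"
    define \<xi> where "\<xi> = attitude_error \<Theta>"
    \<comment> \<open>The part of \<open>\<xi>\<close> that the rotation moves. It is orthogonal to
      the axis of \<open>R0\<close>, so it has only two free coordinates.\<close>
    define w where "w = \<xi> - transpose R0 *v \<xi>"
    define Sy where "Sy = (1/2) *\<^sub>R (\<Theta> + transpose \<Theta>)"
    note bil = bounded_bilinear_matrix_mult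
    have R0': "transpose R0 \<in> SO3" "R0 ** transpose R0 = mat 1" "transpose R0 ** R0 = mat 1"
      using R0 by (auto simp: SO3_transpose SO3_iff)
    have YZ: "\<Theta> = Y - Z" by (simp add: \<Theta>_def Y_def Z_def \<Delta>_def bounded_bilinear.diff_right[OF bil])
    have SO3s: "Y \<in> SO3" "Z \<in> SO3" using R0' R S by (auto simp: Y_def Z_def SO3_mult)
    have "Y - mat 1 = transpose R0 ** (R - R0)" "Z - mat 1 = transpose R0 ** (S - R0)"
      by (simp_all add: Y_def Z_def bounded_bilinear.diff_right[OF bil] R0')
    then have Y1: "norm (Y - mat 1) \<le> \<rho>" and Z1: "norm (Z - mat 1) \<le> \<rho>"
      using RR0 SR0 by (simp_all add: norm_mult_SO3[OF R0'(1)])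
    have norm\<Theta>: "norm \<Theta> = norm \<Delta>" unfolding \<Theta>_def by (rule norm_mult_SO3[OF R0'(1)])
    have quad: "X + transpose X = 2 *\<^sub>R mat 1 - transpose (X - mat 1) ** (X - mat 1)" if "X \<in> SO3" for X
    proof -
      have "transpose (X - mat 1) = transpose X - mat 1"
        by (simp add: linear_diff[OF linear_transpose])
      then show ?thesis
        using that by (simp add: bounded_bilinear.diff_left[OF bil] bounded_bilinear.diff_right[OF bil] SO3_iff
            scaleR_2)
    qed
    have "\<Theta> + transpose \<Theta> = (Y + transpose Y) - (Z + transpose Z)"
      by (simp add: YZ linear_diff[OF linear_transpose])
    also have "\<dots> = transpose (Z - mat 1) ** (Z - mat 1) - transpose (Y - mat 1) ** (Y - mat 1)"
      by (simp add: quad SO3s)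
    also have "\<dots> = - (transpose (Y - mat 1) ** \<Theta> + transpose \<Theta> ** (Z - mat 1))"
    proof -
      have "\<Theta> = (Y - mat 1) - (Z - mat 1)" by (simp add: YZ)
      then show ?thesis
        by (simp add: linear_diff[OF linear_transpose] bounded_bilinear.diff_left[OF bil] bounded_bilinear.diff_right[OF bil])
    qed
    finally have "norm (\<Theta> + transpose \<Theta>) \<le> norm (transpose (Y - mat 1) ** \<Theta>) + norm (transpose \<Theta> ** (Z - mat 1))"
      by (simp only: norm_minus_cancel norm_triangle_ineq)
    also have "\<dots> \<le> norm (transpose (Y - mat 1)) * norm \<Theta> * K + norm (transpose \<Theta>) * norm (Z - mat 1) * K"
      by (intro add_mono K)
    also have "\<dots> = (norm (Y - mat 1) + norm (Z - mat 1)) * (norm \<Delta> * K)"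
      by (simp add: norm_transpose norm\<Theta> algebra_simps)
    also have "\<dots> \<le> (\<rho> + \<rho>) * (norm \<Delta> * K)"
      using Y1 Z1 K(1) by (intro mult_right_mono add_mono) auto
    finally have Sy: "norm Sy \<le> K * \<rho> * norm \<Delta>" by (simp add: Sy_def mult_ac)
    have \<Theta>: "\<Theta> = hat \<xi> + Sy"
      by (simp add: \<xi>_def hat_attitude_error Sy_def scaleR_add_right scaleR_diff_right)
    have \<xi>\<Delta>: "norm \<xi> \<le> norm \<Delta>" unfolding \<xi>_def norm\<Theta>[symmetric] by (rule norm_attitude_error_le)
    have "\<Delta> = R0 ** \<Theta>" by (simp add: \<Theta>_def matrix_mul_assoc R0')
    then have "attitude_error \<Delta> = attitude_error (R0 ** hat \<xi>) + attitude_error (R0 ** Sy)"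
      by (simp add: \<Theta> bounded_bilinear.add_right[OF bil] linear_add[OF linear_attitude_error])
    \<comment> \<open>With \<open>trace R0\<close> near -1 this is \<open>- \<xi>\<close> plus half
      of \<open>w\<close> up to a small term, so \<open>\<xi>\<close> can be recovered from
      \<open>attitude_error \<Delta>\<close> and \<open>w\<close>.\<close>
    also have "attitude_error (R0 ** hat \<xi>) = (1/2) *\<^sub>R (1 + trace R0) *\<^sub>R \<xi> - \<xi> + (1/2) *\<^sub>R w"
      by (simp add: attitude_error_mult_hat w_def vec_eq_iff field_simps del: transpose_matrix_vector)
    finally have "\<xi> = ((1/2) *\<^sub>R (1 + trace R0) *\<^sub>R \<xi> + (1/2) *\<^sub>R w + attitude_error (R0 ** Sy)) - attitude_error \<Delta>"
      by simp
    also have "norm \<dots> \<le> norm ((1/2) *\<^sub>R (1 + trace R0) *\<^sub>R \<xi>) + norm ((1/2) *\<^sub>R w) + norm (attitude_error (R0 ** Sy))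
        + norm (attitude_error \<Delta>)"
      by (intro order_trans[OF norm_triangle_ineq4] add_right_mono norm_triangle_le) simp
    also have "norm ((1/2) *\<^sub>R (1 + trace R0) *\<^sub>R \<xi>) \<le> 1 / 2 * (\<rho> * norm \<Delta>)"
      using tr \<xi>\<Delta> \<rho>0 by (auto intro!: mult_mono)
    also have "norm (attitude_error (R0 ** Sy)) \<le> K * \<rho> * norm \<Delta>"
      using norm_attitude_error_le[of "R0 ** Sy"] Sy by (simp add: norm_mult_SO3[OF R0])
    finally have \<xi>: "norm \<xi> \<le> 1 / 2 * (\<rho> * norm \<Delta>) + 1 / 2 * norm w + K * \<rho> * norm \<Delta> + norm (attitude_error \<Delta>)"
      by simp
    have "norm \<Delta> \<le> norm (hat \<xi>) + norm Sy"
      unfolding norm\<Theta>[symmetric] by (subst \<Theta>) (rule norm_triangle_ineq)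
    also have "\<dots> \<le> 2 * norm \<xi> + K * \<rho> * norm \<Delta>"
      using norm_hat_le[of \<xi>] Sy by linarith
    also have "\<dots> \<le> ((3 * K + 1) * \<rho>) * norm \<Delta> + norm w + 2 * norm (attitude_error \<Delta>)"
      using \<xi> by (simp add: algebra_simps)
    finally have "norm \<Delta> \<le> 4 * norm (attitude_error \<Delta>) + 2 * norm w"
      unfolding \<rho>K by simp
    then show "norm (R - S) \<le> 4 * norm (attitude_error (R - S)) +
        2 * norm (attitude_error (transpose R0 ** (R - S)) - transpose R0 *v attitude_error (transpose R0 ** (R - S)))"
      unfolding w_def \<xi>_def \<Theta>_def \<Delta>_def .
  qed
qed

text \<open>The equation \<open>n \<bullet> w = 0\<close> can be solved for a coordinate in which
  \<open>n\<close> does not vanish. The two other coordinates serve as a chart for the plane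
  orthogonal to the axis.\<close>

lemma orthogonal_two_coordinates:
  fixes n :: "real^3"
  assumes "n \<noteq> 0"
  obtains i j K where "K > 0" "\<And>w. n \<bullet> w = 0 \<Longrightarrow> (norm w)\<^sup>2 \<le> K * ((w $ i)\<^sup>2 + (w $ j)\<^sup>2)"
proof -
  have sq: "c\<^sup>2 \<le> ((a / d)\<^sup>2 + (b / d)\<^sup>2) * (p\<^sup>2 + q\<^sup>2)" if "d \<noteq> 0" "a * p + b * q + d * c = 0" for a b c d p q :: real
  proof -
    have "c = - ((a / d) * p + (b / d) * q)" using that by (simp add: field_simps)
    then have "c\<^sup>2 = ((a / d) * p + (b / d) * q)\<^sup>2" by (simp only: power2_minus)
    \<comment> \<open>The added square completes Lagrange's identity.\<close>
    also have "\<dots> \<le> ((a / d) * p + (b / d) * q)\<^sup>2 + ((a / d) * q - (b / d) * p)\<^sup>2" by simp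
    also have "\<dots> = ((a / d)\<^sup>2 + (b / d)\<^sup>2) * (p\<^sup>2 + q\<^sup>2)"
      by (simp add: power2_eq_square add_divide_distrib algebra_simps)
    finally show ?thesis .
  qed
  have norm3: "(norm w)\<^sup>2 = (w$1)\<^sup>2 + (w$2)\<^sup>2 + (w$3)\<^sup>2" for w :: "real^3"
    unfolding power2_norm_eq_inner by (simp add: inner_vec_def sum_3 power2_eq_square)
  have K: "(0::real) < 1 + ((a / d)\<^sup>2 + (b / d)\<^sup>2)" for a b d :: real
    by (intro add_pos_nonneg) auto
  have inner3: "n \<bullet> w = n$1 * w$1 + n$2 * w$2 + n$3 * w$3" for w
    by (simp add: inner_vec_def sum_3)
  consider "n$1 \<noteq> 0" | "n$2 \<noteq> 0" | "n$3 \<noteq> 0" using assms by (auto simp: vec_eq_iff forall_3)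
  then show ?thesis
  proof cases
    case 1
    show ?thesis
    proof (rule that[OF K, of "n$2" "n$1" "n$3" 2 3])
      show "(norm w)\<^sup>2 \<le> (1 + ((n$2 / n$1)\<^sup>2 + (n$3 / n$1)\<^sup>2)) * ((w$2)\<^sup>2 + (w$3)\<^sup>2)" if "n \<bullet> w = 0" for w
        using sq[of "n$1" "n$2" "w$2" "n$3" "w$3" "w$1"] 1 that by (simp add: norm3 inner3 algebra_simps)
    qed
  next
    case 2
    show ?thesis
    proof (rule that[OF K, of "n$1" "n$2" "n$3" 1 3])
      show "(norm w)\<^sup>2 \<le> (1 + ((n$1 / n$2)\<^sup>2 + (n$3 / n$2)\<^sup>2)) * ((w$1)\<^sup>2 + (w$3)\<^sup>2)" if "n \<bullet> w = 0" for w
        using sq[of "n$2" "n$1" "w$1" "n$3" "w$3" "w$2"] 2 that by (simp add: norm3 inner3 algebra_simps)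
    qed
  next
    case 3
    show ?thesis
    proof (rule that[OF K, of "n$1" "n$3" "n$2" 1 2])
      show "(norm w)\<^sup>2 \<le> (1 + ((n$1 / n$3)\<^sup>2 + (n$2 / n$3)\<^sup>2)) * ((w$1)\<^sup>2 + (w$2)\<^sup>2)" if "n \<bullet> w = 0" for w
        using sq[of "n$3" "n$1" "w$1" "n$2" "w$2" "w$3"] 3 that by (simp add: norm3 inner3 algebra_simps)
    qed
  qed
qed

subsection \<open>The stable set of the half-turns\<close>

text \<open>The function \<open>h t * exp (- k * t)\<close> is nondecreasing, and its upper bound
  \<open>H * exp (- k * t)\<close> tends to 0.\<close>

lemma nonpos_if_exponential_growth:
  fixes h :: "real \<Rightarrow> real"
  assumes k: "k > 0" and a: "a \<ge> 0"
    and deriv: "\<And>t. t \<ge> a \<Longrightarrow> (h has_real_derivative h' t) (at t within {0..})"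
    and growth: "\<And>t. t \<ge> a \<Longrightarrow> h' t \<ge> k * h t" and bound: "\<And>t. t \<ge> a \<Longrightarrow> h t \<le> H"
  shows "h a \<le> 0"
proof -
  define w where "w t = h t * exp (- k * t)" for t
  have w': "(w has_real_derivative (h' t - k * h t) * exp (- k * t)) (at t within {a..})" if "t \<ge> a" for t
    unfolding w_def
    by (rule derivative_eq_intros DERIV_subset[OF deriv[OF that]] refl | use a in \<open>force simp: algebra_simps\<close>)+
  have le: "h a \<le> H * exp (- k * (t - a))" if "t \<ge> a" for t
  proof -
    have "w a \<le> w t"
      by (rule nondecreasing_on_atLeast[OF w']) (use growth that in auto)
    also have "w t \<le> H * exp (- k * t)" unfolding w_def using bound[OF that] by simp
    finally have "h a * exp (- k * a) * exp (k * a) \<le> H * exp (- k * t) * exp (k * a)"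
      unfolding w_def by simp
    then show ?thesis by (simp add: mult.assoc mult_exp_exp algebra_simps)
  qed
  have "((\<lambda>t. H * exp (- k * (t - a))) \<longlongrightarrow> 0) at_top"
  proof -
    have "filterlim (\<lambda>t. (- k) * (- a + t)) at_bot at_top"
      using k by (intro filterlim_tendsto_neg_mult_at_bot[OF tendsto_const]
          filterlim_tendsto_add_at_top[OF tendsto_const filterlim_ident]) auto
    then have "filterlim (\<lambda>t. (- k) * (t - a)) at_bot at_top" by simp
    then have "((\<lambda>t. H * exp (- k * (t - a))) \<longlongrightarrow> H * 0) at_top"
      by (intro tendsto_mult tendsto_const filterlim_compose[OF exp_at_bot])
    then show ?thesis by simp
  qed
  then show ?thesis
    by (rule tendsto_lowerbound[OF _ eventually_mono[OF eventually_ge_at_top[of a] le]]) auto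
qed

section \<open>Comparison of two closed-loop trajectories\<close>

context ndi_lmi
begin

lemma ctrl_diff: "ctrl (e - f) (x - y) = ctrl e x - ctrl f y"
  by (simp add: ctrl_def matrix_vector_mult_diff_distrib)

text \<open>Near the equilibria with zero control, the first summand on the right is small relative to \<open>R - S\<close>,
  and the second one depends on the differences only.\<close>

lemma kinematics_diff:
  "R ** hat (ctrl (attitude_error R) x) - S ** hat (ctrl (attitude_error S) y) =
   (R - S) ** hat (ctrl (attitude_error R) x) + S ** hat (ctrl (attitude_error (R - S)) (x - y))"
  by (simp add: attitude_error_diff ctrl_diff linear_diff[OF linear_hat]
      bounded_bilinear.diff_left[OF bounded_bilinear_matrix_mult]
      bounded_bilinear.diff_right[OF bounded_bilinear_matrix_mult])

lemma loop_diff_deriv: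
  assumes "loop_solution E x" "loop_solution F y" "t \<ge> 0"
  shows "((\<lambda>t. E t - F t) has_vector_derivative (E t - F t) ** hat (ctrl (attitude_error (E t)) (x t)) +
      F t ** hat (ctrl (attitude_error (E t - F t)) (x t - y t))) (at t within {0..})"
    and "((\<lambda>t. x t - y t) has_vector_derivative A *v (x t - y t) + B *v attitude_error (E t - F t))
      (at t within {0..})"
proof -
  show "((\<lambda>t. E t - F t) has_vector_derivative (E t - F t) ** hat (ctrl (attitude_error (E t)) (x t)) +
      F t ** hat (ctrl (attitude_error (E t - F t)) (x t - y t))) (at t within {0..})"
    using has_vector_derivative_diff[OF loop_solutionD(2)[OF assms(1,3)] loop_solutionD(2)[OF assms(2,3)]]
    by (simp only: kinematics_diff)
  show "((\<lambda>t. x t - y t) has_vector_derivative A *v (x t - y t) + B *v attitude_error (E t - F t))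
      (at t within {0..})"
    using has_vector_derivative_diff[OF loop_solutionD(3)[OF assms(1,3)] loop_solutionD(3)[OF assms(2,3)]]
    by (simp add: matrix_vector_mult_diff_distrib attitude_error_diff algebra_simps)
qed

text \<open>The squared distance cannot shrink faster than exponentially. The term
  \<open>\<Delta> ** hat u\<close> with the actual control \<open>u\<close> is orthogonal to
  \<open>\<Delta>\<close>, and what remains is linear in the differences; hence \<open>L\<close> is
  the same for all pairs of trajectories, however large their states.\<close>

lemma loop_diff_backward_bound:
  obtains L where "L > 0" "\<And>E x F y t. loop_solution E x \<Longrightarrow> loop_solution F y \<Longrightarrow> t \<ge> 0 \<Longrightarrow>
    dist (E 0, x 0) (F 0, y 0) \<le> exp (L * t) * dist (E t, x t) (F t, y t)"
proof -
  obtain K where K: "K > 0" "\<And>e x. norm (ctrl e x) \<le> K * norm (e, x)"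
    "\<And>e x. norm (A *v x + B *v e) \<le> K * norm (e, x)"
    by (rule linear_bounds) (rule that)
  \<comment> \<open>The attitude part contributes \<open>2 * K\<close>, because \<open>hat\<close>
    at most doubles norms, and the state part \<open>K\<close>.\<close>
  define L where "L = 3 * K"
  show ?thesis
  proof (rule that[of L])
    show "L > 0" using K by (simp add: L_def)
    fix E x F y and t :: real
    assume sol: "loop_solution E x" "loop_solution F y" and t: "t \<ge> 0"
    define d where "d t = (E t - F t, x t - y t)" for t
    define d' where "d' t = ((E t - F t) ** hat (ctrl (attitude_error (E t)) (x t)) +
        F t ** hat (ctrl (attitude_error (E t - F t)) (x t - y t)),
        A *v (x t - y t) + B *v attitude_error (E t - F t))" for t
    have dd: "(d has_vector_derivative d' t) (at t within {0..})" if "t \<ge> 0" for t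
      unfolding d_def d'_def by (intro has_vector_derivative_Pair loop_diff_deriv sol that)
    have D: "((\<lambda>t. d t \<bullet> d t * exp (2 * L * t)) has_real_derivative
        (2 * (d t \<bullet> d' t) + 2 * L * (d t \<bullet> d t)) * exp (2 * L * t)) (at t within {0..})" if "t \<ge> 0" for t
    proof -
      have "((\<lambda>t. d t \<bullet> d t) has_real_derivative 2 * (d t \<bullet> d' t)) (at t within {0..})"
        using bounded_bilinear.has_vector_derivative[OF bounded_bilinear_inner dd[OF that] dd[OF that]]
        by (simp add: has_real_derivative_iff_has_vector_derivative inner_commute)
      then show ?thesis by (auto intro!: derivative_eq_intros simp: algebra_simps)
    qed
    have nonneg: "(2 * (d t \<bullet> d' t) + 2 * L * (d t \<bullet> d t)) * exp (2 * L * t) \<ge> 0" if "t \<ge> 0" for t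
    proof -
      let ?\<eta> = "attitude_error (E t - F t)" and ?\<delta> = "x t - y t"
      have z: "norm (?\<eta>, ?\<delta>) \<le> norm (d t)"
        using norm_attitude_error_le[of "E t - F t"] by (simp add: d_def norm_Pair power_mono)
      have v: "norm (ctrl ?\<eta> ?\<delta>) \<le> K * norm (d t)"
        using K z by (meson order_trans mult_left_mono less_imp_le)
      have w: "norm (A *v ?\<delta> + B *v ?\<eta>) \<le> K * norm (d t)"
        using K z by (meson order_trans mult_left_mono less_imp_le)
      have "\<bar>d t \<bullet> d' t\<bar> \<le> \<bar>(E t - F t) \<bullet> (F t ** hat (ctrl ?\<eta> ?\<delta>))\<bar> + \<bar>?\<delta> \<bullet> (A *v ?\<delta> + B *v ?\<eta>)\<bar>"
        by (simp add: d_def d'_def inner_add_right inner_mult_hat_self)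
      also have "\<dots> \<le> norm (E t - F t) * norm (F t ** hat (ctrl ?\<eta> ?\<delta>)) + norm ?\<delta> * norm (A *v ?\<delta> + B *v ?\<eta>)"
        by (intro add_mono Cauchy_Schwarz_ineq2)
      also have "\<dots> \<le> norm (d t) * (2 * (K * norm (d t))) + norm (d t) * (K * norm (d t))"
        using v w norm_hat_le[of "ctrl ?\<eta> ?\<delta>"] norm_fst_le[of "E t - F t" ?\<delta>] norm_snd_le[of ?\<delta> "E t - F t"]
        unfolding norm_mult_SO3[OF loop_solutionD(1)[OF sol(2) that]]
        by (intro add_mono mult_mono) (auto simp: d_def)
      also have "\<dots> = L * (d t \<bullet> d t)"
        by (simp add: L_def power2_norm_eq_inner[symmetric] power2_eq_square)
      finally have "\<bar>d t \<bullet> d' t\<bar> \<le> L * (d t \<bullet> d t)" .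
      then show ?thesis by (intro mult_nonneg_nonneg) auto
    qed
    have "d 0 \<bullet> d 0 * exp (2 * L * 0) \<le> d t \<bullet> d t * exp (2 * L * t)"
      by (rule nondecreasing_on_atLeast[OF D nonneg order_refl t])
    then have "(norm (d 0))\<^sup>2 \<le> (exp (L * t) * norm (d t))\<^sup>2"
      by (simp add: power2_norm_eq_inner power_mult_distrib exp_double[symmetric] mult_ac)
    then have "norm (d 0) \<le> exp (L * t) * norm (d t)"
      by (rule power2_le_imp_le) simp
    then show "dist (E 0, x 0) (F 0, y 0) \<le> exp (L * t) * dist (E t, x t) (F t, y t)"
      by (simp add: d_def dist_norm)
  qed
qed

text \<open>The attitude part of the energy is maximal at the equilibria other than \<open>mat 1\<close>, hence the sign of its
  first term below. These equilibria form a surface, and the term with \<open>\<kappa>\<close> bounds the components of \<open>\<Delta>\<close>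
  tangent to it.\<close>

definition cone_form :: "real \<Rightarrow> real^3^3 \<Rightarrow> real^'n \<Rightarrow> real" where
  "cone_form \<kappa> \<Delta> \<delta> = (norm (attitude_error \<Delta>))\<^sup>2 / 2 - \<delta> \<bullet> (P *v \<delta>) - \<kappa> * (norm \<Delta>)\<^sup>2"

definition near_flip :: "real \<Rightarrow> real^3^3 \<Rightarrow> real^'n \<Rightarrow> bool" where
  "near_flip \<epsilon> R x \<longleftrightarrow> norm (attitude_error R, x) \<le> \<epsilon> \<and> \<bar>1 + trace R\<bar> \<le> \<epsilon>"

lemma cone_form_deriv:
  assumes "(\<Delta> has_vector_derivative \<Delta>') (at t within S)" "(\<delta> has_vector_derivative \<delta>') (at t within S)"
  shows "((\<lambda>t. cone_form \<kappa> (\<Delta> t) (\<delta> t)) has_real_derivative attitude_error (\<Delta> t) \<bullet> attitude_error \<Delta>'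
     - 2 * (\<delta> t \<bullet> (P *v \<delta>')) - 2 * \<kappa> * (\<Delta> t \<bullet> \<Delta>')) (at t within S)"
proof -
  have sq: "((\<lambda>t. (norm (f t))\<^sup>2) has_real_derivative 2 * (f t \<bullet> f')) (at t within S)"
    if "(f has_vector_derivative f') (at t within S)" for f :: "real \<Rightarrow> 'z::real_inner" and f'
    using bounded_bilinear.has_vector_derivative[OF bounded_bilinear_inner that that]
    by (simp add: has_real_derivative_iff_has_vector_derivative inner_commute power2_norm_eq_inner)
  have "((\<lambda>t. attitude_error (\<Delta> t)) has_vector_derivative attitude_error \<Delta>') (at t within S)"
    by (rule bounded_linear.has_vector_derivative[OF linear_conv_bounded_linear[THEN iffD1, OF linear_attitude_error] assms(1)])
  note D = sq[OF this] sq[OF assms(1)] P_form_deriv[OF assms(2)]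
  show ?thesis
    unfolding cone_form_def by (rule derivative_eq_intros D refl | simp)+
qed

text \<open>With \<open>z = norm (\<eta>, \<delta>)\<close>, the matrix inequality contributes at
  least \<open>c * z\<^sup>2\<close>, and all error terms carry a factor \<open>\<kappa>\<close>.
  The error terms also involve \<open>norm \<Delta>\<close>, which \<open>z\<close> does not
  control; they are compensated through the term \<open>- \<kappa> * (norm \<Delta>)\<^sup>2\<close>
  of the form itself. The same \<open>\<kappa>\<close> is the weight in the form and the size of the
  neighbourhood of the half-turns.\<close>

lemma cone_form_growth:
  assumes "\<kappa>0 > 0"
  obtains \<kappa> k where "0 < \<kappa>" "\<kappa> \<le> \<kappa>0" "k > 0"
    "\<And>R S x y. R \<in> SO3 \<Longrightarrow> S \<in> SO3 \<Longrightarrow> near_flip \<kappa> R x \<Longrightarrow> near_flip \<kappa> S y \<Longrightarrow>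
      attitude_error (R - S) \<bullet> attitude_error ((R - S) ** hat (ctrl (attitude_error R) x) +
          S ** hat (ctrl (attitude_error (R - S)) (x - y)))
      - 2 * ((x - y) \<bullet> (P *v (A *v (x - y) + B *v attitude_error (R - S))))
      - 2 * \<kappa> * ((R - S) \<bullet> ((R - S) ** hat (ctrl (attitude_error R) x) +
          S ** hat (ctrl (attitude_error (R - S)) (x - y))))
      \<ge> k * cone_form \<kappa> (R - S) (x - y)"
proof -
  obtain c where c: "c > 0" "\<And>e x. supply_rate e x \<le> - c * ((norm e)\<^sup>2 + (norm x)\<^sup>2)"
    using supply_rate_bound by blast
  obtain K where K: "K > 0" "\<And>e x. norm (ctrl e x) \<le> K * norm (e, x)"
    by (rule linear_bounds) (rule that)
  obtain K1 where K1: "K1 > 0" "\<And>(M::real^3^3) (N::real^3^3). norm (M ** N) \<le> norm M * norm N * K1"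
    using bounded_bilinear.pos_bounded[OF bounded_bilinear_matrix_mult] by blast
  \<comment> \<open>The coefficient of \<open>\<kappa> * (norm \<Delta> * z)\<close>: the summands
    stem from \<open>b1\<close>, \<open>b3\<close> and \<open>b4\<close> below, in this
    order.\<close>
  define a where "a = 2 * K1 * K + K / 2 + 4 * K"
  have a: "a > 0" using K K1 by (simp add: a_def add_pos_pos)
  \<comment> \<open>The bound \<open>c / (2 * K)\<close> makes \<open>b2\<close> cost at most a
    quarter of \<open>c * z\<^sup>2\<close>; the bound \<open>c\<^sup>2 / a\<^sup>2\<close> yields
    \<open>k \<le> c\<close>.\<close>
  define \<kappa> where "\<kappa> = min \<kappa>0 (min (c / (2 * K)) (c\<^sup>2 / a\<^sup>2))"
  have \<kappa>: "\<kappa> > 0" "\<kappa> \<le> \<kappa>0" "\<kappa> \<le> c / (2 * K)" "\<kappa> \<le> c\<^sup>2 / a\<^sup>2"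
    using assms c K a by (auto simp: \<kappa>_def)
  have \<kappa>K: "\<kappa> * K / 2 \<le> c / 4" using \<kappa>(3) K(1) by (simp add: field_simps)
  \<comment> \<open>The coefficient left over by completing the square in the mixed term
    \<open>norm \<Delta> * z\<close>.\<close>
  define k where "k = \<kappa> * a\<^sup>2 / c"
  have k: "k > 0" using \<kappa> a c by (simp add: k_def)
  have kc: "k \<le> c" using \<kappa>(4) a c by (simp add: k_def field_simps power2_eq_square)
  show ?thesis
  proof (rule that[OF \<kappa>(1,2) k])
    fix R S x y
    assume R: "R \<in> SO3" and S: "S \<in> SO3" and nR: "near_flip \<kappa> R x" and nS: "near_flip \<kappa> S y"
    define \<eta> where "\<eta> = attitude_error (R - S)"
    define \<delta> where "\<delta> = x - y"
    define \<Delta> where "\<Delta> = R - S"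
    define u where "u = ctrl (attitude_error R) x"
    define v where "v = ctrl \<eta> \<delta>"
    define z where "z = norm (\<eta>, \<delta>)"
    have z0: "z \<ge> 0" by (simp add: z_def)
    have z2: "z\<^sup>2 = (norm \<eta>)\<^sup>2 + (norm \<delta>)\<^sup>2" by (simp add: z_def norm_Pair)
    have \<eta>z: "norm \<eta> \<le> z" unfolding z_def by (rule norm_fst_le)
    have u: "norm u \<le> K * \<kappa>"
      using order_trans[OF K(2) mult_left_mono] K(1) nR by (simp add: u_def near_flip_def)
    have v: "norm v \<le> K * z" using K(2) by (simp add: v_def z_def)
    have eR: "norm (attitude_error R) \<le> \<kappa>"
      using nR norm_fst_le[of "attitude_error R" x] by (simp add: near_flip_def)
    have \<eta>v: "\<bar>\<eta> \<bullet> v\<bar> \<le> z * (K * z)"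
      by (rule order_trans[OF Cauchy_Schwarz_ineq2]) (use \<eta>z v z0 in \<open>auto intro: mult_mono\<close>)
    have b1: "\<bar>\<eta> \<bullet> attitude_error (\<Delta> ** hat u)\<bar> \<le> z * (norm \<Delta> * (2 * (K * \<kappa>)) * K1)"
    proof -
      have "norm (attitude_error (\<Delta> ** hat u)) \<le> norm \<Delta> * norm (hat u) * K1"
        by (rule order_trans[OF norm_attitude_error_le K1(2)])
      also have "\<dots> \<le> norm \<Delta> * (2 * (K * \<kappa>)) * K1"
        using norm_hat_le[of u] u K1(1) by (intro mult_right_mono mult_left_mono) auto
      finally show ?thesis
        using \<eta>z z0 by (intro order_trans[OF Cauchy_Schwarz_ineq2] mult_mono) auto
    qed
    have b2: "\<bar>(1 + trace S) / 2 * (\<eta> \<bullet> v)\<bar> \<le> \<kappa> / 2 * (z * (K * z))"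
      unfolding abs_mult using \<eta>v nS by (intro mult_mono) (auto simp: near_flip_def)
    have b3: "\<bar>(\<Delta> *v attitude_error R) \<bullet> v / 2\<bar> \<le> norm \<Delta> * \<kappa> * (K * z) / 2"
    proof -
      have "norm (\<Delta> *v attitude_error R) \<le> norm \<Delta> * \<kappa>"
        using eR by (intro order_trans[OF norm_matrix_vector_mult_le] mult_left_mono) auto
      then have "\<bar>(\<Delta> *v attitude_error R) \<bullet> v\<bar> \<le> norm \<Delta> * \<kappa> * (K * z)"
        using v \<kappa>(1) by (intro order_trans[OF Cauchy_Schwarz_ineq2] mult_mono) auto
      then show ?thesis by simp
    qed
    have b4: "\<bar>2 * \<kappa> * (\<Delta> \<bullet> (S ** hat v))\<bar> \<le> 2 * \<kappa> * (norm \<Delta> * (2 * (K * z)))"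
    proof -
      have "\<bar>\<Delta> \<bullet> (S ** hat v)\<bar> \<le> norm \<Delta> * norm (S ** hat v)" by (rule Cauchy_Schwarz_ineq2)
      also have "\<dots> \<le> norm \<Delta> * (2 * (K * z))"
        unfolding norm_mult_SO3[OF S] using norm_hat_le[of v] v by (intro mult_left_mono) auto
      finally show ?thesis using \<kappa>(1) by (simp add: abs_mult mult_ac)
    qed
    have sum: "\<eta> \<bullet> attitude_error (\<Delta> ** hat u + S ** hat v) - 2 * (\<delta> \<bullet> (P *v (A *v \<delta> + B *v \<eta>)))
        - 2 * \<kappa> * (\<Delta> \<bullet> (\<Delta> ** hat u + S ** hat v)) =
      - supply_rate \<eta> \<delta> + \<eta> \<bullet> attitude_error (\<Delta> ** hat u) + (1 + trace S) / 2 * (\<eta> \<bullet> v)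
        + (\<Delta> *v attitude_error R) \<bullet> v / 2 - 2 * \<kappa> * (\<Delta> \<bullet> (S ** hat v))"
      using attitude_error_diff_inner[OF R S, of v, folded \<eta>_def, folded \<Delta>_def]
      by (simp add: linear_add[OF linear_attitude_error] inner_add_right inner_mult_hat_self supply_rate_eq
          v_def[symmetric])
    have "\<dots> \<ge> c * z\<^sup>2 - z * (norm \<Delta> * (2 * (K * \<kappa>)) * K1) - \<kappa> / 2 * (z * (K * z))
        - norm \<Delta> * \<kappa> * (K * z) / 2 - 2 * \<kappa> * (norm \<Delta> * (2 * (K * z)))"
      using c(2)[of \<eta> \<delta>, folded z2] b1 b2 b3 b4 by linarith
    moreover have "c * z\<^sup>2 - z * (norm \<Delta> * (2 * (K * \<kappa>)) * K1) - \<kappa> / 2 * (z * (K * z))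
        - norm \<Delta> * \<kappa> * (K * z) / 2 - 2 * \<kappa> * (norm \<Delta> * (2 * (K * z))) =
        c * z\<^sup>2 - \<kappa> * K / 2 * z\<^sup>2 - \<kappa> * a * (norm \<Delta> * z)"
      by (simp add: a_def power2_eq_square algebra_simps)
    moreover have "\<kappa> * K / 2 * z\<^sup>2 \<le> c / 4 * z\<^sup>2"
      using \<kappa>K by (intro mult_right_mono) auto
    moreover have "\<kappa> * a * (norm \<Delta> * z) \<le> c / 4 * z\<^sup>2 + k * (\<kappa> * (norm \<Delta>)\<^sup>2)"
    proof -
      have "0 \<le> (c / 2 * z - \<kappa> * a * norm \<Delta>)\<^sup>2 / c" using c by simp
      also have "\<dots> = c / 4 * z\<^sup>2 + k * (\<kappa> * (norm \<Delta>)\<^sup>2) - \<kappa> * a * (norm \<Delta> * z)"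
        using c by (simp add: k_def power2_eq_square field_simps)
      finally show ?thesis by simp
    qed
    \<comment> \<open>The definition of \<open>cone_form\<close> is solved for
      \<open>\<kappa> * (norm \<Delta>)\<^sup>2\<close>; this converts the leftover into the desired
      multiple of the form.\<close>
    moreover have "k * (\<kappa> * (norm \<Delta>)\<^sup>2) \<le> k * (z\<^sup>2 / 2 - cone_form \<kappa> \<Delta> \<delta>)"
    proof (rule mult_left_mono)
      show "\<kappa> * (norm \<Delta>)\<^sup>2 \<le> z\<^sup>2 / 2 - cone_form \<kappa> \<Delta> \<delta>"
        using P_nonneg[of \<delta>] zero_le_power2[of "norm \<delta>"]
        unfolding cone_form_def z2 \<eta>_def[unfolded \<Delta>_def[symmetric], symmetric] by argo
    qed (use k in simp)
    moreover have "k * z\<^sup>2 \<le> c * z\<^sup>2" using kc by (intro mult_right_mono) auto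
    ultimately have "\<eta> \<bullet> attitude_error (\<Delta> ** hat u + S ** hat v) - 2 * (\<delta> \<bullet> (P *v (A *v \<delta> + B *v \<eta>)))
        - 2 * \<kappa> * (\<Delta> \<bullet> (\<Delta> ** hat u + S ** hat v)) \<ge> k * cone_form \<kappa> \<Delta> \<delta>"
      unfolding sum right_diff_distrib by linarith
    then show "attitude_error (R - S) \<bullet> attitude_error ((R - S) ** hat (ctrl (attitude_error R) x) +
          S ** hat (ctrl (attitude_error (R - S)) (x - y)))
      - 2 * ((x - y) \<bullet> (P *v (A *v (x - y) + B *v attitude_error (R - S))))
      - 2 * \<kappa> * ((R - S) \<bullet> ((R - S) ** hat (ctrl (attitude_error R) x) +
          S ** hat (ctrl (attitude_error (R - S)) (x - y))))
      \<ge> k * cone_form \<kappa> (R - S) (x - y)"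
      unfolding \<eta>_def \<delta>_def \<Delta>_def u_def v_def .
  qed
qed

text \<open>Attitude errors of rotations have norm at most 1, so the form never exceeds 2, which is
  incompatible with exponential growth from a positive value.\<close>

lemma cone_form_nonpos:
  assumes "\<kappa>0 > 0"
  obtains \<kappa> where "0 < \<kappa>" "\<kappa> \<le> \<kappa>0"
    "\<And>E x F y m. loop_solution E x \<Longrightarrow> loop_solution F y \<Longrightarrow> m \<ge> 0 \<Longrightarrow>
      (\<And>t. t \<ge> m \<Longrightarrow> near_flip \<kappa> (E t) (x t) \<and> near_flip \<kappa> (F t) (y t)) \<Longrightarrow>
      cone_form \<kappa> (E m - F m) (x m - y m) \<le> 0"
proof -
  obtain \<kappa> k where \<kappa>: "0 < \<kappa>" "\<kappa> \<le> \<kappa>0" "k > 0" and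
    growth: "\<And>R S x y. R \<in> SO3 \<Longrightarrow> S \<in> SO3 \<Longrightarrow> near_flip \<kappa> R x \<Longrightarrow> near_flip \<kappa> S y \<Longrightarrow>
      attitude_error (R - S) \<bullet> attitude_error ((R - S) ** hat (ctrl (attitude_error R) x) +
          S ** hat (ctrl (attitude_error (R - S)) (x - y)))
      - 2 * ((x - y) \<bullet> (P *v (A *v (x - y) + B *v attitude_error (R - S))))
      - 2 * \<kappa> * ((R - S) \<bullet> ((R - S) ** hat (ctrl (attitude_error R) x) +
          S ** hat (ctrl (attitude_error (R - S)) (x - y))))
      \<ge> k * cone_form \<kappa> (R - S) (x - y)"
    by (rule cone_form_growth[OF assms]) (rule that)
  show ?thesis
  proof (rule that[OF \<kappa>(1,2)])
    fix E x F y and m :: real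
    assume sol: "loop_solution E x" "loop_solution F y" and m: "m \<ge> 0"
      and near: "\<And>t. t \<ge> m \<Longrightarrow> near_flip \<kappa> (E t) (x t) \<and> near_flip \<kappa> (F t) (y t)"
    show "cone_form \<kappa> (E m - F m) (x m - y m) \<le> 0"
    proof (rule nonpos_if_exponential_growth[OF \<kappa>(3) m])
      fix t assume t: "t \<ge> m"
      then have t0: "t \<ge> 0" using m by simp
      show "((\<lambda>t. cone_form \<kappa> (E t - F t) (x t - y t)) has_real_derivative
        attitude_error (E t - F t) \<bullet> attitude_error ((E t - F t) ** hat (ctrl (attitude_error (E t)) (x t)) +
          F t ** hat (ctrl (attitude_error (E t - F t)) (x t - y t)))
        - 2 * ((x t - y t) \<bullet> (P *v (A *v (x t - y t) + B *v attitude_error (E t - F t))))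
        - 2 * \<kappa> * ((E t - F t) \<bullet> ((E t - F t) ** hat (ctrl (attitude_error (E t)) (x t)) +
          F t ** hat (ctrl (attitude_error (E t - F t)) (x t - y t))))) (at t within {0..})"
        by (rule cone_form_deriv[OF loop_diff_deriv[OF sol t0]])
      show "k * cone_form \<kappa> (E t - F t) (x t - y t) \<le> attitude_error (E t - F t) \<bullet> attitude_error ((E t - F t) ** hat (ctrl (attitude_error (E t)) (x t)) +
          F t ** hat (ctrl (attitude_error (E t - F t)) (x t - y t)))
        - 2 * ((x t - y t) \<bullet> (P *v (A *v (x t - y t) + B *v attitude_error (E t - F t))))
        - 2 * \<kappa> * ((E t - F t) \<bullet> ((E t - F t) ** hat (ctrl (attitude_error (E t)) (x t)) +
          F t ** hat (ctrl (attitude_error (E t - F t)) (x t - y t))))"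
        by (intro growth loop_solutionD(1)[OF sol(1) t0] loop_solutionD(1)[OF sol(2) t0])
          (use near[OF t] in auto)
      have "norm (attitude_error (E t - F t)) \<le> 1 + 1"
        unfolding attitude_error_diff
        by (rule order_trans[OF norm_triangle_ineq4 add_mono])
          (rule norm_attitude_error_SO3 loop_solutionD(1)[OF sol(1) t0] loop_solutionD(1)[OF sol(2) t0])+
      then have "(norm (attitude_error (E t - F t)))\<^sup>2 \<le> 2\<^sup>2" by (intro power_mono) auto
      moreover have "0 \<le> \<kappa> * (norm (E t - F t))\<^sup>2" using \<kappa>(1) by simp
      ultimately show "cone_form \<kappa> (E t - F t) (x t - y t) \<le> 2"
        using P_nonneg[of "x t - y t"] unfolding cone_form_def by simp
    qed
  qed
qed

end

section \<open>Measure zero of the exceptional initial states\<close>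

context ndi_lmi
begin

text \<open>The set is cut into countably many pieces, by an integer time \<open>m\<close> from
  which the trajectory stays near the half-turns and by a rotation \<open>R0\<close> close to its
  attitude at that time. On one piece, the controller state at time \<open>m\<close> and two
  coordinates of \<open>W\<close> determine the initial state in a Lipschitz way:
  \<open>2 + CARD('n)\<close> parameters, one less than the dimension of the state space.\<close>

lemma flip_stable_set_null:
  "hausdorff_null (3 + CARD('n)) {(E 0, x 0) | E x. loop_solution E x \<and> ((\<lambda>t. trace (E t)) \<longlongrightarrow> - 1) at_top}"
    (is "hausdorff_null _ ?N")
proof -
  obtain \<rho> where \<rho>: "\<rho> > 0" and diff_bound:
    "\<And>R0 R S. R0 \<in> SO3 \<Longrightarrow> R \<in> SO3 \<Longrightarrow> S \<in> SO3 \<Longrightarrow> \<bar>1 + trace R0\<bar> \<le> \<rho> \<Longrightarrow> norm (R - R0) \<le> \<rho> \<Longrightarrow>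
      norm (S - R0) \<le> \<rho> \<Longrightarrow>
      norm (R - S) \<le> 4 * norm (attitude_error (R - S)) +
        2 * norm (attitude_error (transpose R0 ** (R - S)) - transpose R0 *v attitude_error (transpose R0 ** (R - S)))"
    by (rule SO3_diff_bound) (rule that)
  \<comment> \<open>The cone inequality and the factor 32 below produce the term
    \<open>64 * \<kappa> * (norm \<Delta>)\<^sup>2\<close>; with \<open>\<kappa> \<le> 1/128\<close>
    it is at most half of \<open>(norm \<Delta>)\<^sup>2\<close>.\<close>
  have "min \<rho> (1/128) > 0" using \<rho> by simp
  then obtain \<kappa> where \<kappa>: "0 < \<kappa>" "\<kappa> \<le> min \<rho> (1/128)" and cone:
    "\<And>E x F y m. loop_solution E x \<Longrightarrow> loop_solution F y \<Longrightarrow> m \<ge> 0 \<Longrightarrow>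
      (\<And>t. t \<ge> m \<Longrightarrow> near_flip \<kappa> (E t) (x t) \<and> near_flip \<kappa> (F t) (y t)) \<Longrightarrow>
      cone_form \<kappa> (E m - F m) (x m - y m) \<le> 0"
    by (rule cone_form_nonpos) (rule that; blast)
  obtain K where K: "K > 0" "\<And>x. x \<bullet> (P *v x) \<le> K * (norm x)\<^sup>2"
    by (rule linear_bounds) (rule that)
  obtain L where L: "L > 0" "\<And>E x F y t. loop_solution E x \<Longrightarrow> loop_solution F y \<Longrightarrow> t \<ge> 0 \<Longrightarrow>
    dist (E 0, x 0) (F 0, y 0) \<le> exp (L * t) * dist (E t, x t) (F t, y t)"
    by (rule loop_diff_backward_bound) (rule that)
  \<comment> \<open>One trajectory is chosen for each initial state, so that the state at time
    \<open>m\<close> becomes a function of \<open>p\<close>.\<close>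
  have "\<exists>q. p = (fst q 0, snd q 0) \<and> loop_solution (fst q) (snd q) \<and>
      ((\<lambda>t. trace (fst q t)) \<longlongrightarrow> - 1) at_top" if pN: "p \<in> ?N" for p
  proof -
    obtain E x where "p = (E 0, x 0)" "loop_solution E x" "((\<lambda>t. trace (E t)) \<longlongrightarrow> - 1) at_top"
      using pN by blast
    then show ?thesis by (intro exI[of _ "(E, x)"]) simp
  qed
  then have "\<forall>p\<in>?N. \<exists>q. p = (fst q 0, snd q 0) \<and> loop_solution (fst q) (snd q) \<and>
      ((\<lambda>t. trace (fst q t)) \<longlongrightarrow> - 1) at_top" ..
  from bchoice[OF this] obtain pick where pick: "\<forall>p\<in>?N. p = (fst (pick p) 0, snd (pick p) 0) \<and>
      loop_solution (fst (pick p)) (snd (pick p)) \<and> ((\<lambda>t. trace (fst (pick p) t)) \<longlongrightarrow> - 1) at_top" ..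
  define f where "f p = fst (pick p)" for p
  define g where "g p = snd (pick p)" for p
  have fg: "p = (f p 0, g p 0)" "loop_solution (f p) (g p)" "((\<lambda>t. trace (f p t)) \<longlongrightarrow> - 1) at_top"
    if "p \<in> ?N" for p
    using pick[rule_format, OF that] unfolding f_def g_def by blast+
  \<comment> \<open>The centres are drawn from the near half-turns themselves, because
    \<open>diff_bound\<close> asks for a rotation \<open>R0\<close> with trace close to -1.\<close>
  obtain T where T: "countable T" "T \<subseteq> {R \<in> SO3. \<bar>1 + trace R\<bar> \<le> \<rho>}" "{R \<in> SO3. \<bar>1 + trace R\<bar> \<le> \<rho>} \<subseteq> closure T"
    using separable by blast
  define S where "S = (\<lambda>(m :: nat, R0). {p \<in> ?N. (\<forall>t\<ge>m. near_flip \<kappa> (f p t) (g p t)) \<and> norm (f p m - R0) \<le> \<rho>})"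
  have "?N \<subseteq> (\<Union>i\<in>UNIV \<times> T. S i)"
  proof
    fix p assume p: "p \<in> ?N"
    note sol = fg(2)[OF p]
    have "\<forall>\<^sub>F t in at_top. norm (attitude_error (f p t), g p t) < \<kappa>"
      using order_tendstoD(2)[OF tendsto_norm_zero[OF loop_error_tendsto[OF sol]] \<kappa>(1)] .
    moreover have "((\<lambda>t. \<bar>1 + trace (f p t)\<bar>) \<longlongrightarrow> \<bar>1 + (-1)\<bar>) at_top"
      by (intro tendsto_intros fg(3) p)
    then have "\<forall>\<^sub>F t in at_top. \<bar>1 + trace (f p t)\<bar> < \<kappa>"
      using \<kappa>(1) by (intro order_tendstoD(2)) auto
    ultimately have "\<forall>\<^sub>F t in at_top. near_flip \<kappa> (f p t) (g p t)"
      by eventually_elim (simp add: near_flip_def)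
    then obtain a where a: "\<And>t. t \<ge> a \<Longrightarrow> near_flip \<kappa> (f p t) (g p t)"
      by (auto simp: eventually_at_top_linorder)
    obtain m :: nat where m: "a \<le> m" using real_arch_simple by blast
    then have "f p m \<in> {R \<in> SO3. \<bar>1 + trace R\<bar> \<le> \<rho>}"
      using a[of m] \<kappa>(2) loop_solutionD(1)[OF sol] by (auto simp: near_flip_def)
    then have "f p m \<in> closure T" using T(3) by blast
    then obtain R0 where "R0 \<in> T" "dist R0 (f p m) < \<rho>"
      using \<rho> by (meson closure_approachable)
    then have "p \<in> S (m, R0)"
      using p a m by (auto simp: S_def dist_norm norm_minus_commute)
    then show "p \<in> (\<Union>i\<in>UNIV \<times> T. S i)" using \<open>R0 \<in> T\<close> by blast
  qed
  moreover have "hausdorff_null (3 + CARD('n)) (\<Union>i\<in>UNIV \<times> T. S i)"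
  proof (rule hausdorff_null_countable_Union)
    show "countable ((UNIV :: nat set) \<times> T)" using T(1) by simp
    fix i assume "i \<in> (UNIV :: nat set) \<times> T"
    then obtain m R0 where i: "i = (m, R0)" and R0T: "R0 \<in> T" by auto
    have R0: "R0 \<in> SO3" "\<bar>1 + trace R0\<bar> \<le> \<rho>" using R0T T(2) by auto
    obtain n where n: "n \<noteq> 0" "R0 *v n = n" "transpose R0 *v n = n" using SO3_axis[OF R0(1)] by blast
    obtain j l Kn where Kn: "Kn > 0" "\<And>w. n \<bullet> w = 0 \<Longrightarrow> (norm w)\<^sup>2 \<le> Kn * ((w $ j)\<^sup>2 + (w $ l)\<^sup>2)"
      using orthogonal_two_coordinates[OF n(1)] by blast
    \<comment> \<open>The second vector in \<open>diff_bound\<close>, as a linear function of the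
      difference; it is orthogonal to the axis \<open>n\<close> of \<open>R0\<close>.\<close>
    define W where "W M = attitude_error (transpose R0 ** M) - transpose R0 *v attitude_error (transpose R0 ** M)" for M
    have linW: "bounded_linear W"
    proof -
      have "bounded_linear (\<lambda>M. attitude_error (transpose R0 ** M))"
        by (intro bounded_linear_compose[OF linear_conv_bounded_linear[THEN iffD1, OF linear_attitude_error]]
            bounded_bilinear.bounded_linear_right[OF bounded_bilinear_matrix_mult])
      then show ?thesis
        unfolding W_def by (intro bounded_linear_sub bounded_linear_compose[OF matrix_vector_mul_bounded_linear])
    qed
    have W_perp: "n \<bullet> W M = 0" for M
      by (simp add: W_def inner_diff_right inner_transpose_mult n del: transpose_matrix_vector)
    define h where "h q = ((W (fst q) $ j, W (fst q) $ l), snd q)" for q :: "(real^3^3) \<times> (real^'n)"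
    have linh: "bounded_linear h"
      unfolding h_def
      by (intro bounded_linear_Pair bounded_linear_compose[OF bounded_linear_vec_nth]
          bounded_linear_compose[OF linW] bounded_linear_fst bounded_linear_snd)
    define q where "q p = (f p m, g p m)" for p
    \<comment> \<open>The extra 1 pays for adding \<open>(norm \<delta>)\<^sup>2\<close> to both
      sides.\<close>
    define M where "M = 128 * K + 1 + 16 * Kn"
    show "hausdorff_null (3 + CARD('n)) (S i)"
    proof (rule hausdorff_null_expanding_map[where g = "\<lambda>p. h (q p)" and K = "exp (L * m) * sqrt M"])
      show "DIM((real \<times> real) \<times> (real^'n)) < 3 + CARD('n)" by simp
      have "bounded (q ` S i)"
      proof (rule boundedI)
        fix z assume "z \<in> q ` S i"
        then obtain p where p: "p \<in> ?N" "z = q p" "near_flip \<kappa> (f p m) (g p m)" by (auto simp: i S_def)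
        have "norm (g p m) \<le> \<kappa>"
          using p(3) norm_snd_le[of "g p m" "attitude_error (f p m)"] by (simp add: near_flip_def)
        moreover have "norm (f p m) = sqrt 3"
          by (rule norm_SO3[OF loop_solutionD(1)[OF fg(2)[OF p(1)]]]) simp
        ultimately show "norm z \<le> sqrt 3 + \<kappa>"
          unfolding p(2) q_def by (intro order_trans[OF norm_Pair_le]) simp
      qed
      then show "bounded ((\<lambda>p. h (q p)) ` S i)"
        using bounded_linear_image[OF _ linh] by (metis image_image)
    next
      fix p p' assume p: "p \<in> S i" and p': "p' \<in> S i"
      have pN: "p \<in> ?N" "p' \<in> ?N" using p p' by (auto simp: S_def i)
      note sol = fg(2)[OF pN(1)] fg(2)[OF pN(2)]
      define \<Delta> where "\<Delta> = f p m - f p' m"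
      define \<delta> where "\<delta> = g p m - g p' m"
      have cone: "cone_form \<kappa> \<Delta> \<delta> \<le> 0"
        unfolding \<Delta>_def \<delta>_def by (rule cone[OF sol]) (use p p' in \<open>auto simp: S_def i\<close>)
      have "norm \<Delta> \<le> 4 * norm (attitude_error \<Delta>) + 2 * norm (W \<Delta>)"
        unfolding \<Delta>_def W_def
        by (rule diff_bound[OF R0(1) _ _ R0(2)]) (use p p' loop_solutionD(1)[OF sol(1)] loop_solutionD(1)[OF sol(2)] in \<open>auto simp: S_def i\<close>)
      then have "(norm \<Delta>)\<^sup>2 \<le> (4 * norm (attitude_error \<Delta>) + 2 * norm (W \<Delta>))\<^sup>2"
        by (intro power_mono) auto
      also have "\<dots> \<le> (4 * norm (attitude_error \<Delta>) + 2 * norm (W \<Delta>))\<^sup>2 + (4 * norm (attitude_error \<Delta>) - 2 * norm (W \<Delta>))\<^sup>2"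
        by simp
      also have "\<dots> = 32 * (norm (attitude_error \<Delta>))\<^sup>2 + 8 * (norm (W \<Delta>))\<^sup>2"
        by (simp add: power2_eq_square algebra_simps)
      finally have 1: "(norm \<Delta>)\<^sup>2 \<le> 32 * (norm (attitude_error \<Delta>))\<^sup>2 + 8 * (norm (W \<Delta>))\<^sup>2" .
      have "\<kappa> * (norm \<Delta>)\<^sup>2 \<le> 1/128 * (norm \<Delta>)\<^sup>2" using \<kappa>(2) by (intro mult_right_mono) auto
      then have "(norm \<Delta>)\<^sup>2 \<le> 128 * K * (norm \<delta>)\<^sup>2 + 16 * (norm (W \<Delta>))\<^sup>2"
        using 1 cone K(2)[of \<delta>] unfolding cone_form_def by linarith
      also have "\<dots> \<le> 128 * K * (norm \<delta>)\<^sup>2 + 16 * (Kn * ((W \<Delta> $ j)\<^sup>2 + (W \<Delta> $ l)\<^sup>2))"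
        by (intro add_left_mono mult_left_mono Kn W_perp) auto
      finally have "(norm \<Delta>)\<^sup>2 + (norm \<delta>)\<^sup>2 \<le> (128 * K + 1) * (norm \<delta>)\<^sup>2 + (16 * Kn) * ((W \<Delta> $ j)\<^sup>2 + (W \<Delta> $ l)\<^sup>2)"
        by (simp add: algebra_simps)
      also have "\<dots> \<le> M * (norm \<delta>)\<^sup>2 + M * ((W \<Delta> $ j)\<^sup>2 + (W \<Delta> $ l)\<^sup>2)"
        using K(1) Kn(1) by (intro add_mono mult_right_mono) (auto simp: M_def)
      also have "\<dots> = M * (norm (h (\<Delta>, \<delta>)))\<^sup>2"
        by (simp add: h_def norm_Pair algebra_simps)
      finally have "(norm (\<Delta>, \<delta>))\<^sup>2 \<le> M * (norm (h (\<Delta>, \<delta>)))\<^sup>2"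
        by (simp add: norm_Pair)
      then have "norm (\<Delta>, \<delta>) \<le> sqrt M * norm (h (\<Delta>, \<delta>))"
        using real_le_rsqrt by (fastforce simp: real_sqrt_mult)
      moreover have "h (\<Delta>, \<delta>) = h (q p) - h (q p')"
        using linear_diff[OF bounded_linear.linear[OF linh], of "q p" "q p'"] by (simp add: q_def \<Delta>_def \<delta>_def)
      ultimately have "dist (q p) (q p') \<le> sqrt M * dist (h (q p)) (h (q p'))"
        by (simp add: dist_norm q_def \<Delta>_def \<delta>_def)
      then have "exp (L * m) * dist (q p) (q p') \<le> exp (L * m) * (sqrt M * dist (h (q p)) (h (q p')))"
        by (intro mult_left_mono) auto
      moreover have "dist p p' \<le> exp (L * m) * dist (q p) (q p')"
        using L(2)[OF sol, of m] fg(1)[OF pN(1)] fg(1)[OF pN(2)] unfolding q_def by simp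
      ultimately show "dist p p' \<le> exp (L * m) * sqrt M * dist (h (q p)) (h (q p'))"
        unfolding mult.assoc by (rule order_trans[rotated])
    qed
  qed simp
  ultimately show ?thesis by (rule hausdorff_null_subset[rotated])
qed

lemma loop_almost_globally_asymptotically_stable:
  "almost_globally_asymptotically_stable (3 + CARD('n)) (SO3 \<times> UNIV)
     (closed_loop_trajectories A B C D wd) (mat 1, 0)"
  unfolding almost_globally_asymptotically_stable_def closed_loop_trajectories_eq
proof (intro conjI)
  show "\<forall>p\<in>SO3 \<times> UNIV. \<exists>f\<in>{\<lambda>t. (E t, x t) | E x. loop_solution E x}. f 0 = p"
  proof
    fix p :: "(real^3^3) \<times> (real^'n)" assume "p \<in> SO3 \<times> UNIV"
    then obtain E0 x0 where p: "p = (E0, x0)" "E0 \<in> SO3" by auto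
    obtain E x where "loop_solution E x" "E 0 = E0" "x 0 = x0"
      by (rule loop_solution_exists[OF p(2)])
    then show "\<exists>f\<in>{\<lambda>t. (E t, x t) | E x. loop_solution E x}. f 0 = p"
      using p by (intro bexI[of _ "\<lambda>t. (E t, x t)"]) auto
  qed
  \<comment> \<open>A state belongs to \<open>?N\<close> as soon as some trajectory from it has
    trace tending to -1, so outside \<open>?N\<close> every trajectory converges.\<close>
  let ?N = "{(E 0, x 0) | E x. loop_solution E x \<and> ((\<lambda>t. trace (E t)) \<longlongrightarrow> - 1) at_top}"
  show "\<exists>N\<subseteq>SO3 \<times> UNIV. hausdorff_null (3 + CARD('n)) N \<and>
      (\<forall>f\<in>{\<lambda>t. (E t, x t) | E x. loop_solution E x}. f 0 \<in> SO3 \<times> UNIV - N \<longrightarrow> (f \<longlongrightarrow> (mat 1, 0)) at_top)"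
  proof (intro exI[of _ ?N] conjI ballI impI)
    show "?N \<subseteq> SO3 \<times> UNIV" using loop_solutionD(1) by fastforce
    show "hausdorff_null (3 + CARD('n)) ?N" by (rule flip_stable_set_null)
    fix f assume "f \<in> {\<lambda>t. (E t, x t) | E x. loop_solution E x}" and N: "f 0 \<in> SO3 \<times> UNIV - ?N"
    then obtain E x where f: "f = (\<lambda>t. (E t, x t))" and sol: "loop_solution E x" by blast
    have "\<not> ((\<lambda>t. trace (E t)) \<longlongrightarrow> - 1) at_top" using N sol unfolding f by blast
    then show "(f \<longlongrightarrow> (mat 1, 0)) at_top"
      unfolding f using loop_trace_tendsto[OF sol] loop_tendsto[OF sol] by blast
  qed
qed (rule loop_asymptotically_stable)

end

subsection \<open>Kinematics of the attitude error\<close>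

text \<open>Rotations preserve the cross product. This transports an angular velocity from one side
  of the attitude matrix to the other.\<close>

lemma hat_mult_rotation:
  assumes "R \<in> SO3" shows "R ** hat v = hat (R *v v) ** R"
proof -
  have "(R ** hat v) *v y = (hat (R *v v) ** R) *v y" for y
    using assms by (simp add: matrix_vector_mul_assoc[symmetric] hat_mult_vec SO3_def cross_rotation_matrix)
  then show ?thesis by (simp add: matrix_eq)
qed

text \<open>The product rule leaves \<open>hat (wd t)\<close> to the left of the error matrix;
  rewriting \<open>wd t\<close> as the image of \<open>transpose E *v wd t\<close> under
  \<open>E\<close> moves it to the right.\<close>

lemma attitude_kinematics_error:
  assumes Rd: "attitude_kinematics Rd wd" and R: "attitude_kinematics R w"
  shows "attitude_kinematics (\<lambda>t. transpose (Rd t) ** R t)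
     (\<lambda>t. w t - transpose (transpose (Rd t) ** R t) *v wd t)"
  unfolding attitude_kinematics_def
proof (intro allI impI conjI)
  fix t :: real assume t: "t \<ge> 0"
  note bil = bounded_bilinear_matrix_mult
  define E where "E = transpose (Rd t) ** R t"
  have D: "Rd t \<in> SO3" "(Rd has_vector_derivative Rd t ** hat (wd t)) (at t within {0..})"
    "R t \<in> SO3" "(R has_vector_derivative R t ** hat (w t)) (at t within {0..})"
    using Rd R t by (auto simp: attitude_kinematics_def)
  show E: "transpose (Rd t) ** R t \<in> SO3" by (intro SO3_mult SO3_transpose D)
  have "((\<lambda>t. transpose (Rd t)) has_vector_derivative transpose (Rd t ** hat (wd t))) (at t within {0..})"
    by (rule bounded_linear.has_vector_derivative[OF linear_conv_bounded_linear[THEN iffD1, OF linear_transpose] D(2)])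
  from bounded_bilinear.has_vector_derivative[OF bil this D(4)]
  have "((\<lambda>t. transpose (Rd t) ** R t) has_vector_derivative E ** hat (w t) - hat (wd t) ** E) (at t within {0..})"
    by (simp add: E_def matrix_transpose_mul transpose_hat matrix_mul_assoc bounded_bilinear.minus_left[OF bil])
  moreover have "E *v (transpose E *v wd t) = wd t"
    using E by (metis E_def SO3_iff matrix_vector_mul_assoc matrix_vector_mul_lid)
  then have "hat (wd t) ** E = E ** hat (transpose E *v wd t)"
    using hat_mult_rotation[of E "transpose E *v wd t"] E by (simp only: E_def)
  ultimately show "((\<lambda>t. transpose (Rd t) ** R t) has_vector_derivative transpose (Rd t) ** R t **
      hat (w t - transpose (transpose (Rd t) ** R t) *v wd t)) (at t within {0..})"
    by (simp only: E_def[symmetric] linear_diff[OF linear_hat] bounded_bilinear.diff_right[OF bil])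
qed

subsection \<open>Laplace transforms\<close>

lemma nonneg_integrable_on_atLeast:
  fixes g :: "real \<Rightarrow> real"
  assumes cont: "continuous_on {0..} g" and nonneg: "\<And>t. t \<ge> 0 \<Longrightarrow> g t \<ge> 0"
    and bound: "\<And>T. T \<ge> 0 \<Longrightarrow> integral {0..T} g \<le> M"
  shows "g integrable_on {0..}"
proof -
  define f where "f k t = (if t \<in> {0..real k} then g t else 0)" for k :: nat and t
  have int: "g integrable_on {0..T}" for T
    by (rule integrable_continuous_real[OF continuous_on_subset[OF cont]]) auto
  have I: "integral {0..} (f k) = integral {0..real k} g" for k
    unfolding f_def integral_restrict_Int by (rule arg_cong[of _ _ "\<lambda>S. integral S g"]) auto
  have "g integrable_on {0..} \<and> (\<lambda>k. integral {0..} (f k)) \<longlonglongrightarrow> integral {0..} g"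
  proof (rule monotone_convergence_increasing)
    show "f k integrable_on {0..}" for k
    proof -
      have "{0..real k} \<inter> {0..} = {0..real k}" by auto
      then show ?thesis unfolding f_def integrable_restrict_Int using int by simp
    qed
    show "f k t \<le> f (Suc k) t" if "t \<in> {0..}" for k t
      using nonneg[of t] that by (auto simp: f_def)
    show "(\<lambda>k. f k t) \<longlonglongrightarrow> g t" if "t \<in> {0..}" for t
    proof (rule tendsto_eventually)
      obtain n :: nat where "t \<le> n" using real_arch_simple by blast
      then show "\<forall>\<^sub>F k in sequentially. f k t = g t"
        using that by (auto simp: f_def eventually_sequentially intro!: exI[of _ n])
    qed
    have "\<bar>integral {0..real k} g\<bar> \<le> M" for k
      using bound[of "real k"] integral_nonneg[OF int, of "real k"] nonneg by auto
    then show "bounded (range (\<lambda>k. integral {0..} (f k)))"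
      unfolding I by (auto intro!: boundedI)
  qed
  then show ?thesis ..
qed

lemma tendsto_integral_atLeast:
  fixes f :: "real \<Rightarrow> 'a::euclidean_space"
  assumes f: "f absolutely_integrable_on {0..}"
  shows "((\<lambda>T. integral {0..T} f) \<longlongrightarrow> integral {0..} f) at_top"
proof (rule tendsto_at_topI_sequentially)
  fix X :: "nat \<Rightarrow> real" assume X: "filterlim X at_top sequentially"
  define g where "g k t = (if t \<in> {0..X k} then f t else 0)" for k t
  have sub: "{0..X k} \<inter> {0..} = {0..X k}" for k by auto
  have "(\<lambda>k. integral {0..} (g k)) \<longlonglongrightarrow> integral {0..} f"
  proof (rule dominated_convergence(2))
    show "g k integrable_on {0..}" for k
      unfolding g_def integrable_restrict_Int sub
      using f by (intro integrable_on_subinterval[of f "{0..}"]) (auto simp: absolutely_integrable_on_def)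
    show "(\<lambda>t. norm (f t)) integrable_on {0..}" using f by (simp add: absolutely_integrable_on_def)
    show "norm (g k t) \<le> norm (f t)" for k t by (simp add: g_def)
    show "(\<lambda>k. g k t) \<longlonglongrightarrow> f t" if "t \<in> {0..}" for t
    proof (rule tendsto_eventually)
      have "\<forall>\<^sub>F k in sequentially. t \<le> X k" using X by (simp add: filterlim_at_top)
      then show "\<forall>\<^sub>F k in sequentially. g k t = f t"
        by (rule eventually_mono) (use that in \<open>simp add: g_def\<close>)
    qed
  qed
  then show "(\<lambda>k. integral {0..X k} f) \<longlonglongrightarrow> integral {0..} f"
    unfolding g_def integral_restrict_Int sub .
qed

text \<open>A nonzero limit would keep the norm above a positive constant on arbitrarily long
  intervals. This disposes of the boundary term at infinity in
  \<open>laplace_derivative\<close>.\<close>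

lemma integrable_tendsto_imp_zero:
  fixes f :: "real \<Rightarrow> 'a::euclidean_space"
  assumes f: "f absolutely_integrable_on {0..}" and lim: "(f \<longlongrightarrow> l) at_top"
  shows "l = 0"
proof (rule ccontr)
  assume "l \<noteq> 0"
  then have "\<forall>\<^sub>F t in at_top. norm l / 2 < norm (f t)"
    by (intro order_tendstoD(1)[OF tendsto_norm[OF lim]]) simp
  then obtain a where a: "\<And>t. t \<ge> a \<Longrightarrow> norm l / 2 < norm (f t)"
    by (auto simp: eventually_at_top_linorder)
  define b where "b = max 0 a"
  have int: "(\<lambda>t. norm (f t)) integrable_on {0..}" using f by (simp add: absolutely_integrable_on_def)
  obtain n :: nat where n: "integral {0..} (\<lambda>t. norm (f t)) / (norm l / 2) < n"
    using reals_Archimedean2 by blast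
  have sub: "{b..b + n} \<subseteq> {0..}" by (auto simp: b_def)
  have intb: "(\<lambda>t. norm (f t)) integrable_on {b..b + n}"
    by (rule integrable_on_subinterval[OF int sub])
  have "n * (norm l / 2) = integral {b..b + n} (\<lambda>_. norm l / 2)" by simp
  also have "\<dots> \<le> integral {b..b + n} (\<lambda>t. norm (f t))"
    by (rule integral_le[OF integrable_const_ivl intb]) (use a in \<open>auto simp: b_def intro: less_imp_le\<close>)
  also have "\<dots> \<le> integral {0..} (\<lambda>t. norm (f t))"
    by (rule integral_subset_le[OF sub intb int]) auto
  finally show False using n \<open>l \<noteq> 0\<close> by (simp add: field_simps)
qed

section \<open>Rules for the Laplace transform\<close>

lemma norm_laplace_integrand: "norm (laplace_integrand f s t) = exp (- Re s * t) * norm (f t)"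
proof -
  have "(\<Sum>i\<in>UNIV. (norm (laplace_integrand f s t $ i))\<^sup>2) = (exp (- Re s * t))\<^sup>2 * (\<Sum>i\<in>UNIV. (norm (f t $ i))\<^sup>2)"
    by (simp add: laplace_integrand_def norm_mult power_mult_distrib sum_distrib_left)
  then show ?thesis by (simp add: norm_vec_def L2_set_def real_sqrt_mult)
qed

lemma laplace_exists_imp_integrable:
  "laplace_exists f s \<Longrightarrow> (\<lambda>t. exp (- Re s * t) * norm (f t)) integrable_on {0..}"
  by (simp add: laplace_exists_def absolutely_integrable_on_def norm_laplace_integrand)

lemma laplace_existsI:
  assumes "continuous_on {0..} f" and int: "g integrable_on {0..}"
    and "\<And>t. t \<ge> 0 \<Longrightarrow> exp (- Re s * t) * norm (f t) \<le> g t"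
  shows "laplace_exists f s"
proof -
  have "continuous_on {0..} (laplace_integrand f s)"
    unfolding laplace_integrand_def by (intro continuous_intros assms)
  then show ?thesis
    unfolding laplace_exists_def using assms(3)
    by (intro measurable_bounded_by_integrable_imp_absolutely_integrable[OF _ _ int]
        continuous_imp_measurable_on_sets_lebesgue) (auto simp: norm_laplace_integrand)
qed

lemma laplace_add:
  assumes "laplace_exists f s" "laplace_exists g s"
  shows "laplace_exists (\<lambda>t. f t + g t) s" "laplace (\<lambda>t. f t + g t) s = laplace f s + laplace g s"
proof -
  have eq: "laplace_integrand (\<lambda>t. f t + g t) s = (\<lambda>t. laplace_integrand f s t + laplace_integrand g s t)"
    by (simp add: laplace_integrand_def fun_eq_iff vec_eq_iff algebra_simps)
  show "laplace_exists (\<lambda>t. f t + g t) s"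
    using assms unfolding laplace_exists_def eq by (rule set_integral_add(1))
  show "laplace (\<lambda>t. f t + g t) s = laplace f s + laplace g s"
    using assms unfolding laplace_def eq laplace_exists_def
    by (intro Henstock_Kurzweil_Integration.integral_add) (auto simp: absolutely_integrable_on_def)
qed

lemma laplace_diff:
  assumes "laplace_exists f s" "laplace_exists g s"
  shows "laplace_exists (\<lambda>t. f t - g t) s" "laplace (\<lambda>t. f t - g t) s = laplace f s - laplace g s"
proof -
  have eq: "laplace_integrand (\<lambda>t. f t - g t) s = (\<lambda>t. laplace_integrand f s t - laplace_integrand g s t)"
    by (simp add: laplace_integrand_def fun_eq_iff vec_eq_iff algebra_simps)
  show "laplace_exists (\<lambda>t. f t - g t) s"
    using assms unfolding laplace_exists_def eq by (rule set_integral_diff(1))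
  show "laplace (\<lambda>t. f t - g t) s = laplace f s - laplace g s"
    using assms unfolding laplace_def eq laplace_exists_def
    by (intro Henstock_Kurzweil_Integration.integral_diff) (auto simp: absolutely_integrable_on_def)
qed

lemma laplace_mult_vec:
  fixes M :: "real^'n^'m"
  assumes "laplace_exists f s"
  shows "laplace_exists (\<lambda>t. M *v f t) s" "laplace (\<lambda>t. M *v f t) s = complex_matrix M *v laplace f s"
proof -
  have "linear ((*v) (complex_matrix M))"
    by (intro linearI) (simp_all add: vec_eq_iff matrix_vector_mult_def algebra_simps sum.distrib scaleR_sum_right)
  then have bl: "bounded_linear ((*v) (complex_matrix M))" by (simp add: linear_conv_bounded_linear)
  have eq: "laplace_integrand (\<lambda>t. M *v f t) s = (*v) (complex_matrix M) \<circ> laplace_integrand f s"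
    by (simp add: laplace_integrand_def fun_eq_iff vec_eq_iff matrix_vector_mult_def complex_matrix_def
        sum_distrib_left mult_ac)
  show "laplace_exists (\<lambda>t. M *v f t) s"
    using assms unfolding laplace_exists_def eq by (rule absolutely_integrable_linear[OF _ bl])
  show "laplace (\<lambda>t. M *v f t) s = complex_matrix M *v laplace f s"
    using assms unfolding laplace_def eq laplace_exists_def
    by (intro integral_linear bl) (auto simp: absolutely_integrable_on_def)
qed

text \<open>Integration by parts, with absolute integrability in place of a growth condition: the
  integrand of \<open>f\<close> has an integrable derivative, so it converges at infinity, and being
  integrable itself it converges to 0.\<close>

lemma laplace_derivative:
  assumes deriv: "\<And>t. t \<ge> 0 \<Longrightarrow> (f has_vector_derivative f' t) (at t within {0..})" and f0: "f 0 = 0"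
    and ex: "laplace_exists f s" and ex': "laplace_exists f' s"
  shows "laplace f' s = s *s laplace f s"
proof -
  let ?u = "laplace_integrand f s"
  define u' where "u' t = laplace_integrand f' s t - s *s ?u t" for t
  have smult: "bounded_linear ((*s) s :: complex^'a \<Rightarrow> complex^'a)"
    unfolding linear_conv_bounded_linear[symmetric]
    by (intro linearI) (simp_all add: vec_eq_iff algebra_simps)
  have u': "(?u has_vector_derivative u' t) (at t within {0..})" if "t \<ge> 0" for t
  proof -
    define cvec where "cvec v = (\<chi> i. complex_of_real (v $ i))" for v :: "real^'a"
    have "bounded_linear cvec"
      unfolding linear_conv_bounded_linear[symmetric] cvec_def
      by (intro linearI) (simp_all add: vec_eq_iff scaleR_conv_of_real[where 'a = complex])
    then have F: "((\<lambda>t. cvec (f t)) has_vector_derivative cvec (f' t)) (at t within {0..})"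
      by (rule bounded_linear.has_vector_derivative[OF _ deriv[OF that]])
    have bil: "bounded_bilinear ((*s) :: complex \<Rightarrow> complex^'a \<Rightarrow> complex^'a)"
      unfolding bilinear_conv_bounded_bilinear[symmetric] bilinear_def
      by (intro conjI allI linearI)
        (simp_all only: vec_eq_iff vector_smult_component vector_scaleR_component vector_add_component
          distrib_left distrib_right mult_scaleR_left mult_scaleR_right simp_thms)
    have "((\<lambda>t. exp (- s * of_real t)) has_vector_derivative - s * exp (- s * of_real t)) (at t within {0..})"
      by (auto intro!: derivative_eq_intros has_vector_derivative_real_field)
    from bounded_bilinear.has_vector_derivative[OF bil this F]
    have "((\<lambda>t. exp (- s * of_real t) *s cvec (f t)) has_vector_derivative
        exp (- s * of_real t) *s cvec (f' t) + (- s * exp (- s * of_real t)) *s cvec (f t)) (at t within {0..})" .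
    moreover have u_eq: "laplace_integrand h s = (\<lambda>t. exp (- s * of_real t) *s cvec (h t))" for h
      by (simp add: laplace_integrand_def cvec_def fun_eq_iff vec_eq_iff)
    moreover have "exp (- s * of_real t) *s cvec (f' t) + (- s * exp (- s * of_real t)) *s cvec (f t) = u' t"
      by (simp add: u'_def u_eq vec_eq_iff algebra_simps)
    ultimately show ?thesis by simp
  qed
  have ai: "?u absolutely_integrable_on {0..}" "laplace_integrand f' s absolutely_integrable_on {0..}"
    using ex ex' by (auto simp: laplace_exists_def)
  have ais: "(\<lambda>t. s *s ?u t) absolutely_integrable_on {0..}"
    using absolutely_integrable_linear[OF ai(1) smult] by (simp add: o_def)
  have aiu': "u' absolutely_integrable_on {0..}"
    unfolding u'_def using ai(2) ais by (rule set_integral_diff(1))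
  have "integral {0..T} u' = ?u T" if "T \<ge> 0" for T
  proof -
    have "(u' has_integral (?u T - ?u 0)) {0..T}"
      using that by (intro fundamental_theorem_of_calculus) (auto intro!: has_vector_derivative_within_subset[OF u'])
    moreover have "?u 0 = 0" by (simp add: laplace_integrand_def f0 vec_eq_iff)
    ultimately show ?thesis by (simp add: integral_unique)
  qed
  then have "(?u \<longlongrightarrow> integral {0..} u') at_top"
    using tendsto_integral_atLeast[OF aiu']
    by (rule_tac Lim_transform_eventually) (auto intro: eventually_mono[OF eventually_ge_at_top[of 0]])
  then have "integral {0..} u' = 0" by (rule integrable_tendsto_imp_zero[OF ai(1)])
  moreover have "integral {0..} u' = laplace f' s - integral {0..} (\<lambda>t. s *s ?u t)"
    unfolding u'_def laplace_def using ai(2) ais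
    by (intro Henstock_Kurzweil_Integration.integral_diff) (auto simp: absolutely_integrable_on_def)
  moreover have "integral {0..} (\<lambda>t. s *s ?u t) = s *s laplace f s"
    using integral_linear[OF _ smult, of ?u "{0..}"] ai(1)
    by (simp add: o_def laplace_def absolutely_integrable_on_def)
  ultimately show ?thesis by simp
qed

subsection \<open>Local dynamics\<close>

lemma invertible_matrix_inv:
  fixes M :: "'a::field^'n^'n"
  assumes "invertible M" shows "matrix_inv M ** M = mat 1" "M ** matrix_inv M = mat 1"
  using someI_ex[OF assms[unfolded invertible_def]] by (auto simp: matrix_inv_def)

lemma invertible_if_ker:
  fixes M :: "'a::field^'n^'n"
  shows "(\<And>v. M *v v = 0 \<Longrightarrow> v = 0) \<Longrightarrow> invertible M"
  by (simp add: invertible_left_inverse matrix_left_invertible_ker)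

lemma mat_mult_vec: "mat s *v v = s *s v" for v :: "'a::comm_semiring_1^'n"
proof -
  have "(\<Sum>j\<in>UNIV. (if i = j then s else 0) * v $ j) = s * v $ i" for i
    by (simp add: if_distrib[where f = "\<lambda>x. x * _"] cong: if_cong)
  then show ?thesis by (simp add: mat_def matrix_vector_mult_def vec_eq_iff)
qed

definition vRe :: "complex^'n \<Rightarrow> real^'n" where "vRe v = (\<chi> i. Re (v $ i))"
definition vIm :: "complex^'n \<Rightarrow> real^'n" where "vIm v = (\<chi> i. Im (v $ i))"

lemma vRe_vIm_simps:
  "vRe (complex_matrix M *v v) = M *v vRe v" "vIm (complex_matrix M *v v) = M *v vIm v"
  "vRe (v + w) = vRe v + vRe w" "vIm (v + w) = vIm v + vIm w"
  "vRe (s *s v) = Re s *\<^sub>R vRe v - Im s *\<^sub>R vIm v" "vIm (s *s v) = Re s *\<^sub>R vIm v + Im s *\<^sub>R vRe v"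
  by (simp_all add: vRe_def vIm_def vec_eq_iff complex_matrix_def matrix_vector_mult_def)

lemma vRe_vIm_eq_0: "vRe v = 0 \<Longrightarrow> vIm v = 0 \<Longrightarrow> v = 0"
  by (simp add: vRe_def vIm_def vec_eq_iff complex_eq_iff)

context ndi_lmi
begin

lemma supply_rate_zero_imp:
  assumes "supply_rate e x + supply_rate f y \<ge> 0"
  shows "e = 0" "x = 0" "f = 0" "y = 0"
proof -
  obtain c where c: "c > 0" "\<And>e x. supply_rate e x \<le> - c * ((norm e)\<^sup>2 + (norm x)\<^sup>2)"
    using supply_rate_bound by blast
  have "c * ((norm e)\<^sup>2 + (norm x)\<^sup>2 + (norm f)\<^sup>2 + (norm y)\<^sup>2) \<le> 0"
    using assms c(2)[of e x] c(2)[of f y] by (simp add: algebra_simps)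
  then have le: "(norm e)\<^sup>2 + (norm x)\<^sup>2 + (norm f)\<^sup>2 + (norm y)\<^sup>2 \<le> 0"
    using c(1) by (simp add: mult_le_0_iff)
  have "(norm e)\<^sup>2 = 0" "(norm x)\<^sup>2 = 0" "(norm f)\<^sup>2 = 0" "(norm y)\<^sup>2 = 0"
    using le zero_le_power2[of "norm e"] zero_le_power2[of "norm x"] zero_le_power2[of "norm f"] zero_le_power2[of "norm y"]
    by linarith+
  then show "e = 0" "x = 0" "f = 0" "y = 0" by simp_all
qed

text \<open>With \<open>x\<close> and \<open>y\<close> as real and imaginary parts, the second
  arguments are those of the product with the complex number a + b i. The terms with
  \<open>b\<close> cancel by the symmetry of \<open>P\<close>.\<close>

lemma P_form_eigen:
  "x \<bullet> (P *v (a *\<^sub>R x - b *\<^sub>R y)) + y \<bullet> (P *v (a *\<^sub>R y + b *\<^sub>R x)) = a * (x \<bullet> (P *v x) + y \<bullet> (P *v y))"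
proof -
  have "y \<bullet> (P *v x) = x \<bullet> (P *v y)" by (metis P_symmetric inner_commute)
  then show ?thesis
    by (simp add: matrix_vector_right_distrib matrix_vector_mult_diff_distrib matrix_vector_mult_scaleR
        inner_add_right inner_diff_right algebra_simps)
qed

text \<open>An eigenvector with eigenvalue \<open>s\<close> would make the supply rates of its real
  and imaginary parts, with zero attitude error, add up to a nonnegative number.\<close>

lemma resolvent_invertible:
  assumes s: "Re s \<ge> 0" shows "invertible (mat s - complex_matrix A)"
proof (rule invertible_if_ker)
  fix v assume "(mat s - complex_matrix A) *v v = 0"
  then have v: "complex_matrix A *v v = s *s v"
    by (simp add: matrix_vector_mult_diff_rdistrib mat_mult_vec)
  have A: "A *v vRe v = Re s *\<^sub>R vRe v - Im s *\<^sub>R vIm v" "A *v vIm v = Re s *\<^sub>R vIm v + Im s *\<^sub>R vRe v"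
    using arg_cong[OF v, of vRe] arg_cong[OF v, of vIm] by (simp_all add: vRe_vIm_simps)
  have "supply_rate 0 (vRe v) + supply_rate 0 (vIm v) = 2 * (Re s * (vRe v \<bullet> (P *v vRe v) + vIm v \<bullet> (P *v vIm v)))"
    unfolding P_form_eigen[of _ _ "Im s", symmetric] by (simp add: supply_rate_def A)
  also have "\<dots> \<ge> 0" using s P_nonneg by simp
  finally show "v = 0" using supply_rate_zero_imp vRe_vIm_eq_0 by blast
qed

text \<open>A kernel vector \<open>v\<close>, completed by the controller state \<open>z\<close> it
  induces, is an eigenvector with eigenvalue \<open>s\<close> of the full loop matrix with blocks
  \<open>A\<close>, \<open>B\<close>, \<open>C\<close>, \<open>D\<close>; the argument for the
  resolvent then applies to the pair.\<close>

lemma transfer_invertible: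
  assumes s: "Re s \<ge> 0" shows "invertible (mat s - transfer_matrix A B C D s)"
proof (rule invertible_if_ker)
  fix v assume v: "(mat s - transfer_matrix A B C D s) *v v = 0"
  define z where "z = matrix_inv (mat s - complex_matrix A) *v (complex_matrix B *v v)"
  have "(mat s - complex_matrix A) *v z = complex_matrix B *v v"
    unfolding z_def using invertible_matrix_inv(2)[OF resolvent_invertible[OF s]]
    by (metis matrix_vector_mul_assoc matrix_vector_mul_lid)
  then have z: "complex_matrix A *v z + complex_matrix B *v v = s *s z"
    by (simp add: matrix_vector_mult_diff_rdistrib mat_mult_vec algebra_simps)
  have v': "complex_matrix C *v z + complex_matrix D *v v = s *s v"
    using v by (simp add: transfer_matrix_def matrix_vector_mult_diff_rdistrib matrix_vector_mult_add_rdistrib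
        mat_mult_vec matrix_vector_mul_assoc[symmetric] z_def)
  have zz: "A *v vRe z + B *v vRe v = Re s *\<^sub>R vRe z - Im s *\<^sub>R vIm z"
    "A *v vIm z + B *v vIm v = Re s *\<^sub>R vIm z + Im s *\<^sub>R vRe z"
    using arg_cong[OF z, of vRe] arg_cong[OF z, of vIm] by (simp_all add: vRe_vIm_simps)
  have vv: "C *v vRe z + D *v vRe v = Re s *\<^sub>R vRe v - Im s *\<^sub>R vIm v"
    "C *v vIm z + D *v vIm v = Re s *\<^sub>R vIm v + Im s *\<^sub>R vRe v"
    using arg_cong[OF v', of vRe] arg_cong[OF v', of vIm] by (simp_all add: vRe_vIm_simps)
  have "supply_rate (vRe v) (vRe z) + supply_rate (vIm v) (vIm z) =
      Re s * (vRe v \<bullet> vRe v + vIm v \<bullet> vIm v) + 2 * (Re s * (vRe z \<bullet> (P *v vRe z) + vIm z \<bullet> (P *v vIm z)))"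
    unfolding P_form_eigen[of _ _ "Im s", symmetric]
    by (simp add: supply_rate_def zz vv inner_diff_right inner_add_right inner_commute algebra_simps)
  also have "\<dots> \<ge> 0" using s P_nonneg by simp
  finally show "v = 0" using supply_rate_zero_imp vRe_vIm_eq_0 by blast
qed

text \<open>The attitude part of the energy becomes \<open>(norm e)^2 / 2\<close> for small errors.\<close>

definition local_energy :: "real^3 \<Rightarrow> real^'n \<Rightarrow> real" where
  "local_energy e x = (e \<bullet> e) / 2 + x \<bullet> (P *v x)"

lemma local_energy_deriv:
  assumes "(e has_vector_derivative v) (at t within S)" "(x has_vector_derivative w) (at t within S)"
  shows "((\<lambda>t. local_energy (e t) (x t)) has_real_derivative e t \<bullet> v + 2 * (x t \<bullet> (P *v w))) (at t within S)"
proof -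
  have "((\<lambda>t. e t \<bullet> e t) has_real_derivative 2 * (e t \<bullet> v)) (at t within S)"
    using bounded_bilinear.has_vector_derivative[OF bounded_bilinear_inner assms(1) assms(1)]
    by (simp add: has_real_derivative_iff_has_vector_derivative inner_commute)
  with P_form_deriv[OF assms(2)] show ?thesis
    unfolding local_energy_def by (auto intro!: derivative_eq_intros)
qed

lemma local_energy_bounds:
  obtains m M where "m > 0" "M > 0" "\<And>e x. m * (norm (e, x))\<^sup>2 \<le> local_energy e x"
    "\<And>e x. local_energy e x \<le> M * (norm (e, x))\<^sup>2"
proof -
  obtain p where p: "p > 0" "\<And>x. p * (norm x)\<^sup>2 \<le> x \<bullet> (P *v x)"
    using P_bound by blast
  obtain K where K: "K > 0" "\<And>x. x \<bullet> (P *v x) \<le> K * (norm x)\<^sup>2"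
    by (rule linear_bounds) (rule that)
  have d: "(norm (e, x))\<^sup>2 = (norm e)\<^sup>2 + (norm x)\<^sup>2" for e :: "real^3" and x :: "real^'n"
    by (simp add: norm_Pair)
  have en: "local_energy e x = 1/2 * (norm e)\<^sup>2 + x \<bullet> (P *v x)" for e x
    by (simp add: local_energy_def power2_norm_eq_inner)
  show ?thesis
  proof (rule that[of "min (1/2) p" "max (1/2) K"])
    fix e :: "real^3" and x :: "real^'n"
    show "min (1/2) p * (norm (e, x))\<^sup>2 \<le> local_energy e x"
      unfolding d en distrib_left
      by (intro add_mono order_trans[OF mult_right_mono p(2)] mult_right_mono) auto
    show "local_energy e x \<le> max (1/2) K * (norm (e, x))\<^sup>2"
      unfolding d en distrib_left
      by (intro add_mono order_trans[OF K(2) mult_right_mono] mult_right_mono) auto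
  qed (use p K in auto)
qed

text \<open>With matching feedforward, \<open>r\<close> cancels from the error dynamics and
  \<open>local_energy\<close> decays exponentially. Zero initial energy therefore stays zero, and
  any other initial error dies out.\<close>

lemma local_loop_tracking:
  assumes loop: "local_closed_loop A B C D r r \<Phi> \<Phi>d x"
  shows "\<Phi> 0 = \<Phi>d 0 \<and> x 0 = 0 \<longrightarrow> (\<forall>t\<ge>0. \<Phi> t = \<Phi>d t)" "((\<lambda>t. \<Phi> t - \<Phi>d t) \<longlongrightarrow> 0) at_top"
proof -
  obtain m M where mM: "m > 0" "M > 0" "\<And>e x. m * (norm (e, x))\<^sup>2 \<le> local_energy e x"
    "\<And>e x. local_energy e x \<le> M * (norm (e, x))\<^sup>2"
    using local_energy_bounds by blast
  obtain c where c: "c > 0" "\<And>e x. supply_rate e x \<le> - c * ((norm e)\<^sup>2 + (norm x)\<^sup>2)"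
    using supply_rate_bound by blast
  define e where "e t = \<Phi> t - \<Phi>d t" for t
  have e': "(e has_vector_derivative C *v x t + D *v e t) (at t within {0..})"
    and x': "(x has_vector_derivative A *v x t + B *v e t) (at t within {0..})" if "t \<ge> 0" for t
    using loop that unfolding local_closed_loop_def e_def by auto
  define W where "W t = local_energy (e t) (x t)" for t
  \<comment> \<open>The dissipation \<open>c * (norm (e, x))\<^sup>2\<close> is at least
    \<open>k\<close> times the local energy, by its upper bound with \<open>M\<close>.\<close>
  define k where "k = c / M"
  have k: "k > 0" using c mM by (simp add: k_def)
  have W': "((\<lambda>t. W t * exp (k * t)) has_real_derivative (supply_rate (e t) (x t) + k * W t) * exp (k * t))
      (at t within {0..})" if "t \<ge> 0" for t
    unfolding W_def
    by (rule derivative_eq_intros local_energy_deriv[OF e'[OF that] x'[OF that]] refl)+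
      (simp add: supply_rate_def algebra_simps)
  have "supply_rate (e t) (x t) + k * W t \<le> 0" for t
  proof -
    have "k * W t \<le> k * (M * (norm (e t, x t))\<^sup>2)" using k mM(4) by (simp add: W_def)
    also have "\<dots> = c * ((norm (e t))\<^sup>2 + (norm (x t))\<^sup>2)" using mM(2) by (simp add: k_def norm_Pair)
    finally show ?thesis using c(2)[of "e t" "x t"] by simp
  qed
  then have bound: "W t * exp (k * t) \<le> W 0 * exp (k * 0)" if "t \<ge> 0" for t
    using that by (intro nonincreasing_on_atLeast[OF W']) (auto intro!: mult_nonpos_nonneg)
  have decay: "W t \<le> W 0 * exp (- (k * t))" if "t \<ge> 0" for t
  proof -
    have "W t * exp (k * t) * exp (- (k * t)) \<le> W 0 * exp (k * 0) * exp (- (k * t))"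
      using bound[OF that] by (intro mult_right_mono) auto
    then show ?thesis by (simp add: mult.assoc mult_exp_exp)
  qed
  have eW: "m * (norm (e t))\<^sup>2 \<le> W t" for t
  proof -
    have "m * (norm (e t))\<^sup>2 \<le> m * (norm (e t, x t))\<^sup>2"
      using mM(1) by (intro mult_left_mono power_mono norm_fst_le) auto
    then show ?thesis using mM(3)[of "e t" "x t"] by (simp add: W_def)
  qed
  show "\<Phi> 0 = \<Phi>d 0 \<and> x 0 = 0 \<longrightarrow> (\<forall>t\<ge>0. \<Phi> t = \<Phi>d t)"
  proof (intro impI allI)
    fix t :: real assume *: "\<Phi> 0 = \<Phi>d 0 \<and> x 0 = 0" and t: "t \<ge> 0"
    have "W 0 = 0" using * by (simp add: W_def e_def local_energy_def)
    then have "m * (norm (e t))\<^sup>2 \<le> 0" using decay[OF t] eW[of t] by simp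
    then have "(norm (e t))\<^sup>2 \<le> 0" using mM(1) by (simp add: mult_le_0_iff)
    then show "\<Phi> t = \<Phi>d t" by (simp add: e_def)
  qed
  have "((\<lambda>t. (norm (e t))\<^sup>2) \<longlongrightarrow> 0) at_top"
  proof (rule tendsto_sandwich[OF _ _ tendsto_const])
    show "\<forall>\<^sub>F t in at_top. 0 \<le> (norm (e t))\<^sup>2" by simp
    show "\<forall>\<^sub>F t in at_top. (norm (e t))\<^sup>2 \<le> W 0 / m * exp (- (k * t))"
    proof (rule eventually_mono[OF eventually_ge_at_top[of 0]])
      fix t :: real assume "t \<ge> 0"
      then have "m * (norm (e t))\<^sup>2 \<le> W 0 * exp (- (k * t))" using decay eW order_trans by blast
      then show "(norm (e t))\<^sup>2 \<le> W 0 / m * exp (- (k * t))" using mM(1) by (simp add: field_simps)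
    qed
    have "filterlim (\<lambda>t. - (k * t)) at_bot at_top"
      using k by (simp add: filterlim_uminus_at_bot filterlim_tendsto_pos_mult_at_top[OF tendsto_const _ filterlim_ident])
    then have "((\<lambda>t. W 0 / m * exp (- (k * t))) \<longlongrightarrow> W 0 / m * 0) at_top"
      by (intro tendsto_mult tendsto_const filterlim_compose[OF exp_at_bot])
    then show "((\<lambda>t. W 0 / m * exp (- (k * t))) \<longlongrightarrow> 0) at_top" by simp
  qed
  then have "((\<lambda>t. sqrt ((norm (e t))\<^sup>2)) \<longlongrightarrow> sqrt 0) at_top" by (rule tendsto_real_sqrt)
  then have "(e \<longlongrightarrow> 0) at_top" by (simp add: tendsto_norm_zero_iff)
  then show "((\<lambda>t. \<Phi> t - \<Phi>d t) \<longlongrightarrow> 0) at_top" unfolding e_def .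
qed

text \<open>The state is \<open>\<Phi>\<close> rather than the error, so that only
  \<open>\<Phi>d\<close>, and not its derivative, enters as forcing. The square root of the energy
  obeys a linear differential inequality with decay rate \<open>a\<close> and forcing
  \<open>b * norm (\<Phi>d t)\<close>, which is integrated against the weight.\<close>

lemma forced_local_loop_integral_bound:
  assumes \<Phi>': "\<And>t. t \<ge> 0 \<Longrightarrow> (\<Phi> has_vector_derivative C *v x t + D *v (\<Phi> t - \<Phi>d t)) (at t within {0..})"
    and x': "\<And>t. t \<ge> 0 \<Longrightarrow> (x has_vector_derivative A *v x t + B *v (\<Phi> t - \<Phi>d t)) (at t within {0..})"
    and init: "\<Phi> 0 = 0" "x 0 = 0" and \<sigma>: "\<sigma> \<ge> 0"
    and int: "(\<lambda>t. exp (- \<sigma> * t) * norm (\<Phi>d t)) integrable_on {0..}"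
  obtains H where "\<And>T. T \<ge> 0 \<Longrightarrow> integral {0..T} (\<lambda>t. exp (- \<sigma> * t) * norm (\<Phi> t, x t)) \<le> H"
proof -
  obtain m M where mM: "m > 0" "M > 0" "\<And>e x. m * (norm (e, x))\<^sup>2 \<le> local_energy e x"
    "\<And>e x. local_energy e x \<le> M * (norm (e, x))\<^sup>2"
    using local_energy_bounds by blast
  obtain c where c: "c > 0" "\<And>e x. supply_rate e x \<le> - c * ((norm e)\<^sup>2 + (norm x)\<^sup>2)"
    using supply_rate_bound by blast
  define K where "K = norm D + 2 * (norm P * norm B)"
  have K0: "K \<ge> 0" by (simp add: K_def)
  define V where "V t = local_energy (\<Phi> t) (x t)" for t
  define V' where "V' t = supply_rate (\<Phi> t) (x t) - (\<Phi> t \<bullet> (D *v \<Phi>d t) + 2 * (x t \<bullet> (P *v (B *v \<Phi>d t))))" for t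
  have V': "(V has_real_derivative V' t) (at t within {0..})" if "t \<ge> 0" for t
    unfolding V_def
    by (rule DERIV_cong[OF local_energy_deriv[OF \<Phi>'[OF that] x'[OF that]]])
      (simp add: V'_def supply_rate_def matrix_vector_mult_diff_distrib matrix_vector_right_distrib
        inner_add_right inner_diff_right algebra_simps)
  \<comment> \<open>Passing from the energy to its square root halves both the decay rate and the
    forcing coefficient.\<close>
  define a where "a = c / (2 * M)"
  define b where "b = K / (2 * sqrt m)"
  have ab: "a > 0" "b \<ge> 0" using c mM K0 by (auto simp: a_def b_def)
  have yV: "sqrt m * norm (\<Phi> t, x t) \<le> sqrt (V t)" for t
    using real_sqrt_le_mono[OF mM(3)[of "\<Phi> t" "x t"]] by (simp add: V_def real_sqrt_mult)
  have V0: "V t \<ge> 0" for t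
    by (simp add: V_def local_energy_def P_nonneg)
  have V'_le: "V' t \<le> - 2 * a * V t + 2 * b * sqrt (V t) * norm (\<Phi>d t)" for t
  proof -
    have "2 * a * V t \<le> c * (norm (\<Phi> t, x t))\<^sup>2"
      using mM(2) mM(4)[of "\<Phi> t" "x t"] c(1) by (simp add: a_def V_def field_simps)
    then have 1: "supply_rate (\<Phi> t) (x t) \<le> - 2 * a * V t"
      using c(2)[of "\<Phi> t" "x t"] by (simp add: norm_Pair)
    have "norm (P *v (B *v \<Phi>d t)) \<le> norm P * (norm B * norm (\<Phi>d t))"
      by (rule order_trans[OF norm_matrix_vector_mult_le mult_left_mono[OF norm_matrix_vector_mult_le]]) simp
    then have "\<bar>x t \<bullet> (P *v (B *v \<Phi>d t))\<bar> \<le> norm (\<Phi> t, x t) * (norm P * (norm B * norm (\<Phi>d t)))"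
      by (intro order_trans[OF Cauchy_Schwarz_ineq2 mult_mono] norm_snd_le) auto
    moreover have "\<bar>\<Phi> t \<bullet> (D *v \<Phi>d t)\<bar> \<le> norm (\<Phi> t, x t) * (norm D * norm (\<Phi>d t))"
      by (intro order_trans[OF Cauchy_Schwarz_ineq2 mult_mono] norm_fst_le norm_matrix_vector_mult_le) auto
    ultimately have "- (\<Phi> t \<bullet> (D *v \<Phi>d t) + 2 * (x t \<bullet> (P *v (B *v \<Phi>d t)))) \<le> norm (\<Phi> t, x t) * K * norm (\<Phi>d t)"
      unfolding K_def distrib_left distrib_right by (simp add: mult_ac)
    also have "\<dots> \<le> (sqrt (V t) / sqrt m) * K * norm (\<Phi>d t)"
      using yV[of t] mM(1) K0 by (intro mult_right_mono) (auto simp: field_simps)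
    also have "\<dots> = 2 * b * sqrt (V t) * norm (\<Phi>d t)" by (simp add: b_def)
    finally show ?thesis using 1 by (simp add: V'_def)
  qed
  have cont_\<Phi>: "continuous_on {0..} \<Phi>" and cont_x: "continuous_on {0..} x"
    unfolding continuous_on_eq_continuous_within
    using \<Phi>' x' has_vector_derivative_continuous by fastforce+
  have cont_V: "continuous_on {0..} V"
    unfolding continuous_on_eq_continuous_within using V' DERIV_continuous by fastforce
  define J where "J = integral {0..} (\<lambda>t. exp (- \<sigma> * t) * norm (\<Phi>d t))"
  show ?thesis
  \<comment> \<open>The summands \<open>a\<close>, \<open>b * J\<close> and 1 account for the
    regularization, the forcing and the initial value of \<open>g\<close>.\<close>
  proof (rule that[of "(a + b * J + 1) / (a * sqrt m)"])
    fix T :: real assume T: "T \<ge> 0"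
    \<comment> \<open>The square root is not differentiable where the energy vanishes, in particular
      at time 0, hence the regularization. Letting it depend on \<open>T\<close> keeps the
      accumulated error \<open>a * \<epsilon> * T\<close> below \<open>a\<close>.\<close>
    define \<epsilon> where "\<epsilon> = 1 / (T + 1)"
    have \<epsilon>: "\<epsilon> > 0" "\<epsilon> \<le> 1" "\<epsilon> * T \<le> 1" using T by (auto simp: \<epsilon>_def field_simps)
    define g where "g t = sqrt (V t + \<epsilon>\<^sup>2)" for t
    have pos: "V t + \<epsilon>\<^sup>2 > 0" for t using V0[of t] \<epsilon>(1) by (simp add: add_nonneg_pos)
    have g_ge: "g t \<ge> \<epsilon>" "g t \<ge> sqrt (V t)" for t
    proof -
      show "g t \<ge> \<epsilon>" unfolding g_def using V0[of t] \<epsilon>(1) by (intro real_le_rsqrt) simp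
      show "g t \<ge> sqrt (V t)" unfolding g_def by simp
    qed
    have g2: "(g t)\<^sup>2 = V t + \<epsilon>\<^sup>2" for t unfolding g_def using pos[of t] by simp
    have g0: "g t > 0" for t using g_ge(1)[of t] \<epsilon>(1) by linarith
    define h' where "h' t = exp (- \<sigma> * t) * (V' t / (2 * g t) - \<sigma> * g t)" for t
    have g': "(g has_real_derivative V' t / (2 * g t)) (at t within {0..})" if "t \<ge> 0" for t
    proof -
      have "((\<lambda>t. V t + \<epsilon>\<^sup>2) has_real_derivative V' t) (at t within {0..})"
        using V'[OF that] by (auto intro!: derivative_eq_intros)
      from DERIV_chain2[OF DERIV_real_sqrt[OF pos] this] show ?thesis
        unfolding g_def by (rule DERIV_cong) (simp add: field_simps)
    qed
    have h': "((\<lambda>t. exp (- \<sigma> * t) * g t) has_real_derivative h' t) (at t within {0..})" if "t \<ge> 0" for t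
      by (rule derivative_eq_intros g'[OF that] refl)+ (simp add: h'_def algebra_simps)
    have ineq: "h' t + a * (exp (- \<sigma> * t) * g t) \<le> a * \<epsilon> + b * (exp (- \<sigma> * t) * norm (\<Phi>d t))" if "t \<ge> 0" for t
    proof -
      have "V' t / (2 * g t) \<le> (- 2 * a * ((g t)\<^sup>2 - \<epsilon>\<^sup>2) + 2 * b * g t * norm (\<Phi>d t)) / (2 * g t)"
      proof (intro divide_right_mono order_trans[OF V'_le] add_mono)
        show "- 2 * a * V t \<le> - 2 * a * ((g t)\<^sup>2 - \<epsilon>\<^sup>2)" by (simp add: g2)
        show "2 * b * sqrt (V t) * norm (\<Phi>d t) \<le> 2 * b * g t * norm (\<Phi>d t)"
          using ab g_ge(2)[of t] by (intro mult_right_mono mult_left_mono) auto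
      qed (use g0[of t] in simp)
      also have "\<dots> = - a * g t + a * \<epsilon> * (\<epsilon> / g t) + b * norm (\<Phi>d t)"
        using g0[of t] by (simp add: field_simps power2_eq_square)
      also have "\<dots> \<le> - a * g t + a * \<epsilon> * 1 + b * norm (\<Phi>d t)"
      proof -
        have "\<epsilon> / g t \<le> 1" using g_ge(1)[of t] g0[of t] by simp
        then have "a * \<epsilon> * (\<epsilon> / g t) \<le> a * \<epsilon> * 1" using ab \<epsilon> by (intro mult_left_mono) auto
        then show ?thesis by linarith
      qed
      finally have "V' t / (2 * g t) - \<sigma> * g t + a * g t \<le> a * \<epsilon> + b * norm (\<Phi>d t)"
        using mult_nonneg_nonneg[OF \<sigma>, of "g t"] g0[of t] by simp
      then have "exp (- \<sigma> * t) * (V' t / (2 * g t) - \<sigma> * g t + a * g t) \<le> exp (- \<sigma> * t) * (a * \<epsilon> + b * norm (\<Phi>d t))"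
        by (intro mult_left_mono) auto
      moreover have "exp (- \<sigma> * t) * (a * \<epsilon>) \<le> 1 * (a * \<epsilon>)"
        using ab \<epsilon> \<sigma> that by (intro mult_right_mono) auto
      ultimately show ?thesis by (simp add: h'_def algebra_simps)
    qed
    have cont_g: "continuous_on {0..T} g"
      unfolding g_def by (intro continuous_intros continuous_on_subset[OF cont_V]) auto
    define G where "G = integral {0..T} (\<lambda>t. exp (- \<sigma> * t) * g t)"
    have int_g: "(\<lambda>t. exp (- \<sigma> * t) * g t) integrable_on {0..T}"
      by (intro integrable_continuous_real continuous_intros cont_g)
    then have "((\<lambda>t. exp (- \<sigma> * t) * g t) has_integral G) {0..T}"
      by (simp add: G_def has_integral_iff)
    moreover have "(h' has_integral (exp (- \<sigma> * T) * g T - exp (- \<sigma> * 0) * g 0)) {0..T}"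
    proof (rule fundamental_theorem_of_calculus[OF T])
      fix t assume "t \<in> {0..T}"
      then have "t \<ge> 0" by simp
      from h'[OF this, unfolded has_real_derivative_iff_has_vector_derivative]
      show "((\<lambda>t. exp (- \<sigma> * t) * g t) has_vector_derivative h' t) (at t within {0..T})"
        by (rule has_vector_derivative_within_subset) auto
    qed
    ultimately have L: "((\<lambda>t. h' t + a * (exp (- \<sigma> * t) * g t)) has_integral
        (exp (- \<sigma> * T) * g T - exp (- \<sigma> * 0) * g 0) + a * G) {0..T}"
      by (intro has_integral_add has_integral_mult_right)
    have int_T: "(\<lambda>t. exp (- \<sigma> * t) * norm (\<Phi>d t)) integrable_on {0..T}"
      by (rule integrable_on_subinterval[OF int]) auto
    then have "((\<lambda>t. exp (- \<sigma> * t) * norm (\<Phi>d t)) has_integral integral {0..T} (\<lambda>t. exp (- \<sigma> * t) * norm (\<Phi>d t))) {0..T}"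
      by (rule integrable_integral)
    from has_integral_add[OF has_integral_const_real[of "a * \<epsilon>" 0 T] has_integral_mult_right[OF this, of b]]
    have R: "((\<lambda>t. a * \<epsilon> + b * (exp (- \<sigma> * t) * norm (\<Phi>d t))) has_integral
        a * \<epsilon> * T + b * integral {0..T} (\<lambda>t. exp (- \<sigma> * t) * norm (\<Phi>d t))) {0..T}"
      using T by (simp add: mult_ac)
    have "(exp (- \<sigma> * T) * g T - exp (- \<sigma> * 0) * g 0) + a * G \<le>
        a * \<epsilon> * T + b * integral {0..T} (\<lambda>t. exp (- \<sigma> * t) * norm (\<Phi>d t))"
      by (rule has_integral_le[OF L R]) (use ineq in auto)
    moreover have "integral {0..T} (\<lambda>t. exp (- \<sigma> * t) * norm (\<Phi>d t)) \<le> J"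
      unfolding J_def by (rule integral_subset_le[OF _ int_T int]) auto
    then have "b * integral {0..T} (\<lambda>t. exp (- \<sigma> * t) * norm (\<Phi>d t)) \<le> b * J"
      using ab(2) by (rule mult_left_mono)
    moreover have "a * \<epsilon> * T \<le> a * 1"
      using \<epsilon>(3) ab(1) by (simp only: mult.assoc) (intro mult_left_mono; simp)
    moreover have "g 0 = \<epsilon>" using \<epsilon>(1) by (simp add: g_def V_def init local_energy_def)
    moreover have "exp (- \<sigma> * T) * g T \<ge> 0" using g0[of T] by simp
    ultimately have aG: "a * G \<le> a + b * J + 1" using \<epsilon>(2) by simp
    have "sqrt m * integral {0..T} (\<lambda>t. exp (- \<sigma> * t) * norm (\<Phi> t, x t)) =
        integral {0..T} (\<lambda>t. sqrt m * (exp (- \<sigma> * t) * norm (\<Phi> t, x t)))"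
      by simp
    also have "\<dots> \<le> G"
      unfolding G_def
    proof (rule integral_le[OF _ int_g])
      show "(\<lambda>t. sqrt m * (exp (- \<sigma> * t) * norm (\<Phi> t, x t))) integrable_on {0..T}"
        by (intro integrable_continuous_real continuous_intros continuous_on_subset[OF cont_\<Phi>]
            continuous_on_subset[OF cont_x]) auto
      fix t
      have "sqrt m * norm (\<Phi> t, x t) \<le> g t" using yV[of t] g_ge(2)[of t] by linarith
      then have "exp (- \<sigma> * t) * (sqrt m * norm (\<Phi> t, x t)) \<le> exp (- \<sigma> * t) * g t"
        by (intro mult_left_mono) auto
      then show "sqrt m * (exp (- \<sigma> * t) * norm (\<Phi> t, x t)) \<le> exp (- \<sigma> * t) * g t"
        by (simp only: mult.left_commute)
    qed
    finally have "a * (sqrt m * integral {0..T} (\<lambda>t. exp (- \<sigma> * t) * norm (\<Phi> t, x t))) \<le> a + b * J + 1"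
      using aG ab(1) by (meson mult_left_mono less_imp_le order_trans)
    then show "integral {0..T} (\<lambda>t. exp (- \<sigma> * t) * norm (\<Phi> t, x t)) \<le> (a + b * J + 1) / (a * sqrt m)"
      using ab(1) mM(1) by (simp add: field_simps)
  qed
qed

text \<open>Adding the derivative of \<open>\<Phi>d\<close> to the error dynamics removes
  \<open>r\<close> and leaves the forced loop. The weighted integral bound supplies both transforms,
  and eliminating the controller state gives s F = \<Gamma> (F - Fd).\<close>

lemma local_loop_laplace:
  assumes \<Phi>d: "\<forall>t\<ge>0. (\<Phi>d has_vector_derivative r t) (at t within {0..})"
    and loop: "local_closed_loop A B C D r (\<lambda>t. 0) \<Phi> \<Phi>d x" and init: "\<Phi> 0 = 0" "x 0 = 0"
    and s: "Re s \<ge> 0" and ex: "laplace_exists \<Phi>d s"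
  shows "laplace_exists \<Phi> s"
    and "laplace \<Phi> s = - (matrix_inv (mat s - transfer_matrix A B C D s) ** transfer_matrix A B C D s)
      *v laplace \<Phi>d s"
proof -
  obtain w where "\<forall>t\<ge>0. ((\<lambda>t. \<Phi> t - \<Phi>d t) has_vector_derivative (w t - r t)) (at t within {0..}) \<and>
      (x has_vector_derivative (A *v x t + B *v (\<Phi> t - \<Phi>d t))) (at t within {0..}) \<and>
      w t = 0 + C *v x t + D *v (\<Phi> t - \<Phi>d t)"
    using loop unfolding local_closed_loop_def by blast
  then have w: "((\<lambda>t. \<Phi> t - \<Phi>d t) has_vector_derivative (w t - r t)) (at t within {0..})"
    "(x has_vector_derivative (A *v x t + B *v (\<Phi> t - \<Phi>d t))) (at t within {0..})"
    "w t = C *v x t + D *v (\<Phi> t - \<Phi>d t)" if "t \<ge> 0" for t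
    using that by auto
  have \<Phi>': "(\<Phi> has_vector_derivative C *v x t + D *v (\<Phi> t - \<Phi>d t)) (at t within {0..})" if "t \<ge> 0" for t
    using has_vector_derivative_add[OF w(1)[OF that] \<Phi>d[rule_format, OF that]] w(3)[OF that] by simp
  have cont: "continuous_on {0..} \<Phi>" "continuous_on {0..} x"
    unfolding continuous_on_eq_continuous_within
    using \<Phi>' w(2) has_vector_derivative_continuous by fastforce+
  have "\<exists>H. \<forall>T\<ge>0. integral {0..T} (\<lambda>t. exp (- Re s * t) * norm (\<Phi> t, x t)) \<le> H"
    using forced_local_loop_integral_bound[of \<Phi> x \<Phi>d "Re s", OF \<Phi>' w(2) init s laplace_exists_imp_integrable[OF ex]]
    by metis
  then obtain H where H: "integral {0..T} (\<lambda>t. exp (- Re s * t) * norm (\<Phi> t, x t)) \<le> H" if "T \<ge> 0" for T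
    by blast
  have int: "(\<lambda>t. exp (- Re s * t) * norm (\<Phi> t, x t)) integrable_on {0..}"
    by (rule nonneg_integrable_on_atLeast[OF _ _ H]) (auto intro!: continuous_intros cont)
  show ex\<Phi>: "laplace_exists \<Phi> s"
    by (rule laplace_existsI[OF cont(1) int]) (simp add: norm_fst_le)
  have exx: "laplace_exists x s"
    by (rule laplace_existsI[OF cont(2) int]) (simp add: norm_snd_le)
  define F where "F = laplace \<Phi> s"
  define X where "X = laplace x s"
  define Fd where "Fd = laplace \<Phi>d s"
  define \<Gamma> where "\<Gamma> = transfer_matrix A B C D s"
  note exe = laplace_diff[OF ex\<Phi> ex]
  \<comment> \<open>General \<open>M\<close> and \<open>N\<close> cover the right-hand sides of both
    differential equations, including the existence of their transforms, which
    \<open>laplace_derivative\<close> requires.\<close>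
  have io: "laplace_exists (\<lambda>t. M *v x t + N *v (\<Phi> t - \<Phi>d t)) s"
    "laplace (\<lambda>t. M *v x t + N *v (\<Phi> t - \<Phi>d t)) s = complex_matrix M *v X + complex_matrix N *v (F - Fd)"
    for M :: "real^'n^'q" and N :: "real^3^'q"
    using laplace_add[OF laplace_mult_vec(1)[OF exx] laplace_mult_vec(1)[OF exe(1)], of M N]
    by (simp_all add: laplace_mult_vec(2)[OF exx] laplace_mult_vec(2)[OF exe(1)] exe(2) X_def F_def Fd_def)
  have eqF: "complex_matrix C *v X + complex_matrix D *v (F - Fd) = s *s F"
    using laplace_derivative[OF \<Phi>' init(1) ex\<Phi> io(1)] by (simp only: io(2) F_def)
  have "complex_matrix A *v X + complex_matrix B *v (F - Fd) = s *s X"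
    using laplace_derivative[OF w(2) init(2) exx io(1)] by (simp only: io(2) X_def)
  then have "(mat s - complex_matrix A) *v X = complex_matrix B *v (F - Fd)"
    by (simp add: matrix_vector_mult_diff_rdistrib mat_mult_vec algebra_simps)
  then have "X = matrix_inv (mat s - complex_matrix A) *v (complex_matrix B *v (F - Fd))"
    using invertible_matrix_inv(1)[OF resolvent_invertible[OF s]]
    by (metis matrix_vector_mul_assoc matrix_vector_mul_lid)
  then have "s *s F = \<Gamma> *v (F - Fd)"
    using eqF by (simp add: \<Gamma>_def transfer_matrix_def matrix_vector_mult_add_rdistrib matrix_vector_mul_assoc[symmetric])
  then have "(mat s - \<Gamma>) *v F = - (\<Gamma> *v Fd)"
    by (simp add: matrix_vector_mult_diff_rdistrib matrix_vector_mult_diff_distrib mat_mult_vec)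
  then have "F = matrix_inv (mat s - \<Gamma>) *v (- (\<Gamma> *v Fd))"
    using invertible_matrix_inv(1)[OF transfer_invertible[OF s]]
    by (metis \<Gamma>_def matrix_vector_mul_assoc matrix_vector_mul_lid)
  also have "\<dots> = - (matrix_inv (mat s - \<Gamma>) ** \<Gamma>) *v Fd"
  proof -
    have "M *v (- v) = - (M *v v)" "(- M) *v v = - (M *v v)" for M :: "complex^3^3" and v
      by (simp_all add: matrix_vector_mult_def vec_eq_iff sum_negf)
    then show ?thesis by (simp add: matrix_vector_mul_assoc)
  qed
  finally show "laplace \<Phi> s = - (matrix_inv (mat s - transfer_matrix A B C D s) ** transfer_matrix A B C D s)
      *v laplace \<Phi>d s"
    unfolding F_def Fd_def \<Gamma>_def .
qed

end

theorem theorem1: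
  fixes A :: "real^'n^'n" and B :: "real^3^'n" and C :: "real^'n^3" and D :: "real^3^3"
    and Rd :: "real \<Rightarrow> real^3^3" and wd :: "real \<Rightarrow> real^3"
  assumes desired: "attitude_kinematics Rd wd"
    and lmi: "\<exists>P. positive_definite P \<and> negative_definite (Q_matrix A B C D P)"
  shows
    "(\<forall>R w. attitude_kinematics R w \<longrightarrow>
        attitude_kinematics (\<lambda>t. transpose (Rd t) ** R t)
          (\<lambda>t. w t - transpose (transpose (Rd t) ** R t) *v wd t))
     \<and>
     almost_globally_asymptotically_stable (3 + CARD('n)) (SO3 \<times> UNIV)
       (closed_loop_trajectories A B C D wd) (mat 1, 0)
     \<and>
     (\<forall>r \<Phi> \<Phi>d x. local_closed_loop A B C D r r \<Phi> \<Phi>d x \<longrightarrow>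
        (\<Phi> 0 = \<Phi>d 0 \<and> x 0 = 0 \<longrightarrow> (\<forall>t\<ge>0. \<Phi> t = \<Phi>d t)) \<and>
        ((\<lambda>t. \<Phi> t - \<Phi>d t) \<longlongrightarrow> 0) at_top)
     \<and>
     (\<forall>r \<Phi> \<Phi>d x.
        (\<forall>t\<ge>0. (\<Phi>d has_vector_derivative r t) (at t within {0..})) \<and>
        local_closed_loop A B C D r (\<lambda>t. 0) \<Phi> \<Phi>d x \<and> \<Phi> 0 = 0 \<and> x 0 = 0 \<longrightarrow>
        (\<forall>s. Re s \<ge> 0 \<and> laplace_exists \<Phi>d s \<longrightarrow>
           laplace_exists \<Phi> s \<and>
           invertible (mat s - complex_matrix A) \<and>
           invertible (mat s - transfer_matrix A B C D s) \<and>
           laplace \<Phi> s =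
             - (matrix_inv (mat s - transfer_matrix A B C D s) ** transfer_matrix A B C D s)
               *v laplace \<Phi>d s))"
proof -
  obtain P where "positive_definite P" "negative_definite (Q_matrix A B C D P)"
    using lmi by blast
  then interpret ndi_lmi A B C D P by unfold_locales
  show ?thesis
  proof (intro conjI allI impI)
    fix R w assume "attitude_kinematics R w"
    then show "attitude_kinematics (\<lambda>t. transpose (Rd t) ** R t)
        (\<lambda>t. w t - transpose (transpose (Rd t) ** R t) *v wd t)"
      by (rule attitude_kinematics_error[OF desired])
  next
    show "almost_globally_asymptotically_stable (3 + CARD('n)) (SO3 \<times> UNIV)
        (closed_loop_trajectories A B C D wd) (mat 1, 0)"
      by (rule loop_almost_globally_asymptotically_stable)
  next
    fix r \<Phi> \<Phi>d x t
    assume "local_closed_loop A B C D r r \<Phi> \<Phi>d x" "\<Phi> 0 = \<Phi>d 0 \<and> x 0 = 0" "(0::real) \<le> t"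
    then show "\<Phi> t = \<Phi>d t" using local_loop_tracking(1) by blast
  next
    fix r \<Phi> \<Phi>d x
    assume "local_closed_loop A B C D r r \<Phi> \<Phi>d x"
    then show "((\<lambda>t. \<Phi> t - \<Phi>d t) \<longlongrightarrow> 0) at_top" by (rule local_loop_tracking(2))
  next
    fix r \<Phi> \<Phi>d x s
    assume loop: "(\<forall>t\<ge>0. (\<Phi>d has_vector_derivative r t) (at t within {0..})) \<and>
        local_closed_loop A B C D r (\<lambda>t. 0) \<Phi> \<Phi>d x \<and> \<Phi> 0 = 0 \<and> x 0 = 0"
      and s: "Re s \<ge> 0 \<and> laplace_exists \<Phi>d s"
    show "laplace_exists \<Phi> s"
      by (rule local_loop_laplace(1)[of \<Phi>d r \<Phi> x]) (use loop s in auto)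
    show "laplace \<Phi> s = - (matrix_inv (mat s - transfer_matrix A B C D s) ** transfer_matrix A B C D s)
        *v laplace \<Phi>d s"
      by (rule local_loop_laplace(2)[of \<Phi>d r \<Phi> x]) (use loop s in auto)
    show "invertible (mat s - complex_matrix A)" using s by (intro resolvent_invertible) simp
    show "invertible (mat s - transfer_matrix A B C D s)" using s by (intro transfer_invertible) simp
  qed
qed

end
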